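(* Let $\phi_1,\ldots,\phi_m$ be analytic self-maps of $B_N$ which induce bounded composition operators on $\mathcal{H}$, where $\mathcal{H}$ is the Hardy space $H^2(B_N)$ or a weighted Bergman space $A^2_s(B_N)$ ($s>-1$). Then for any complex numbers $c_1,\ldots,c_m$ and any $\zeta\in\partial B_N$, $$\|c_1C_{\phi_1}+\cdots+c_mC_{\phi_m}\|_e^2\ \ge\ \sum_{d_{\phi_j}(\zeta)<\infty}\ \Bigl|\sum_{\substack{\phi_l(\zeta)=\phi_j(\zeta)\\ d_{\phi_l}(\zeta)=d_{\phi_j}(\zeta)}} c_l\Bigr|^2\,\frac{1}{d_{\phi_j}(\zeta)^{\beta}},$$ where the outer sum is over the indices $j\in\{1,\ldots,m\}$ with $d_{\phi_j}(\zeta)<\infty$, the inner sum is over the indices $l\in\{1,\ldots,m\}$ satisfying the two displayed conditions, and $\beta=N$ for $H^2(B_N)$, $\beta=N+s+1$ for $A^2_s(B_N)$.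
   Context: $B_N$ is the open unit ball of $\mathbb{C}^N$, $\partial B_N$ the unit sphere, $\sigma$ normalized Lebesgue measure on $\partial B_N$, $\nu$ normalized Lebesgue volume measure on $B_N$. $H^2(B_N)$ is the Hilbert space of holomorphic $f$ on $B_N$ with $\|f\|_2^2=\sup_{0<r<1}\int_{\partial B_N}|f(r\zeta)|^2\,d\sigma(\zeta)<\infty$. For $s>-1$, $A^2_s(B_N)$ is the Hilbert space of holomorphic $f$ on $B_N$ with $\|f\|_{2,s}^2=\int_{B_N}|f(z)|^2 w_s(z)\,d\nu(z)<\infty$, where $w_s(z)=\frac{\Gamma(N+s+1)}{\Gamma(N+1)\Gamma(s+1)}(1-|z|^2)^s$. For an analytic map $\phi:B_N\to B_N$, the composition operator is $C_\phi f=f\circ\phi$. The essential norm of a bounded operator $T$ on $\mathcal{H}$ is $\|T\|_e=\inf\{\|T-K\|: K \text{ compact on }\mathcal{H}\}$. For $\zeta\in\partial B_N$, $$d_\phi(\zeta)=\liminf_{z\to\zeta}\frac{1-|\phi(z)|}{1-|z|},$$ where $z$ tends to $\zeta$ unrestrictedly in $B_N$, and $\phi(\zeta):=\lim_{r\to1^-}\phi(r\zeta)$ denotes the radial limit; by the Julia–Carathéodory theorem in $B_N$ this radial limit exists and lies in $\partial B_N$ whenever $d_\phi(\zeta)<\infty$.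
   Formalization: The outer sum is taken once per distinct pair (φ_j(ζ), d_{φ_j}(ζ)) with d_{φ_j}(ζ)<∞, not once per index j; with repetition the inequality fails for φ_1=φ_2=identity, c_1=c_2=1 (4 ≥ 8). *)

theory Defs
  imports "HOL-Analysis.Analysis"
begin

abbreviation unit_ball :: "(complex ^ 'n) set"
  where "unit_ball \<equiv> ball 0 1"

text \<open>Holomorphy in several variables: complex (Frechet) differentiability at every point
  of the open set \<open>S\<close>.\<close>

definition holomorphic_mv :: "(complex ^ 'n \<Rightarrow> complex) \<Rightarrow> (complex ^ 'n) set \<Rightarrow> bool"
  where "holomorphic_mv f S \<longleftrightarrow>
    (\<forall>z\<in>S. \<exists>D. (f has_derivative D) (at z) \<and> (\<forall>a v. D (a *s v) = a * D v))"

definition analytic_self_map :: "(complex ^ 'n \<Rightarrow> complex ^ 'n) \<Rightarrow> bool"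
  where "analytic_self_map \<phi> \<longleftrightarrow>
    \<phi> ` unit_ball \<subseteq> unit_ball \<and> (\<forall>i. holomorphic_mv (\<lambda>z. \<phi> z $ i) unit_ball)"

definition ball_measure :: "(complex ^ 'n) measure"
  where "ball_measure = uniform_measure lborel unit_ball"

text \<open>Normalized surface measure as cone measure: the measure of \<open>A\<close> is the
  normalized volume of the cone \<open>{r \<zeta> | 0 < r < 1, \<zeta> \<in> A}\<close>. Here \<open>sgn z = z / |z|\<close>;
  the measure lives on the Borel sets of the whole space and is concentrated on the unit sphere.\<close>

definition sphere_measure :: "(complex ^ 'n) measure"
  where "sphere_measure = distr ball_measure borel sgn"

definition bergman_weight :: "real \<Rightarrow> complex ^ 'n \<Rightarrow> real"
  where "bergman_weight s z =
    Gamma (real CARD('n) + s + 1) / (Gamma (real CARD('n) + 1) * Gamma (s + 1))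
      * (1 - (norm z)\<^sup>2) powr s"

text \<open>\<open>Hardy\<close> stands for the Hardy space \<open>H\<^sup>2\<close> of the ball and \<open>Bergman s\<close> for the weighted Bergman space with weight
  \<open>bergman_weight s\<close> (meaningful for \<open>s > -1\<close>).
  The squared norms are computed in \<open>ennreal\<close>, so that they make sense before
  membership in the space is known.\<close>

datatype fspace = Hardy | Bergman real

fun admissible :: "fspace \<Rightarrow> bool"
  where
    "admissible Hardy \<longleftrightarrow> True"
  | "admissible (Bergman s) \<longleftrightarrow> s > -1"

fun sqnorm :: "fspace \<Rightarrow> (complex ^ 'n \<Rightarrow> complex) \<Rightarrow> ennreal"
  where
    "sqnorm Hardy f =
       (SUP r\<in>{0<..<1}. \<integral>\<^sup>+ \<zeta>. ennreal ((cmod (f (r *\<^sub>R \<zeta>)))\<^sup>2) \<partial>sphere_measure)"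
  | "sqnorm (Bergman s) f =
       (\<integral>\<^sup>+ z. ennreal ((cmod (f z))\<^sup>2 * bergman_weight s z) \<partial>ball_measure)"

text \<open>A function on the ball is represented by its extension by \<open>0\<close> to the whole space,
  so that equality in HOL is equality of functions on the ball.\<close>

definition carrier_of :: "fspace \<Rightarrow> (complex ^ 'n \<Rightarrow> complex) set"
  where "carrier_of X =
    {f. holomorphic_mv f unit_ball \<and> (\<forall>z. z \<notin> unit_ball \<longrightarrow> f z = 0) \<and> sqnorm X f < \<infinity>}"

definition fnorm :: "fspace \<Rightarrow> (complex ^ 'n \<Rightarrow> complex) \<Rightarrow> real"
  where "fnorm X f = sqrt (enn2real (sqnorm X f))"

definition linear_op ::
  "fspace \<Rightarrow> ((complex ^ 'n \<Rightarrow> complex) \<Rightarrow> (complex ^ 'n \<Rightarrow> complex)) \<Rightarrow> bool"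
  where "linear_op X T \<longleftrightarrow>
    (\<forall>f\<in>carrier_of X. T f \<in> carrier_of X) \<and>
    (\<forall>f\<in>carrier_of X. \<forall>g\<in>carrier_of X. \<forall>a b.
       T (\<lambda>z. a * f z + b * g z) = (\<lambda>z. a * T f z + b * T g z))"

definition bounded_op ::
  "fspace \<Rightarrow> ((complex ^ 'n \<Rightarrow> complex) \<Rightarrow> (complex ^ 'n \<Rightarrow> complex)) \<Rightarrow> bool"
  where "bounded_op X T \<longleftrightarrow>
    linear_op X T \<and> (\<exists>C. \<forall>f\<in>carrier_of X. fnorm X (T f) \<le> C * fnorm X f)"

text \<open>Sequential form: the image of the closed unit ball is relatively compact.\<close>

definition compact_op ::
  "fspace \<Rightarrow> ((complex ^ 'n \<Rightarrow> complex) \<Rightarrow> (complex ^ 'n \<Rightarrow> complex)) \<Rightarrow> bool"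
  where "compact_op X K \<longleftrightarrow>
    linear_op X K \<and>
    (\<forall>f :: nat \<Rightarrow> complex ^ 'n \<Rightarrow> complex.
       (\<forall>k. f k \<in> carrier_of X \<and> fnorm X (f k) \<le> 1) \<longrightarrow>
       (\<exists>r g. strict_mono r \<and> g \<in> carrier_of X \<and>
          (\<lambda>k. fnorm X (\<lambda>z. K (f (r k)) z - g z)) \<longlonglongrightarrow> 0))"

definition op_norm ::
  "fspace \<Rightarrow> ((complex ^ 'n \<Rightarrow> complex) \<Rightarrow> (complex ^ 'n \<Rightarrow> complex)) \<Rightarrow> real"
  where "op_norm X T = (SUP f\<in>{f \<in> carrier_of X. fnorm X f \<le> 1}. fnorm X (T f))"

definition ess_norm ::
  "fspace \<Rightarrow> ((complex ^ 'n \<Rightarrow> complex) \<Rightarrow> (complex ^ 'n \<Rightarrow> complex)) \<Rightarrow> real"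
  where "ess_norm X T = (INF K\<in>{K. compact_op X K}. op_norm X (\<lambda>f z. T f z - K f z))"

definition comp_op ::
  "(complex ^ 'n \<Rightarrow> complex ^ 'n) \<Rightarrow> (complex ^ 'n \<Rightarrow> complex) \<Rightarrow> (complex ^ 'n \<Rightarrow> complex)"
  where "comp_op \<phi> f = (\<lambda>z. if z \<in> unit_ball then f (\<phi> z) else 0)"

definition ang_dilation :: "(complex ^ 'n \<Rightarrow> complex ^ 'n) \<Rightarrow> complex ^ 'n \<Rightarrow> ereal"
  where "ang_dilation \<phi> \<zeta> =
    Liminf (at \<zeta> within unit_ball) (\<lambda>z. ereal ((1 - norm (\<phi> z)) / (1 - norm z)))"

text \<open>An unspecified value if the radial limit does not exist.\<close>

definition radial_lim :: "(complex ^ 'n \<Rightarrow> complex ^ 'n) \<Rightarrow> complex ^ 'n \<Rightarrow> complex ^ 'n"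
  where "radial_lim \<phi> \<zeta> = Lim (at_left 1) (\<lambda>r. \<phi> (r *\<^sub>R \<zeta>))"

fun kernel_exponent :: "fspace \<Rightarrow> nat \<Rightarrow> real"
  where
    "kernel_exponent Hardy N = real N"
  | "kernel_exponent (Bergman s) N = real N + s + 1"

text \<open>The pairs \<open>(\<phi>\<^sub>j(\<zeta>), d\<^sub>j(\<zeta>))\<close> of first-order data with finite \<open>d\<^sub>j(\<zeta>)\<close>.
  A set, so a pair shared by several of the maps occurs once: summing over the indices \<open>j\<close>
  instead would count its term repeatedly, and the lower bound would already fail for
  \<open>\<phi>\<^sub>1 = \<phi>\<^sub>2 = id\<close>.\<close>

definition boundary_data ::
  "nat \<Rightarrow> (nat \<Rightarrow> complex ^ 'n \<Rightarrow> complex ^ 'n) \<Rightarrow> complex ^ 'n \<Rightarrow> ((complex ^ 'n) \<times> ereal) set"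
  where "boundary_data m \<phi> \<zeta> =
    (\<lambda>j. (radial_lim (\<phi> j) \<zeta>, ang_dilation (\<phi> j) \<zeta>)) `
      {j \<in> {1..m}. ang_dilation (\<phi> j) \<zeta> < \<infinity>}"

end

theory Submission
  imports Defs "HOL-Complex_Analysis.Complex_Analysis"
begin

text \<open>
  With \<open>\<beta>\<close> the kernel exponent, the reproducing kernels are \<open>(1 - \<langle>z, p\<rangle>) powr -\<beta>\<close>. Test \<open>T - K\<close> on
  the combination \<open>f\<close> of the kernels at the points \<open>p = (1 - d t (1 + i M)) \<eta>\<close>, one for each pair \<open>(\<eta>, d)\<close> of
  boundary data, the coefficient being the conjugate of the corresponding sum of the \<open>c\<^sub>l\<close>, and evaluate at
  \<open>w = (1 - t (1 + i M)) \<zeta>\<close> as \<open>t \<rightarrow> 0\<close>. By the Julia-Caratheodory theorem \<open>1 - \<langle>\<phi>\<^sub>j w, \<eta>\<^sub>j\<rangle>\<close> is asymptotic to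
  \<open>d\<^sub>j t (1 + i M)\<close>, so \<open>t powr \<beta> * T f w\<close> and \<open>t powr \<beta> * \<parallel>f\<parallel>\<^sup>2\<close> have the same limit \<open>Q\<close>. Compactness
  makes \<open>K f / \<parallel>f\<parallel>\<close> converge in norm along a sequence, while \<open>|g w|\<^sup>2 (1 - |w|\<^sup>2) powr \<beta> \<rightarrow> 0\<close> for every
  fixed \<open>g\<close>; the sharp estimate \<open>|g w|\<^sup>2 (1 - |w|\<^sup>2) powr \<beta> \<le> \<parallel>g\<parallel>\<^sup>2\<close> for \<open>g = (T - K) f\<close> then gives
  \<open>2 powr \<beta> * Q \<le> \<parallel>T - K\<parallel>\<^sup>2\<close>. As \<open>M \<rightarrow> \<infinity>\<close>, kernels with the same \<open>\<eta>\<close> and different \<open>d\<close> become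
  orthogonal and \<open>2 powr \<beta> * Q\<close> tends to the claimed sum.

  The point estimates are only needed on the slice through \<open>\<zeta>\<close>. Averaging over rotations bounds the norm of
  \<open>g\<close> from below by a weighted \<open>l\<^sup>2\<close> norm of the Taylor coefficients of the slice function, with the moments of
  \<open>|\<langle>z, \<zeta>\<rangle>|\<close> as weights; these are found from a Gaussian integral.
\<close>

section \<open>Lebesgue measure and rotations\<close>

text \<open>The test function imitates the adjoint of \<open>T\<close> applied to the kernel at
  \<open>w\<close>: the adjoint of a composition operator sends the kernel at \<open>w\<close> to
  the kernel at the image of \<open>w\<close>, so one gets kernels at the points
  \<open>\<phi> j w\<close> with coefficients \<open>cnj (c j)\<close>. Explicit points with the
  same first-order behaviour replace these images; this explains the factor \<open>d\<close> in
  \<open>p\<close> and the conjugates. The factor \<open>2 powr \<beta>\<close> is the limit of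
  \<open>((1 - |w|^2) / t) powr \<beta>\<close>.

  The obstacle is a pair of maps with equal \<open>\<eta>\<close> and different \<open>d\<close>. On
  the radius, \<open>M = 0\<close>, the rescaled pairing of their kernels is
  \<open>(d + d') powr (- \<beta>)\<close> and \<open>Q\<close> is not diagonal. The slope
  \<open>M\<close> adds the imaginary part \<open>(d' - d) * M\<close> to the base and makes the
  pairing small, while the diagonal entries stay the same. This is why nontangential limits are
  required.

  No inner product of functions is used. Two one-sided estimates replace the reproducing property:
  point values are bounded by norms, and norms of kernel combinations by Gram sums, up to an error
  that vanishes after rescaling.\<close>

lemma nn_integral_lborel_affine:
  fixes f :: "'a::euclidean_space \<Rightarrow> ennreal"
  assumes [measurable]: "f \<in> borel_measurable borel" and c: "c \<noteq> 0"
  shows "(\<integral>\<^sup>+x. f x \<partial>lborel) = ennreal (\<bar>c\<bar> ^ DIM('a)) * (\<integral>\<^sup>+x. f (t + c *\<^sub>R x) \<partial>lborel)"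
  by (subst lborel_affine[OF c, of t])
     (simp add: nn_integral_density nn_integral_distr nn_integral_cmult)

lemma nn_integral_lborel_translate:
  fixes f :: "'a::euclidean_space \<Rightarrow> ennreal"
  assumes "f \<in> borel_measurable borel"
  shows "(\<integral>\<^sup>+x. f (x + t) \<partial>lborel) = (\<integral>\<^sup>+x. f x \<partial>lborel)"
  using nn_integral_lborel_affine[OF assms, of 1 t] by (simp add: add.commute)

text \<open>Uniqueness of Haar measure: the image measure is translation invariant, and Fubini's
  theorem compares it with Lebesgue measure via the unit ball, which the map preserves.\<close>

lemma lborel_distr_orthogonal:
  fixes U :: "'a::euclidean_space \<Rightarrow> 'a"
  assumes U: "orthogonal_transformation U"
  shows "distr lborel borel U = lborel"
proof -
  define M where "M = distr lborel borel U"
  have lin: "linear U" and bij: "bij U"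
    using U by (auto simp: orthogonal_transformation_linear orthogonal_transformation_bij)
  have contU: "continuous_on UNIV U"
    using lin by (simp add: linear_continuous_on linear_conv_bounded_linear)
  have [measurable]: "U \<in> borel_measurable borel"
    using contU by (rule borel_measurable_continuous_onI)
  have setsM [measurable_cong]: "sets M = sets borel" by (simp add: M_def)
  have spM: "space M = UNIV" by (simp add: M_def)
  have ball: "emeasure M (ball 0 r) = emeasure lborel (ball (0::'a) r)" for r
  proof -
    have "U -` ball 0 r = ball 0 r"
      using U by (auto simp: orthogonal_transformation_norm)
    then show ?thesis by (simp add: M_def emeasure_distr)
  qed
  have fin: "emeasure lborel (ball (0::'a) r) < \<infinity>" for r
    using emeasure_bounded_finite[of "ball (0::'a) r"] by simp
  interpret M: sigma_finite_measure M
  proof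
    show "\<exists>A. countable A \<and> A \<subseteq> sets M \<and> \<Union> A = space M \<and> (\<forall>a\<in>A. emeasure M a \<noteq> \<infinity>)"
    proof (intro exI[of _ "(\<lambda>n::nat. ball 0 (real n)) ` UNIV"] conjI ballI)
      show "\<Union> ((\<lambda>n. ball 0 (real n)) ` UNIV) = space M"
        using reals_Archimedean2 by (auto simp: spM)
      show "emeasure M a \<noteq> \<infinity>" if a: "a \<in> range (\<lambda>n::nat. ball 0 (real n))" for a
        using a fin ball by (auto simp: less_top)
    qed (auto simp: setsM)
  qed
  have trM: "(\<integral>\<^sup>+x. f (x + a) \<partial>M) = (\<integral>\<^sup>+x. f x \<partial>M)"
    if [measurable]: "f \<in> borel_measurable borel" for f :: "'a \<Rightarrow> ennreal" and a
  proof -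
    obtain b where b: "a = U b" using bij by (metis bij_pointE)
    have "(\<integral>\<^sup>+x. f (x + a) \<partial>M) = (\<integral>\<^sup>+x. f (U (x + b)) \<partial>lborel)"
      by (simp add: M_def nn_integral_distr b linear_add[OF lin])
    also have "\<dots> = (\<integral>\<^sup>+x. f (U x) \<partial>lborel)"
      by (rule nn_integral_lborel_translate) measurable
    finally show ?thesis by (simp add: M_def nn_integral_distr)
  qed
  interpret P: pair_sigma_finite lborel M ..
  have "M = lborel"
  proof (rule measure_eqI)
    fix A assume "A \<in> sets M"
    then have [measurable]: "A \<in> sets borel" by (simp add: setsM)
    define iA iB :: "'a \<Rightarrow> ennreal" where "iA = indicator A" and "iB = indicator (ball 0 1)"
    have [measurable]: "iA \<in> borel_measurable borel" "iB \<in> borel_measurable borel"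
      unfolding iA_def iB_def by (rule borel_measurable_indicator; simp)+
    have iA: "(\<integral>\<^sup>+x. iA x \<partial>lborel) = emeasure lborel A" "(\<integral>\<^sup>+x. iA x \<partial>M) = emeasure M A"
      by (simp_all add: iA_def setsM)
    have iB: "(\<integral>\<^sup>+x. iB x \<partial>lborel) = emeasure lborel (ball (0::'a) 1)"
      "(\<integral>\<^sup>+x. iB x \<partial>M) = emeasure lborel (ball (0::'a) 1)"
      by (simp_all add: iB_def setsM ball)
    have "emeasure lborel (ball (0::'a) 1) * emeasure lborel A = (\<integral>\<^sup>+y. iB y * (\<integral>\<^sup>+x. iA x \<partial>lborel) \<partial>M)"
      by (simp add: nn_integral_multc iA iB)
    also have "\<dots> = (\<integral>\<^sup>+y. (\<integral>\<^sup>+x. iB y * iA (x + y) \<partial>lborel) \<partial>M)"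
      by (simp add: nn_integral_cmult nn_integral_lborel_translate)
    also have "\<dots> = (\<integral>\<^sup>+x. (\<integral>\<^sup>+y. iB y * iA (x + y) \<partial>M) \<partial>lborel)"
      by (rule P.Fubini') measurable
    \<comment> \<open>Invariance of \<open>M\<close> under the shift by \<open>- x\<close> frees
      \<open>A\<close> from \<open>x\<close>. By symmetry of the ball the other factor is, as a
      function of \<open>x\<close>, the indicator of a translated ball, so its Lebesgue integral
      does not depend on \<open>y\<close>.\<close>
    also have "\<dots> = (\<integral>\<^sup>+x. (\<integral>\<^sup>+y. iB (y + - x) * iA (x + (y + - x)) \<partial>M) \<partial>lborel)"
      by (rule nn_integral_cong, rule trM[symmetric]) measurable
    also have "\<dots> = (\<integral>\<^sup>+x. (\<integral>\<^sup>+y. iB (y - x) * iA y \<partial>M) \<partial>lborel)"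
      by simp
    also have "\<dots> = (\<integral>\<^sup>+y. (\<integral>\<^sup>+x. iB (y - x) * iA y \<partial>lborel) \<partial>M)"
      by (rule P.Fubini'[symmetric]) measurable
    also have "\<dots> = (\<integral>\<^sup>+y. (\<integral>\<^sup>+x. iB (x + - y) \<partial>lborel) * iA y \<partial>M)"
      by (subst nn_integral_multc[symmetric])
        (measurable, simp add: iB_def indicator_def dist_norm norm_minus_commute)
    also have "\<dots> = emeasure lborel (ball (0::'a) 1) * emeasure M A"
      by (subst nn_integral_lborel_translate) (measurable, simp add: nn_integral_cmult iA iB)
    finally have "emeasure lborel (ball (0::'a) 1) * emeasure lborel A
        = emeasure lborel (ball (0::'a) 1) * emeasure M A" .
    moreover have "emeasure lborel (ball (0::'a) 1) \<noteq> 0"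
      by (simp add: emeasure_ball unit_ball_vol_pos less_imp_neq[symmetric] ennreal_eq_0_iff not_le)
    ultimately show "emeasure M A = emeasure lborel A"
      using fin[of 1] by (auto simp: ennreal_mult_cancel_left)
  qed (simp add: setsM)
  then show ?thesis by (simp add: M_def)
qed

section \<open>Parseval's identity on the circle\<close>

text \<open>Orthogonality of the characters proves the identity for partial sums. Absolute
  summability bounds all of them by the constant \<open>S\<close>, so dominated convergence applies.
  The values are in \<open>ennreal\<close> because the identity is used inside further
  integrals.\<close>

lemma parseval_circle:
  fixes a :: "nat \<Rightarrow> complex"
  assumes sa: "summable (\<lambda>k. cmod (a k))"
  shows "(\<integral>\<^sup>+\<theta>. ennreal ((cmod (\<Sum>k. a k * cis \<theta> ^ k))\<^sup>2) * indicator {0..2*pi} \<theta> \<partial>lborel)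
    = ennreal (2 * pi) * (\<Sum>k. ennreal ((cmod (a k))\<^sup>2))"
proof -
  define p where "p n \<theta> = (\<Sum>k<n. a k * cis \<theta> ^ k)" for n \<theta>
  define h where "h \<theta> = (\<Sum>k. a k * cis \<theta> ^ k)" for \<theta>
  define S where "S = (\<Sum>k. cmod (a k))"
  have sm: "summable (\<lambda>k. a k * cis \<theta> ^ k)" for \<theta>
    by (rule summable_norm_cancel) (simp add: norm_mult norm_power sa)
  have plim: "(\<lambda>n. p n \<theta>) \<longlonglongrightarrow> h \<theta>" for \<theta>
    unfolding p_def h_def using sm by (rule summable_LIMSEQ)
  have pb: "cmod (p n \<theta>) \<le> S" for n \<theta>
  proof -
    have "cmod (p n \<theta>) \<le> (\<Sum>k<n. cmod (a k))"
      unfolding p_def by (rule order_trans[OF norm_sum]) (simp add: norm_mult norm_power)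
    also have "\<dots> \<le> S" unfolding S_def by (rule sum_le_suminf) (auto simp: sa)
    finally show ?thesis .
  qed
  have meas [measurable]: "p n \<in> borel_measurable borel" for n
    unfolding p_def[abs_def] by (intro borel_measurable_continuous_onI continuous_intros)
  have [measurable]: "h \<in> borel_measurable borel"
    by (rule borel_measurable_LIMSEQ_metric[where f=p]) (use plim in auto)
  have orth: "((\<lambda>\<theta>. cis \<theta> ^ j * cnj (cis \<theta> ^ k)) has_integral (if j = k then 2*pi else 0)) {0..2*pi}"
    for j k
  proof (cases "j = k")
    case True
    have "cis \<theta> ^ k * cnj (cis \<theta> ^ k) = 1" for \<theta>
      by (simp add: complex_norm_square[symmetric] norm_power del: complex_cnj_power)
    then show ?thesis
      using True has_integral_const_real[of "1::complex" 0 "2*pi"] by (simp add: scaleR_conv_of_real)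
  next
    case False
    define m where "m = real j - real k"
    have m0: "m \<noteq> 0" using False by (simp add: m_def)
    have eq: "cis \<theta> ^ j * cnj (cis \<theta> ^ k) = exp (\<i> * m * \<theta>)" for \<theta>
    proof -
      have "cis \<theta> ^ j * cnj (cis \<theta> ^ k) = cis (m * \<theta>)"
        by (simp add: Complex.DeMoivre cis_cnj cis_mult m_def algebra_simps)
      then show ?thesis by (simp add: cis_conv_exp mult_ac)
    qed
    have D: "((\<lambda>\<theta>. exp (\<i> * m * of_real \<theta>) / (\<i> * m)) has_vector_derivative exp (\<i> * m * \<theta>)) (at \<theta> within A)" for \<theta> A
    proof (rule has_vector_derivative_real_field)
      show "((\<lambda>z. exp (\<i> * m * z) / (\<i> * m)) has_field_derivative exp (\<i> * m * \<theta>)) (at (of_real \<theta>))"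
        using m0 by (auto intro!: derivative_eq_intros)
    qed
    have per: "exp (\<i> * m * of_real (2*pi)) = 1"
    proof -
      have "Re (\<i> * m * of_real (2*pi)) = 0" "Im (\<i> * m * of_real (2*pi)) = of_int (2 * (int j - int k)) * pi"
        by (simp_all add: m_def algebra_simps)
      then show ?thesis unfolding exp_eq_1 by blast
    qed
    have "((\<lambda>\<theta>. exp (\<i> * m * of_real \<theta>)) has_integral
      (exp (\<i> * m * of_real (2*pi)) / (\<i> * m) - exp (\<i> * m * of_real 0) / (\<i> * m))) {0..2*pi}"
      by (rule fundamental_theorem_of_calculus) (use D in auto)
    then show ?thesis using False by (simp only: eq per) simp
  qed
  have "((\<lambda>\<theta>. p n \<theta> * cnj (p n \<theta>)) has_integral (\<Sum>j<n. \<Sum>k<n. a j * cnj (a k) * (if j = k then 2*pi else 0))) {0..2*pi}" for n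
  proof -
    have "((\<lambda>\<theta>. \<Sum>j<n. \<Sum>k<n. a j * cnj (a k) * (cis \<theta> ^ j * cnj (cis \<theta> ^ k))) has_integral
       (\<Sum>j<n. \<Sum>k<n. a j * cnj (a k) * (if j = k then 2*pi else 0))) {0..2*pi}"
      by (intro has_integral_sum has_integral_mult_right finite_lessThan) (use orth in auto)
    then show ?thesis
      by (simp add: p_def sum_product mult_ac cong: sum.cong)
  qed
  then have "((\<lambda>\<theta>. Re (p n \<theta> * cnj (p n \<theta>))) has_integral Re (\<Sum>j<n. \<Sum>k<n. a j * cnj (a k) * (if j = k then 2*pi else 0))) {0..2*pi}" for n
    by (fastforce dest: has_integral_linear[OF _ bounded_linear_Re] simp: o_def)
  moreover have "Re (p n \<theta> * cnj (p n \<theta>)) = (cmod (p n \<theta>))\<^sup>2" for n \<theta>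
    by (metis Re_complex_of_real complex_norm_square)
  moreover have "Re (\<Sum>j<n. \<Sum>k<n. a j * cnj (a k) * (if j = k then 2*pi else 0)) = (\<Sum>k<n. 2 * pi * (cmod (a k))\<^sup>2)" for n
  proof -
    have "(\<Sum>k<n. a j * cnj (a k) * (if j = k then 2*pi else 0)) = of_real (2 * pi * (cmod (a j))\<^sup>2)" if "j < n" for j
    proof -
      have "(\<Sum>k<n. a j * cnj (a k) * (if j = k then 2*pi else 0)) = (\<Sum>k<n. if j = k then 2 * pi * (a j * cnj (a j)) else 0)"
        by (intro sum.cong) auto
      also have "\<dots> = 2 * pi * (a j * cnj (a j))" using that by simp
      finally show ?thesis by (simp add: complex_norm_square[of "a j", symmetric] del: of_real_power)
    qed
    then have "(\<Sum>j<n. \<Sum>k<n. a j * cnj (a k) * (if j = k then 2*pi else 0)) = of_real (\<Sum>k<n. 2 * pi * (cmod (a k))\<^sup>2)"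
      by (simp del: of_real_mult of_real_power)
    then show ?thesis by (metis Re_complex_of_real)
  qed
  ultimately have hi: "((\<lambda>\<theta>. (cmod (p n \<theta>))\<^sup>2) has_integral (\<Sum>k<n. 2 * pi * (cmod (a k))\<^sup>2)) {0..2*pi}" for n
    by simp
  have fin: "(\<integral>\<^sup>+\<theta>. ennreal ((cmod (p n \<theta>))\<^sup>2) * indicator {0..2*pi} \<theta> \<partial>lborel)
     = ennreal (\<Sum>k<n. 2 * pi * (cmod (a k))\<^sup>2)" for n
    using nn_integral_has_integral_lebesgue[OF _ hi]
    by (simp add: nn_integral_completion ennreal_mult' ennreal_indicator mult.commute)
  have "(\<lambda>n. \<integral>\<^sup>+\<theta>. ennreal ((cmod (p n \<theta>))\<^sup>2) * indicator {0..2*pi} \<theta> \<partial>lborel)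
     \<longlonglongrightarrow> (\<integral>\<^sup>+\<theta>. ennreal ((cmod (h \<theta>))\<^sup>2) * indicator {0..2*pi} \<theta> \<partial>lborel)"
  proof (rule nn_integral_dominated_convergence[where w="\<lambda>\<theta>. ennreal (S\<^sup>2) * indicator {0..2*pi} \<theta>"])
    show "(\<integral>\<^sup>+\<theta>. ennreal (S\<^sup>2) * indicator {0..2*pi} \<theta> \<partial>lborel) < \<infinity>"
      by (simp add: nn_integral_cmult ennreal_mult_less_top)
    show "AE \<theta> in lborel. (\<lambda>n. ennreal ((cmod (p n \<theta>))\<^sup>2) * indicator {0..2*pi} \<theta>)
        \<longlonglongrightarrow> ennreal ((cmod (h \<theta>))\<^sup>2) * indicator {0..2*pi} \<theta>"
      by (intro AE_I2 tendsto_intros plim) (auto simp: indicator_def intro!: tendsto_intros plim)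
    show "AE \<theta> in lborel. ennreal ((cmod (p n \<theta>))\<^sup>2) * indicator {0..2*pi} \<theta>
        \<le> ennreal (S\<^sup>2) * indicator {0..2*pi} \<theta>" for n
      by (intro AE_I2 mult_right_mono ennreal_leI power_mono pb) auto
  qed measurable
  moreover have "(\<lambda>n. ennreal (\<Sum>k<n. 2 * pi * (cmod (a k))\<^sup>2)) \<longlonglongrightarrow> ennreal (2*pi) * (\<Sum>k. ennreal ((cmod (a k))\<^sup>2))"
  proof -
    have "(\<lambda>n. (\<Sum>k<n. ennreal (2*pi) * ennreal ((cmod (a k))\<^sup>2))) \<longlonglongrightarrow> (\<Sum>k. ennreal (2*pi) * ennreal ((cmod (a k))\<^sup>2))"
      by (rule summable_LIMSEQ) simp
    then show ?thesis
      by (simp add: ennreal_suminf_cmult sum_ennreal[symmetric] ennreal_mult' cong: sum.cong)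
  qed
  ultimately show ?thesis
    unfolding h_def fin by (rule LIMSEQ_unique)
qed

section \<open>The complex inner product\<close>

definition cip :: "complex ^ 'n \<Rightarrow> complex ^ 'n \<Rightarrow> complex"
  where "cip z w = (\<Sum>i\<in>UNIV. z $ i * cnj (w $ i))"

lemma cip_add_left: "cip (x + y) w = cip x w + cip y w"
  and cip_diff_left: "cip (x - y) w = cip x w - cip y w"
  and cip_add_right: "cip w (x + y) = cip w x + cip w y"
  and cip_scale_left: "cip (a *s x) w = a * cip x w"
  and cip_scale_right: "cip w (a *s x) = cnj a * cip w x"
  and cnj_cip: "cnj (cip x y) = cip y x"
  by (simp_all add: cip_def sum.distrib sum_subtractf sum_distrib_left algebra_simps)

lemma scaleR_eq_smult: "r *\<^sub>R (z :: complex ^ 'n) = of_real r *s z"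
  by (simp add: vec_eq_iff scaleR_conv_of_real[where 'a=complex])

lemma cip_scaleR_left: "cip (r *\<^sub>R x) w = of_real r * cip x w"
  and cip_scaleR_right: "cip w (r *\<^sub>R x) = of_real r * cip w x"
  by (simp_all add: scaleR_eq_smult cip_scale_left cip_scale_right)

lemma cip_zero [simp]: "cip 0 w = 0"
  by (simp add: cip_def)

lemma Re_cip: "Re (cip z w) = z \<bullet> w"
  by (simp add: cip_def inner_vec_def inner_complex_def)

lemma cip_self: "cip z z = of_real ((norm z)\<^sup>2)"
proof (rule complex_eqI)
  show "Re (cip z z) = Re (of_real ((norm z)\<^sup>2))"
    by (simp add: Re_cip power2_norm_eq_inner)
  have "cnj (cip z z) = cip z z" by (rule cnj_cip)
  then show "Im (cip z z) = Im (of_real ((norm z)\<^sup>2))"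
    by (metis Im_complex_of_real Reals_cnj_iff complex_is_Real_iff)
qed

lemma norm_smult: "norm (c *s (z :: complex ^ 'n)) = cmod c * norm z"
  by (simp add: norm_vec_def norm_mult L2_set_right_distrib)

lemma cmod_cip_le: "cmod (cip z w) \<le> norm z * norm w"
proof (cases "cip z w = 0")
  case False
  define c where "c = cnj (cip z w) / of_real (cmod (cip z w))"
  have c1: "cmod c = 1" using False by (simp add: c_def norm_divide)
  have "c * cip z w = of_real (cmod (cip z w))"
    using False complex_norm_square[of "cip z w"] by (simp add: c_def field_simps power2_eq_square)
  then have "cmod (cip z w) = Re (cip (c *s z) w)" by (simp add: cip_scale_left)
  also have "\<dots> \<le> norm (c *s z) * norm w" unfolding Re_cip by (rule norm_cauchy_schwarz)
  finally show ?thesis by (simp add: norm_smult c1)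
qed simp

text \<open>Converts closeness of \<open>cip x y\<close> to 1 into closeness of \<open>x\<close> and
  \<open>y\<close>. Limits of the scalar function \<open>cip (\<phi> z) \<eta>\<close> thereby
  become limits of the vector \<open>\<phi> z\<close>, and kernels at distinct boundary points are
  kept apart.\<close>

lemma norm_diff_unit_sq_le:
  assumes "norm x \<le> 1" "norm y \<le> 1"
  shows "(norm (x - y))\<^sup>2 \<le> 2 * (1 - Re (cip x y))"
proof -
  have "(norm (x - y))\<^sup>2 = (norm x)\<^sup>2 + (norm y)\<^sup>2 - 2 * (x \<bullet> y)"
    by (simp add: power2_norm_eq_inner inner_diff algebra_simps inner_commute)
  also have "\<dots> \<le> 2 - 2 * (x \<bullet> y)"
    using assms power_mono[of "norm x" 1 2] power_mono[of "norm y" 1 2] by simp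
  finally show ?thesis by (simp add: Re_cip)
qed

lemma bounded_linear_cip_left: "bounded_linear (\<lambda>z. cip z w)"
  by (rule bounded_linear_intro[where K="norm w"])
    (simp_all add: cip_add_left cip_scaleR_left cmod_cip_le scaleR_conv_of_real[where 'a=complex])

lemma bounded_linear_smult_right: "bounded_linear (\<lambda>z :: complex ^ 'n. c *s z)"
  by (rule bounded_linear_intro[where K="cmod c"])
    (simp_all add: norm_smult vec_eq_iff algebra_simps)

lemma bounded_linear_smult_left: "bounded_linear (\<lambda>c. c *s (z :: complex ^ 'n))"
  by (rule bounded_linear_intro[where K="norm z"])
    (simp_all add: norm_smult vec_eq_iff algebra_simps)

lemma continuous_on_cip [continuous_intros]:
  assumes "continuous_on A f" "continuous_on A g"
  shows "continuous_on A (\<lambda>x. cip (f x) (g x))"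
  unfolding cip_def using assms by (intro continuous_intros)

lemma tendsto_cip [tendsto_intros]:
  assumes "(f \<longlongrightarrow> a) F" "(g \<longlongrightarrow> b) F"
  shows "((\<lambda>x. cip (f x) (g x)) \<longlongrightarrow> cip a b) F"
  unfolding cip_def using assms by (intro tendsto_intros)

lemma tendsto_smult [tendsto_intros]:
  assumes "(f \<longlongrightarrow> a) F" "(g \<longlongrightarrow> (b :: complex ^ 'n)) F"
  shows "((\<lambda>x. f x *s g x) \<longlongrightarrow> a *s b) F"
  by (rule vec_tendstoI) (simp, intro tendsto_intros assms)

lemma continuous_on_smult [continuous_intros]:
  assumes "continuous_on A f" "continuous_on A (g :: _ \<Rightarrow> complex ^ 'n)"
  shows "continuous_on A (\<lambda>x. f x *s g x)"
  using assms unfolding continuous_on_def by (auto intro!: tendsto_smult)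

lemma norm_orthogonal_decomposition:
  assumes "norm u = 1" "cip v u = 0"
  shows "(norm (a *s u + v))\<^sup>2 = (cmod a)\<^sup>2 + (norm v)\<^sup>2"
proof -
  have uv: "cip u v = 0" using assms(2) cnj_cip[of v u] by simp
  have "complex_of_real ((norm (a *s u + v))\<^sup>2) = cip (a *s u + v) (a *s u + v)"
    by (rule cip_self[symmetric])
  also have "\<dots> = a * cnj a * cip u u + cip v v"
    by (simp add: cip_add_left cip_add_right cip_scale_left cip_scale_right assms uv)
  also have "\<dots> = of_real ((cmod a)\<^sup>2 + (norm v)\<^sup>2)"
    using assms complex_norm_square[of a] by (simp add: cip_self)
  finally show ?thesis by (simp only: of_real_eq_iff)
qed

section \<open>Averaging over rotations\<close>

text \<open>For a unit vector \<open>u\<close> this fixes the complex line through \<open>u\<close>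
  and multiplies its orthogonal complement by \<open>c\<close>. Averaging over unimodular
  \<open>c\<close> compares a function with its restriction to that line.\<close>

definition cperp_rot :: "complex ^ 'n \<Rightarrow> complex \<Rightarrow> complex ^ 'n \<Rightarrow> complex ^ 'n"
  where "cperp_rot u c z = cip z u *s u + c *s (z - cip z u *s u)"

lemma cip_perp [simp]:
  assumes "norm u = 1" shows "cip (z - cip z u *s u) u = 0"
  using assms by (simp add: cip_diff_left cip_scale_left cip_self)

lemma orthogonal_transformation_cperp_rot:
  assumes u: "norm u = 1" and c: "cmod c = 1"
  shows "orthogonal_transformation (cperp_rot u c)"
proof -
  have "linear (cperp_rot u c)"
    by (rule linearI)
      (simp_all add: cperp_rot_def cip_add_left cip_scaleR_left vec_eq_iff algebra_simps scaleR_conv_of_real[where 'a=complex])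
  moreover have "norm (cperp_rot u c z) = norm z" for z
  proof -
    let ?v = "z - cip z u *s u"
    have "(norm (cperp_rot u c z))\<^sup>2 = (cmod (cip z u))\<^sup>2 + (norm (c *s ?v))\<^sup>2"
      unfolding cperp_rot_def
      by (rule norm_orthogonal_decomposition[OF u]) (simp add: cip_scale_left u del: vector_ssub_ldistrib)
    also have "\<dots> = (norm (cip z u *s u + ?v))\<^sup>2"
      using norm_orthogonal_decomposition[OF u cip_perp[OF u], of "cip z u" z] by (simp add: norm_smult c del: vector_ssub_ldistrib)
    finally show ?thesis by (simp add: power2_eq_iff_nonneg)
  qed
  ultimately show ?thesis by (simp add: orthogonal_transformation)
qed

lemma orthogonal_transformation_smult:
  assumes c: "cmod c = 1"
  shows "orthogonal_transformation (\<lambda>z :: complex ^ 'n. c *s z)"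
  by (simp add: orthogonal_transformation norm_smult c bounded_linear.linear[OF bounded_linear_smult_right])

text \<open>By invariance the integral of \<open>F (U \<theta> z)\<close> is the same for every
  \<open>\<theta>\<close>, and Tonelli's theorem exchanges the two integrals. Joint continuity of
  \<open>U\<close> makes the integrand measurable on the product.\<close>

lemma nn_integral_rotation_average:
  fixes M :: "'a::second_countable_topology measure" and U :: "real \<Rightarrow> 'a \<Rightarrow> 'a" and F :: "'a \<Rightarrow> ennreal"
  assumes "sigma_finite_measure M" and sets [measurable_cong]: "sets M = sets borel"
    and inv: "\<And>\<theta>. distr M borel (U \<theta>) = M"
    and cont: "continuous_on UNIV (\<lambda>p. U (fst p) (snd p))"
    and F [measurable]: "F \<in> borel_measurable borel"
  shows "ennreal (2 * pi) * (\<integral>\<^sup>+z. F z \<partial>M)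
    = (\<integral>\<^sup>+z. (\<integral>\<^sup>+\<theta>. F (U \<theta> z) * indicator {0..2*pi} \<theta> \<partial>lborel) \<partial>M)"
proof -
  interpret M: sigma_finite_measure M by fact
  interpret P: pair_sigma_finite M "lborel :: real measure" ..
  have "(\<lambda>p. U (fst p) (snd p)) \<in> borel_measurable borel"
    using cont by (rule borel_measurable_continuous_onI)
  then have [measurable]: "(\<lambda>p. U (fst p) (snd p)) \<in> borel_measurable (borel \<Otimes>\<^sub>M borel)"
    by (simp add: borel_prod)
  have U [measurable]: "U \<theta> \<in> borel_measurable borel" for \<theta>
    by (rule borel_measurable_continuous_onI, rule continuous_on_compose2[OF cont, of UNIV "\<lambda>z. (\<theta>, z)", simplified])
      (intro continuous_intros)
  have V [measurable]: "(\<lambda>p. U (snd p) (fst p)) \<in> borel_measurable (M \<Otimes>\<^sub>M lborel)"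
  proof -
    have "(\<lambda>p. (snd p, fst p)) \<in> M \<Otimes>\<^sub>M lborel \<rightarrow>\<^sub>M borel \<Otimes>\<^sub>M borel" by measurable
    from measurable_compose[OF this, of "\<lambda>p. U (fst p) (snd p)" borel] show ?thesis by simp
  qed
  have "ennreal (2 * pi) * (\<integral>\<^sup>+z. F z \<partial>M) = (\<integral>\<^sup>+\<theta>. (\<integral>\<^sup>+z. F z \<partial>M) * indicator {0..2*pi} \<theta> \<partial>lborel)"
    by (simp add: nn_integral_cmult mult.commute)
  also have "\<dots> = (\<integral>\<^sup>+\<theta>. (\<integral>\<^sup>+z. F (U \<theta> z) * indicator {0..2*pi} \<theta> \<partial>M) \<partial>lborel)"
  proof (rule nn_integral_cong)
    fix \<theta> :: real
    have "(\<integral>\<^sup>+z. F z \<partial>M) = (\<integral>\<^sup>+z. F z \<partial>distr M borel (U \<theta>))" by (simp add: inv)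
    also have "\<dots> = (\<integral>\<^sup>+z. F (U \<theta> z) \<partial>M)" by (rule nn_integral_distr) measurable
    finally show "(\<integral>\<^sup>+z. F z \<partial>M) * indicator {0..2*pi} \<theta> = (\<integral>\<^sup>+z. F (U \<theta> z) * indicator {0..2*pi} \<theta> \<partial>M)"
      by (simp add: nn_integral_multc)
  qed
  also have "\<dots> = (\<integral>\<^sup>+z. (\<integral>\<^sup>+\<theta>. F (U \<theta> z) * indicator {0..2*pi} \<theta> \<partial>lborel) \<partial>M)"
    by (rule P.Fubini') measurable
  finally show ?thesis .
qed

text \<open>Zeros of a nontrivial power series are isolated, so vanishing on a one-sided real
  interval suffices. In the application \<open>x\<close> is a squared norm, hence
  nonnegative.\<close>

lemma powser_zero_right:
  fixes a :: "nat \<Rightarrow> real"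
  assumes z: "\<And>x. 0 \<le> x \<Longrightarrow> x < 1 \<Longrightarrow> (\<lambda>k. a k * x ^ k) sums 0"
  shows "a k = 0"
proof (rule ccontr)
  assume ak: "a k \<noteq> 0"
  define f where "f x = (\<Sum>k. a k * x ^ k)" for x
  have f0: "f x = 0" if "0 \<le> x" "x < 1" for x
    using z[OF that] by (simp add: f_def sums_iff)
  have a0: "a 0 = 0" using z[of 0] by (simp add: sums_iff)
  then have k: "k > 0" using ak by (cases k) auto
  have sm: "(\<lambda>n. a n * (x - 0) ^ n) sums f x" if "norm (x - 0) < 1/2" for x
  proof -
    have "summable (\<lambda>k. a k * (1/2) ^ k)" using z[of "1/2"] by (simp add: sums_iff)
    from powser_inside[OF this, of x] that show ?thesis by (simp add: f_def summable_sums)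
  qed
  obtain s where s: "0 < s" "\<And>z. z \<in> cball 0 s - {0} \<Longrightarrow> f z \<noteq> 0"
    using powser_0_nonzero[of "1/2" 0 a f k] sm f0[of 0] ak k by auto
  have "f (min s (1/2)) \<noteq> 0" using s by (intro s(2)) auto
  moreover have "f (min s (1/2)) = 0" using s by (intro f0) auto
  ultimately show False by simp
qed

text \<open>Both sides integrate \<open>h\<close> against a measure on the line: the image of
  \<open>F dz\<close> under the squared norm, and a multiple of the density
  \<open>p * u ^ (p - 1)\<close>. Scaling by \<open>sqrt x\<close> shows that they agree on every
  half-line below \<open>x\<close>, and these half-lines generate the Borel sets. The exponent is
  halved because the variable is the squared norm.\<close>

lemma nn_integral_radial:
  fixes F :: "'a::euclidean_space \<Rightarrow> ennreal" and h :: "real \<Rightarrow> ennreal"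
  assumes F [measurable]: "F \<in> borel_measurable borel" and h [measurable]: "h \<in> borel_measurable borel"
    and hom: "\<And>r z. 0 < r \<Longrightarrow> F (r *\<^sub>R z) = ennreal (r ^ m) * F z"
    and p: "m + DIM('a) = 2 * p" "0 < p"
    and S: "(\<integral>\<^sup>+z. F z * indicator (ball 0 1) z \<partial>lborel) = S" "S < \<infinity>"
  shows "(\<integral>\<^sup>+z. F z * h ((norm z)\<^sup>2) \<partial>lborel)
    = S * (\<integral>\<^sup>+u. ennreal (p * u ^ (p - 1)) * h u * indicator {0<..} u \<partial>lborel)"
proof -
  define L where "L = distr (density lborel F) borel (\<lambda>z. (norm z)\<^sup>2)"
  define R where "R = density lborel (\<lambda>u. S * (ennreal (p * u ^ (p - 1)) * indicator {0<..} u))"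
  have eL: "emeasure L {..<x} = S * ennreal (if x \<le> 0 then 0 else x ^ p)" for x
  proof -
    have "emeasure L {..<x} = (\<integral>\<^sup>+z. F z * indicator {z. (norm z)\<^sup>2 < x} z \<partial>lborel)"
      by (simp add: L_def emeasure_distr emeasure_density vimage_def)
    also have "\<dots> = S * ennreal (if x \<le> 0 then 0 else x ^ p)"
    proof (cases "x \<le> 0")
      case True
      then have "\<not> (norm z)\<^sup>2 < x" for z :: 'a by (smt (verit) zero_le_power2)
      then show ?thesis using True by simp
    next
      case False
      then have x: "sqrt x > 0" "x > 0" by auto
      have "(\<integral>\<^sup>+z. F z * indicator {z. (norm z)\<^sup>2 < x} z \<partial>lborel)
        = ennreal (\<bar>sqrt x\<bar> ^ DIM('a)) * (\<integral>\<^sup>+z. F (0 + sqrt x *\<^sub>R z) * indicator {z. (norm z)\<^sup>2 < x} (0 + sqrt x *\<^sub>R z) \<partial>lborel)"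
        by (rule nn_integral_lborel_affine) (use x in auto)
      also have "(\<integral>\<^sup>+z. F (0 + sqrt x *\<^sub>R z) * indicator {z. (norm z)\<^sup>2 < x} (0 + sqrt x *\<^sub>R z) \<partial>lborel)
         = (\<integral>\<^sup>+z. ennreal (sqrt x ^ m) * (F z * indicator (ball 0 1) z) \<partial>lborel)"
        using x by (intro nn_integral_cong)
          (auto simp: hom indicator_def power_mult_distrib mult.assoc abs_square_less_1 field_simps)
      also have "\<dots> = ennreal (sqrt x ^ m) * S"
        unfolding S(1)[symmetric]
          by (intro nn_integral_cmult borel_measurable_times_ennreal borel_measurable_indicator) auto
      also have "ennreal (\<bar>sqrt x\<bar> ^ DIM('a)) * \<dots> = ennreal (sqrt x ^ (m + DIM('a))) * S"
        using x by (simp add: power_add ennreal_mult' mult_ac)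
      also have "sqrt x ^ (m + DIM('a)) = x ^ p"
        using x by (simp add: p power_mult)
      finally show ?thesis using False by (simp add: mult.commute)
    qed
    finally show ?thesis .
  qed
  have eR: "emeasure R {..<x} = S * ennreal (if x \<le> 0 then 0 else x ^ p)" for x
  proof -
    have "emeasure R {..<x} = (\<integral>\<^sup>+u. S * (ennreal (p * u ^ (p - 1)) * indicator {0<..} u) * indicator {..<x} u \<partial>lborel)"
      by (simp add: R_def emeasure_density)
    also have "\<dots> = (\<integral>\<^sup>+u. S * (ennreal (p * u ^ (p - 1)) * indicator {0<..<x} u) \<partial>lborel)"
      by (intro nn_integral_cong) (auto simp: indicator_def)
    also have "\<dots> = S * (\<integral>\<^sup>+u. ennreal (p * u ^ (p - 1)) * indicator {0<..<x} u \<partial>lborel)"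
      by (simp add: nn_integral_cmult)
    also have "(\<integral>\<^sup>+u. ennreal (p * u ^ (p - 1)) * indicator {0<..<x} u \<partial>lborel) = ennreal (if x \<le> 0 then 0 else x ^ p)"
    proof (cases "x \<le> 0")
      case False
      have "(\<integral>\<^sup>+u. ennreal (p * u ^ (p - 1)) * indicator {0<..<x} u \<partial>lborel)
         = (\<integral>\<^sup>+u. ennreal (p * u ^ (p - 1)) * indicator {0..x} u \<partial>lborel)"
      proof (rule nn_integral_cong_AE)
        have "AE u in lborel. u \<noteq> 0 \<and> u \<noteq> x"
          using AE_lborel_singleton[of "0::real"] AE_lborel_singleton[of x] by eventually_elim auto
        then show "AE u in lborel. ennreal (p * u ^ (p - 1)) * indicator {0<..<x} u
            = ennreal (p * u ^ (p - 1)) * indicator {0..x} u"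
          by eventually_elim (auto simp: indicator_def)
      qed
      also have "\<dots> = ennreal (x ^ p - 0 ^ p)"
        by (rule nn_integral_FTC_Icc) (use False p in \<open>auto intro!: derivative_eq_intros\<close>)
      finally show ?thesis using False p by (simp add: zero_power)
    qed (simp add: greaterThanLessThan_empty)
    finally show ?thesis .
  qed
  have "L = R"
  proof (rule measure_eqI_generator_eq[where E="range lessThan" and \<Omega>=UNIV and A="\<lambda>i. {..<real i}"])
    show "Int_stable (range (lessThan :: real \<Rightarrow> _))"
    proof -
      have "{..<a} \<inter> {..<b} = {..<min a b}" for a b :: real by auto
      then show ?thesis by (auto simp: Int_stable_def)
    qed
    show "sets L = sigma_sets UNIV (range lessThan)" "sets R = sigma_sets UNIV (range lessThan)"
      by (simp_all add: L_def R_def borel_Iio)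
    show "(\<Union>i. {..<real i}) = UNIV" using reals_Archimedean2 by auto
    show "emeasure L {..<real i} \<noteq> \<infinity>" for i
      unfolding eL using S by (auto simp: ennreal_mult_eq_top_iff)
  qed (use eL eR in auto)
  have "(\<integral>\<^sup>+z. F z * h ((norm z)\<^sup>2) \<partial>lborel) = (\<integral>\<^sup>+u. h u \<partial>L)"
    by (simp add: L_def nn_integral_distr nn_integral_density)
  also have "\<dots> = (\<integral>\<^sup>+u. S * (ennreal (p * u ^ (p - 1)) * indicator {0<..} u) * h u \<partial>lborel)"
    unfolding \<open>L = R\<close> by (simp add: R_def nn_integral_density)
  also have "\<dots> = (\<integral>\<^sup>+u. S * (ennreal (p * u ^ (p - 1)) * h u * indicator {0<..} u) \<partial>lborel)"
    by (simp add: mult_ac)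
  also have "\<dots> = S * (\<integral>\<^sup>+u. ennreal (p * u ^ (p - 1)) * h u * indicator {0<..} u \<partial>lborel)"
    by (rule nn_integral_cmult) measurable
  finally show ?thesis .
qed

section \<open>Gaussian moments and the measures of the spaces\<close>

text \<open>The coefficient of \<open>x ^ k\<close> in \<open>(1 - x) powr (- \<beta>)\<close>. Its
  reciprocal turns out to be the moment of order \<open>2 * k\<close> of \<open>|cip z u|\<close> in
  the space with kernel exponent \<open>\<beta>\<close>.\<close>

definition bcoef :: "real \<Rightarrow> nat \<Rightarrow> real"
  where "bcoef \<beta> k = pochhammer \<beta> k / fact k"

lemma bcoef_pos: "\<beta> > 0 \<Longrightarrow> bcoef \<beta> k > 0"
  by (simp add: bcoef_def pochhammer_pos)

lemma borel_measurable_cip [measurable (raw)]: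
  assumes "f \<in> borel_measurable M" "g \<in> borel_measurable M"
  shows "(\<lambda>x. cip (f x) (g x)) \<in> borel_measurable M"
  using assms by (rule borel_measurable_continuous_Pair) (intro continuous_intros)

lemma borel_measurable_smult [measurable (raw)]:
  fixes g :: "_ \<Rightarrow> complex ^ 'n"
  assumes "f \<in> borel_measurable M" "g \<in> borel_measurable M"
  shows "(\<lambda>x. f x *s g x) \<in> borel_measurable M"
  using assms by (rule borel_measurable_continuous_Pair) (intro continuous_intros)

lemma DIM_cvec: "DIM(complex ^ 'n) = 2 * CARD('n)"
  by (simp add: DIM_cart)

lemma orthogonal_transformation_measurable:
  fixes U :: "'a::euclidean_space \<Rightarrow> 'a"
  shows "orthogonal_transformation U \<Longrightarrow> U \<in> borel_measurable borel"
  by (intro borel_measurable_continuous_onI linear_continuous_on)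
    (simp add: orthogonal_transformation_linear flip: linear_conv_bounded_linear)

lemma distr_density_orthogonal:
  fixes U :: "'a::euclidean_space \<Rightarrow> 'a"
  assumes U: "orthogonal_transformation U"
    and g [measurable]: "g \<in> borel_measurable borel" and inv: "\<And>z. g (U z) = g z"
  shows "distr (density lborel g) borel U = density lborel g"
proof (rule measure_eqI)
  have [measurable]: "U \<in> borel_measurable borel"
    using U by (rule orthogonal_transformation_measurable)
  fix A assume "A \<in> sets (distr (density lborel g) borel U)"
  then have [measurable]: "A \<in> sets borel" by simp
  have "emeasure (distr (density lborel g) borel U) A = (\<integral>\<^sup>+z. indicator A z \<partial>distr (density lborel g) borel U)"
    by simp
  also have "\<dots> = (\<integral>\<^sup>+z. g (U z) * indicator A (U z) \<partial>lborel)"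
    by (simp add: nn_integral_distr nn_integral_density inv del: nn_integral_indicator)
  also have "\<dots> = (\<integral>\<^sup>+z. g z * indicator A z \<partial>distr lborel borel U)"
    by (simp add: nn_integral_distr)
  also have "\<dots> = emeasure (density lborel g) A"
    by (simp add: lborel_distr_orthogonal[OF U] emeasure_density)
  finally show "emeasure (distr (density lborel g) borel U) A = emeasure (density lborel g) A" .
qed simp

text \<open>Completing the square: \<open>2 * (z \<bullet> w) - |z|^2 = |w|^2 - |z - w|^2\<close>;
  what remains is a translation.\<close>

lemma nn_integral_gauss_exp:
  fixes w :: "'a::euclidean_space"
  shows "(\<integral>\<^sup>+z. ennreal (exp (2 * (z \<bullet> w)) * exp (- (norm z)\<^sup>2)) \<partial>lborel)
    = ennreal (exp ((norm w)\<^sup>2)) * (\<integral>\<^sup>+z. ennreal (exp (- (norm z)\<^sup>2)) \<partial>(lborel :: 'a measure))"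
proof -
  have "exp (2 * (z \<bullet> w)) * exp (- (norm z)\<^sup>2) = exp ((norm w)\<^sup>2) * exp (- (norm (z + - w))\<^sup>2)" for z
    by (simp add: power2_norm_eq_inner inner_diff algebra_simps inner_commute flip: exp_add)
  then have "(\<integral>\<^sup>+z. ennreal (exp (2 * (z \<bullet> w)) * exp (- (norm z)\<^sup>2)) \<partial>lborel)
    = ennreal (exp ((norm w)\<^sup>2)) * (\<integral>\<^sup>+z. ennreal (exp (- (norm (z + - w))\<^sup>2)) \<partial>lborel)"
    by (simp add: ennreal_mult' nn_integral_cmult)
  also have "(\<integral>\<^sup>+z. ennreal (exp (- (norm (z + - w))\<^sup>2)) \<partial>lborel) = (\<integral>\<^sup>+z. ennreal (exp (- (norm z)\<^sup>2)) \<partial>(lborel :: 'a measure))"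
    by (rule nn_integral_lborel_translate) measurable
  finally show ?thesis .
qed

text \<open>The integral is \<open>p * Gamma p\<close>. It is the radial factor of a Gaussian when
  \<open>u\<close> stands for the squared norm.\<close>

lemma nn_integral_power_exp:
  "0 < p \<Longrightarrow> (\<integral>\<^sup>+u. ennreal (real p * u ^ (p - 1)) * ennreal (exp (- u)) * indicator {0<..} u \<partial>lborel) = ennreal (fact p)"
proof -
  assume p: "0 < p"
  have "(\<integral>\<^sup>+u. ennreal (real p * u ^ (p - 1)) * ennreal (exp (- u)) * indicator {0<..} u \<partial>lborel)
     = (\<integral>\<^sup>+u. ennreal (real p) * ennreal (indicator {0..} u * u powr (real p - 1) / exp u) \<partial>lborel)"
  proof (rule nn_integral_cong_AE)
    show "AE u in lborel. ennreal (real p * u ^ (p - 1)) * ennreal (exp (- u)) * indicator {0<..} u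
      = ennreal (real p) * ennreal (indicator {0..} u * u powr (real p - 1) / exp u)"
      using AE_lborel_singleton[of "0::real"]
    proof eventually_elim
      case (elim u)
      show ?case
      proof (cases "u > 0")
        case True
        have "u powr (real p - 1) = u ^ (p - 1)"
          using True p by (subst powr_realpow[symmetric]) (auto simp: of_nat_diff)
        then show ?thesis
          using True by (simp add: ennreal_mult'[symmetric] exp_minus field_simps)
      qed (use elim in auto)
    qed
  qed
  also have "\<dots> = ennreal (real p) * ennreal (Gamma (real p))"
    using p by (simp add: nn_integral_cmult Gamma_conv_nn_integral_real)
  also have "\<dots> = ennreal (fact p)"
  proof -
    obtain q where q: "p = Suc q" using p by (cases p) auto
    have "Gamma (real p) = fact q" using Gamma_fact[of q, where 'a=real] by (simp add: q add.commute)
    then show ?thesis using ennreal_mult'[of "real p" "fact q"] by (simp add: q)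
  qed
  finally show ?thesis .
qed

lemma emeasure_unit_ball:
  "emeasure lborel (ball (0 :: complex ^ 'n) 1) = ennreal (unit_ball_vol (real DIM(complex ^ 'n)))"
  by (simp add: emeasure_ball)

section \<open>Moments of one coordinate against radial weights\<close>

context
  fixes u :: "complex ^ 'n"
  assumes u: "norm u = 1"
begin

lemma cip_power_measurable [measurable]: "(\<lambda>z. ennreal (cmod (cip z u) ^ m)) \<in> borel_measurable borel"
  by (intro measurable_compose[OF _ measurable_ennreal] borel_measurable_continuous_onI continuous_intros)

lemma radial_cip_finite:
  "(\<integral>\<^sup>+z. ennreal (cmod (cip z u) ^ (2*k)) * indicator (ball 0 1) z \<partial>lborel) < \<infinity>"
proof -
  have "(\<integral>\<^sup>+z. ennreal (cmod (cip z u) ^ (2*k)) * indicator (ball 0 1) z \<partial>lborel)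
     \<le> (\<integral>\<^sup>+z. indicator (ball (0 :: complex ^ 'n) 1) z \<partial>lborel)"
  proof (rule nn_integral_mono)
    fix z :: "complex ^ 'n"
    have "cmod (cip z u) ^ (2*k) \<le> 1" if "norm z < 1"
      using cmod_cip_le[of z u] u that by (intro power_le_one) auto
    then show "ennreal (cmod (cip z u) ^ (2*k)) * indicator (ball 0 1) z \<le> indicator (ball 0 1) z"
      by (auto simp: indicator_def)
  qed
  also have "\<dots> < \<infinity>" by (simp add: emeasure_unit_ball)
  finally show "(\<integral>\<^sup>+z. ennreal (cmod (cip z u) ^ (2*k)) * indicator (ball 0 1) z \<partial>lborel) < \<infinity>" .
qed

text \<open>The factor \<open>cmod (cip z u) ^ (2*k)\<close> is homogeneous of degree
  \<open>2 * k\<close> and the real dimension is twice \<open>CARD('n)\<close>, which gives the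
  exponent \<open>CARD('n) + k\<close>.\<close>

lemma radial_cip:
  assumes h: "h \<in> borel_measurable borel"
  shows "(\<integral>\<^sup>+z. ennreal (cmod (cip z u) ^ (2*k)) * h ((norm z)\<^sup>2) \<partial>lborel)
    = (\<integral>\<^sup>+z. ennreal (cmod (cip z u) ^ (2*k)) * indicator (ball 0 1) z \<partial>lborel)
      * (\<integral>\<^sup>+t. ennreal (real (CARD('n) + k) * t ^ (CARD('n) + k - 1)) * h t * indicator {0<..} t \<partial>lborel)"
  by (rule nn_integral_radial[OF _ h _ _ _ refl radial_cip_finite, where m="2*k"])
    (auto simp: cip_scaleR_left norm_mult power_mult_distrib ennreal_mult' DIM_cvec)

lemma gauss_total: "(\<integral>\<^sup>+z. ennreal (exp (- (norm z)\<^sup>2)) \<partial>(lborel :: (complex ^ 'n) measure)) = ennreal (unit_ball_vol (real DIM(complex ^ 'n)) * fact CARD('n))"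
proof -
  have "(\<integral>\<^sup>+z. ennreal (exp (- (norm z)\<^sup>2)) \<partial>(lborel :: (complex ^ 'n) measure))
    = (\<integral>\<^sup>+z. ennreal (cmod (cip z u) ^ (2*0)) * ennreal (exp (- (norm z)\<^sup>2)) \<partial>lborel)" by simp
  also have "\<dots> = ennreal (unit_ball_vol (real DIM(complex ^ 'n))) * ennreal (fact CARD('n))"
    by (subst radial_cip[where k=0 and h="\<lambda>t. ennreal (exp (- t))"])
      (simp_all add: emeasure_unit_ball nn_integral_power_exp[of "CARD('n)", simplified])
  finally show ?thesis using unit_ball_vol_pos[of "DIM(complex ^ 'n)"] by (simp add: ennreal_mult)
qed

text \<open>For \<open>w = sqrt x u\<close> the integral of \<open>|exp \<langle>z, w\<rangle>|\<^sup>2\<close> is a multiple of \<open>exp x\<close> by translation, and the power series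
  with coefficients \<open>m\<^sub>k / (k!)\<^sup>2\<close> by averaging over rotations; comparing coefficients gives the moments \<open>m\<^sub>k\<close>.\<close>

lemma gauss_moment:
  "(\<integral>\<^sup>+z. ennreal (cmod (cip z u) ^ (2*k)) * ennreal (exp (- (norm z)\<^sup>2)) \<partial>lborel)
    = ennreal (fact k * (unit_ball_vol (real DIM(complex ^ 'n)) * fact CARD('n)))"
proof -
  define G where "G = density lborel (\<lambda>z :: complex ^ 'n. ennreal (exp (- (norm z)\<^sup>2)))"
  define Z where "Z = unit_ball_vol (real DIM(complex ^ 'n)) * fact CARD('n)"
  have Z: "Z > 0" by (simp add: Z_def)
  have G: "(\<integral>\<^sup>+z. f z \<partial>G) = (\<integral>\<^sup>+z. ennreal (exp (- (norm z)\<^sup>2)) * f z \<partial>lborel)"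
    if "f \<in> borel_measurable borel" for f
    using that by (simp add: G_def nn_integral_density)
  have setsG [measurable_cong]: "sets G = sets borel" by (simp add: G_def)
  have "finite_measure G"
    by (rule finite_measureI) (simp add: G_def emeasure_density gauss_total)
  then have sf: "sigma_finite_measure G" by (simp add: finite_measure_def)
  have invG: "distr G borel U = G" if U: "orthogonal_transformation U" for U
    unfolding G_def
    by (rule distr_density_orthogonal[OF U]) (use U in \<open>simp_all add: orthogonal_transformation_norm\<close>)
  define m where "m k = (\<integral>\<^sup>+z. ennreal (cmod (cip z u) ^ (2*k)) \<partial>G)" for k
  have gen: "(\<Sum>k. ennreal (x ^ k / (fact k)\<^sup>2) * m k) = ennreal (exp x * Z)" if x: "x \<ge> 0" for x :: real
  proof -
    define w where "w = sqrt x *\<^sub>R u"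
    have nw: "norm w = sqrt x" by (simp add: w_def u x)
    have E: "(cmod (exp (cip z w)))\<^sup>2 = exp (2 * (z \<bullet> w))" for z
      by (simp add: Re_cip power2_eq_square flip: exp_add)
    have [measurable]: "(\<lambda>z. ennreal ((cmod (exp (cip z w)))\<^sup>2)) \<in> borel_measurable borel"
      by (intro measurable_compose[OF _ measurable_ennreal] borel_measurable_continuous_onI continuous_intros)
    have "ennreal (2 * pi) * ennreal (exp x * Z) = ennreal (2 * pi) * (\<integral>\<^sup>+z. ennreal ((cmod (exp (cip z w)))\<^sup>2) \<partial>G)"
    proof -
      have "(\<integral>\<^sup>+z. ennreal ((cmod (exp (cip z w)))\<^sup>2) \<partial>G)
          = (\<integral>\<^sup>+z. ennreal (exp (- (norm z)\<^sup>2)) * ennreal ((cmod (exp (cip z w)))\<^sup>2) \<partial>lborel)"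
        by (rule G) measurable
      also have "\<dots> = (\<integral>\<^sup>+z. ennreal (exp (2 * (z \<bullet> w)) * exp (- (norm z)\<^sup>2)) \<partial>lborel)"
        unfolding E by (simp add: ennreal_mult'[symmetric] mult.commute)
      also have "\<dots> = ennreal (exp x) * ennreal Z"
        using x by (simp only: nn_integral_gauss_exp nw gauss_total Z_def) simp
      finally show ?thesis by (simp add: ennreal_mult')
    qed
    also have "\<dots> = (\<integral>\<^sup>+z. (\<integral>\<^sup>+\<theta>. ennreal ((cmod (exp (cip (cis \<theta> *s z) w)))\<^sup>2) * indicator {0..2*pi} \<theta> \<partial>lborel) \<partial>G)"
      by (rule nn_integral_rotation_average[OF sf setsG])
        (auto intro!: invG orthogonal_transformation_smult continuous_intros simp: cis_conv_exp)
    also have "\<dots> = (\<integral>\<^sup>+z. ennreal (2 * pi) * (\<Sum>k. ennreal (x ^ k / (fact k)\<^sup>2) * ennreal (cmod (cip z u) ^ (2*k))) \<partial>G)"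
    proof (rule nn_integral_cong)
      fix z
      define a where "a k = cip z w ^ k / fact k" for k
      have sa: "summable (\<lambda>k. cmod (a k))"
        using summable_norm_exp[of "cip z w"] by (simp add: a_def norm_divide scaleR_conv_of_real field_simps)
      have "exp (cip (cis \<theta> *s z) w) = (\<Sum>k. a k * cis \<theta> ^ k)" for \<theta>
        by (simp add: exp_def cip_scale_left a_def power_mult_distrib scaleR_conv_of_real field_simps)
      moreover have "(cmod (a k))\<^sup>2 = x ^ k / (fact k)\<^sup>2 * cmod (cip z u) ^ (2*k)" for k
      proof -
        have "(sqrt x ^ k)\<^sup>2 = x ^ k" using x by (metis power_mult mult.commute real_sqrt_pow2)
        then show ?thesis using x
          by (simp add: a_def w_def cip_scaleR_right norm_divide norm_mult norm_power power_mult_distrib power_divide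
            power_even_eq power_commutes flip: power_mult)
      qed
      ultimately show "(\<integral>\<^sup>+\<theta>. ennreal ((cmod (exp (cip (cis \<theta> *s z) w)))\<^sup>2) * indicator {0..2*pi} \<theta> \<partial>lborel)
        = ennreal (2 * pi) * (\<Sum>k. ennreal (x ^ k / (fact k)\<^sup>2) * ennreal (cmod (cip z u) ^ (2*k)))"
        using parseval_circle[OF sa] x by (simp add: ennreal_mult'[symmetric])
    qed
    also have "\<dots> = ennreal (2 * pi) * (\<Sum>k. ennreal (x ^ k / (fact k)\<^sup>2) * m k)"
      by (subst nn_integral_cmult nn_integral_suminf, measurable)+ (simp add: nn_integral_cmult measurable_cong_sets[OF setsG refl] m_def)
    finally show ?thesis by (simp add: ennreal_mult_cancel_left)
  qed
  \<comment> \<open>Every moment is dominated by the value of the series at \<open>x = 1\<close>.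
    Finiteness is required before the coefficients can be compared as real numbers.\<close>
  have mfin: "m k < \<infinity>" for k
  proof -
    have "ennreal (1 ^ k / (fact k)\<^sup>2) * m k \<le> (\<Sum>k. ennreal (1 ^ k / (fact k)\<^sup>2) * m k)"
      using sum_le_suminf[of "\<lambda>k. ennreal (1 ^ k / (fact k)\<^sup>2) * m k" "{k}"] by simp
    also have "\<dots> < \<infinity>" by (subst gen) auto
    finally show ?thesis by (auto simp: ennreal_mult_less_top)
  qed
  define M where "M k = enn2real (m k)" for k
  have mM: "m k = ennreal (M k)" "M k \<ge> 0" for k using mfin by (simp_all add: M_def)
  have "(\<lambda>k. (M k / (fact k)\<^sup>2 - Z / fact k) * x ^ k) sums 0" if x: "0 \<le> x" "x < 1" for x
  proof -
    have "(\<lambda>k. ennreal (x ^ k / (fact k)\<^sup>2 * M k)) sums ennreal (exp x * Z)"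
      using gen[OF x(1)] x mM by (simp add: ennreal_mult'[symmetric] sums_iff)
    then have "(\<lambda>k. x ^ k / (fact k)\<^sup>2 * M k) sums (exp x * Z)"
      using x mM Z by (subst (asm) sums_ennreal) auto
    moreover have "(\<lambda>k. x ^ k / fact k * Z) sums (exp x * Z)"
      using exp_converges[of x] by (intro sums_mult2) (simp add: field_simps)
    ultimately have "(\<lambda>k. x ^ k / (fact k)\<^sup>2 * M k - x ^ k / fact k * Z) sums (exp x * Z - exp x * Z)"
      by (rule sums_diff)
    then show ?thesis by (simp add: algebra_simps)
  qed
  then have "M k / (fact k)\<^sup>2 - Z / fact k = 0" by (rule powser_zero_right)
  then have "M k = fact k * Z" by (simp add: field_simps power2_eq_square)
  then have "m k = ennreal (fact k * Z)" by (simp add: mM)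
  then show ?thesis unfolding m_def by (subst (asm) G) (measurable, simp add: Z_def mult.commute)
qed

text \<open>By \<open>radial_cip\<close> the dependence on \<open>h\<close> sits in a
  one-dimensional integral, with one constant \<open>S\<close> common to all \<open>h\<close>. The
  Gaussian choice \<open>h t = exp (- t)\<close> evaluates this constant.\<close>

lemma radial_moment:
  assumes h: "h \<in> borel_measurable borel"
  shows "(\<integral>\<^sup>+z. ennreal (cmod (cip z u) ^ (2*k)) * h ((norm z)\<^sup>2) \<partial>lborel)
    = ennreal (unit_ball_vol (real DIM(complex ^ 'n)) * fact k * fact CARD('n) / fact (CARD('n) + k))
      * (\<integral>\<^sup>+t. ennreal (real (CARD('n) + k) * t ^ (CARD('n) + k - 1)) * h t * indicator {0<..} t \<partial>lborel)"
proof -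
  define S where "S = enn2real (\<integral>\<^sup>+z. ennreal (cmod (cip z u) ^ (2*k)) * indicator (ball 0 1) z \<partial>lborel)"
  have S: "(\<integral>\<^sup>+z. ennreal (cmod (cip z u) ^ (2*k)) * indicator (ball 0 1) z \<partial>lborel) = ennreal S" "S \<ge> 0"
    using radial_cip_finite[of k] by (simp_all add: S_def)
  have "ennreal S * ennreal (fact (CARD('n) + k)) = ennreal (fact k * (unit_ball_vol (real DIM(complex ^ 'n)) * fact CARD('n)))"
    using radial_cip[where k=k and h="\<lambda>t. ennreal (exp (- t))"] gauss_moment[of k]
      nn_integral_power_exp[of "CARD('n) + k"]
    by (simp add: S(1) del: of_nat_add)
  then have "S * fact (CARD('n) + k) = fact k * (unit_ball_vol (real DIM(complex ^ 'n)) * fact CARD('n))"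
    using S(2) by (simp add: ennreal_mult'[symmetric])
  then have "S = unit_ball_vol (real DIM(complex ^ 'n)) * fact k * fact CARD('n) / fact (CARD('n) + k)"
    by (simp add: field_simps)
  then show ?thesis using radial_cip[OF h, of k] S(1) by simp
qed

end

section \<open>The two norms as integrals against rotation invariant probability measures\<close>

text \<open>Together with \<open>radii\<close> this gives both norms one shape: the supremum over
  \<open>r\<close> of the integral of \<open>|f (r z)|^2\<close>. The Hardy space has the sphere and
  all radii below 1, the Bergman space its weighted measure and the single radius 1, so that most
  arguments treat both at once.\<close>

definition space_measure :: "fspace \<Rightarrow> (complex ^ 'n) measure"
  where "space_measure X = (case X of Hardy \<Rightarrow> sphere_measure
    | Bergman s \<Rightarrow> density ball_measure (\<lambda>z. ennreal (bergman_weight s z)))"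

definition radii :: "fspace \<Rightarrow> real set"
  where "radii X = (case X of Hardy \<Rightarrow> {0<..<1} | Bergman s \<Rightarrow> {1})"

lemma radii_bounds: "r \<in> radii X \<Longrightarrow> 0 < r \<and> r \<le> 1"
  by (cases X) (auto simp: radii_def)

lemma kernel_exponent_pos: "admissible X \<Longrightarrow> kernel_exponent X CARD('n::finite) > 0"
proof (cases X)
  case (Bergman s)
  assume "admissible X"
  then have "s > -1" using Bergman by simp
  moreover have "real CARD('n) > 0" by simp
  ultimately show ?thesis using Bergman by simp
qed simp

lemma sets_ball_measure [measurable_cong]: "sets ball_measure = sets borel"
  by (simp add: ball_measure_def)

lemma sets_space_measure [measurable_cong]: "sets (space_measure X) = sets borel"
  by (cases X) (simp_all add: space_measure_def sphere_measure_def sets_ball_measure)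

lemma space_space_measure [simp]: "space (space_measure X) = UNIV"
  using sets_eq_imp_space_eq[OF sets_space_measure] by simp

lemma borel_measurable_sgn_eucl: "(sgn :: 'a::euclidean_space \<Rightarrow> 'a) \<in> borel_measurable borel"
  unfolding sgn_div_norm[abs_def] by measurable

lemma bergman_weight_nonneg: "s > -1 \<Longrightarrow> bergman_weight s (z :: complex ^ 'n) \<ge> 0"
  using Gamma_real_pos[of "real CARD('n) + s + 1"] Gamma_real_pos[of "s + 1"] Gamma_real_pos[of "real CARD('n) + 1"]
  by (auto simp: bergman_weight_def intro!: mult_nonneg_nonneg divide_nonneg_nonneg)

lemma bergman_weight_measurable [measurable]: "bergman_weight s \<in> borel_measurable borel"
  unfolding bergman_weight_def[abs_def] by measurable

lemma nn_integral_ball_measure: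
  fixes f :: "complex ^ 'n \<Rightarrow> ennreal"
  assumes [measurable]: "f \<in> borel_measurable borel"
  shows "(\<integral>\<^sup>+z. f z \<partial>ball_measure) = (\<integral>\<^sup>+z. f z * indicator (ball 0 1) z \<partial>lborel) / ennreal (unit_ball_vol (real DIM(complex ^ 'n)))"
  unfolding ball_measure_def by (subst nn_integral_uniform_measure) (simp_all add: emeasure_unit_ball del: DIM_cart)

lemma ennreal_cancel_factor:
  assumes "0 < v" "0 \<le> a"
  shows "ennreal (v * a) * I / ennreal v = ennreal a * I"
proof -
  have "ennreal (v * a) * I = (ennreal a * I) * ennreal v"
    using assms by (simp add: ennreal_mult mult_ac)
  moreover have "(ennreal a * I) * ennreal v / ennreal v = ennreal a * I"
    by (rule ennreal_mult_divide_eq) (use assms in \<open>auto simp: ennreal_eq_0_iff\<close>)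
  ultimately show ?thesis by simp
qed

text \<open>Restriction to the ball is itself a radial factor, \<open>|z|^2 < 1\<close>, so it can
  be absorbed into \<open>h\<close>. The volume of the ball cancels against the
  normalisation.\<close>

lemma ball_measure_radial_moment:
  fixes u :: "complex ^ 'n"
  assumes u: "norm u = 1" and [measurable]: "h \<in> borel_measurable borel"
  shows "(\<integral>\<^sup>+z. ennreal (cmod (cip z u) ^ (2*k)) * h ((norm z)\<^sup>2) \<partial>ball_measure)
    = ennreal (fact k * fact CARD('n) / fact (CARD('n) + k)) *
      (\<integral>\<^sup>+t. ennreal (real (CARD('n) + k) * t ^ (CARD('n) + k - 1)) * h t * indicator {0<..<1} t \<partial>lborel)"
proof -
  let ?V = "unit_ball_vol (real DIM(complex ^ 'n))"
  let ?I = "\<integral>\<^sup>+t. ennreal (real (CARD('n) + k) * t ^ (CARD('n) + k - 1)) * h t * indicator {0<..<1} t \<partial>lborel"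
  have V: "?V > 0" by (rule unit_ball_vol_pos) simp
  have "(\<integral>\<^sup>+z. ennreal (cmod (cip z u) ^ (2*k)) * h ((norm z)\<^sup>2) \<partial>ball_measure)
     = (\<integral>\<^sup>+z. ennreal (cmod (cip z u) ^ (2*k)) * h ((norm z)\<^sup>2) * indicator (ball 0 1) z \<partial>lborel) / ennreal ?V"
    by (rule nn_integral_ball_measure) measurable
  also have "(\<integral>\<^sup>+z. ennreal (cmod (cip z u) ^ (2*k)) * h ((norm z)\<^sup>2) * indicator (ball 0 1) z \<partial>lborel)
     = (\<integral>\<^sup>+z. ennreal (cmod (cip z u) ^ (2*k)) * (h ((norm z)\<^sup>2) * indicator {..<1} ((norm z)\<^sup>2)) \<partial>lborel)"
    by (intro nn_integral_cong) (auto simp: indicator_def abs_square_less_1)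
  also have "\<dots> = ennreal (?V * fact k * fact CARD('n) / fact (CARD('n) + k)) *
     (\<integral>\<^sup>+t. ennreal (real (CARD('n) + k) * t ^ (CARD('n) + k - 1)) * (h t * indicator {..<1} t) * indicator {0<..} t \<partial>lborel)"
    by (rule radial_moment[OF u]) measurable
  also have "(\<integral>\<^sup>+t. ennreal (real (CARD('n) + k) * t ^ (CARD('n) + k - 1)) * (h t * indicator {..<1} t) * indicator {0<..} t \<partial>lborel) = ?I"
    by (intro nn_integral_cong) (auto simp: indicator_def)
  also have "ennreal (?V * fact k * fact CARD('n) / fact (CARD('n) + k)) * ?I / ennreal ?V
     = ennreal (fact k * fact CARD('n) / fact (CARD('n) + k)) * ?I"
    using ennreal_cancel_factor[OF V, of "fact k * fact CARD('n) / fact (CARD('n) + k)" ?I] by (simp add: mult.assoc del: DIM_cart)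
  finally show ?thesis .
qed

lemma pochhammer_fact_quotient: "0 < n \<Longrightarrow> pochhammer (real n) k = fact (n + k - 1) / fact (n - 1)"
proof (induction k)
  case (Suc k)
  have "fact (n + k) = (real n + real k) * fact (n + k - 1)"
    using Suc.prems by (subst fact_reduce) auto
  then show ?case using Suc by (simp add: pochhammer_Suc field_simps)
qed simp

text \<open>Both cases reduce to a radial weight on the ball. For the cone measure,
  \<open>|cip (sgn z) u|^(2k)\<close> differs from \<open>|cip z u|^(2k)\<close> by the radial
  factor \<open>|z|^(-2k)\<close>, and an elementary integral remains; the Bergman weight leads to a
  Beta integral. The result depends on the space only through the kernel exponent.\<close>

lemma space_moment:
  fixes u :: "complex ^ 'n"
  assumes X: "admissible X" and u: "norm u = 1"
  shows "(\<integral>\<^sup>+z. ennreal (cmod (cip z u) ^ (2*k)) \<partial>space_measure X)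
    = ennreal (1 / bcoef (kernel_exponent X CARD('n)) k)"
proof (cases X)
  case Hardy
  define h :: "real \<Rightarrow> ennreal" where "h t = ennreal (inverse (t ^ k))" for t
  have [measurable]: "h \<in> borel_measurable borel" unfolding h_def[abs_def] by measurable
  have N: "0 < CARD('n)" by simp
  have "(\<integral>\<^sup>+z. ennreal (cmod (cip z u) ^ (2*k)) \<partial>space_measure X)
     = (\<integral>\<^sup>+z. ennreal (cmod (cip (sgn z) u) ^ (2*k)) \<partial>ball_measure)"
    using Hardy borel_measurable_sgn_eucl
    by (simp add: space_measure_def sphere_measure_def nn_integral_distr measurable_cong_sets[OF sets_ball_measure refl])
  also have "\<dots> = (\<integral>\<^sup>+z. ennreal (cmod (cip z u) ^ (2*k)) * h ((norm z)\<^sup>2) \<partial>ball_measure)"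
  proof (rule nn_integral_cong)
    fix z :: "complex ^ 'n"
    show "ennreal (cmod (cip (sgn z) u) ^ (2*k)) = ennreal (cmod (cip z u) ^ (2*k)) * h ((norm z)\<^sup>2)"
    proof (cases "z = 0")
      \<comment> \<open>Here \<open>sgn 0 = 0\<close>. For \<open>k = 0\<close> both sides are 1,
        because \<open>inverse (0 ^ 0) = 1\<close>; for \<open>k > 0\<close> both vanish.\<close>
      case True then show ?thesis by (cases k) (auto simp: h_def)
    next
      case False
      have "cmod (cip (sgn z) u) ^ (2*k) = cmod (cip z u) ^ (2*k) * inverse (((norm z)\<^sup>2) ^ k)"
        using False by (simp add: sgn_div_norm cip_scaleR_left norm_mult power_mult_distrib norm_inverse power_inverse power_mult)
      then show ?thesis by (simp add: h_def ennreal_mult')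
    qed
  qed
  also have "\<dots> = ennreal (fact k * fact CARD('n) / fact (CARD('n) + k)) *
      (\<integral>\<^sup>+t. ennreal (real (CARD('n) + k) * t ^ (CARD('n) + k - 1)) * h t * indicator {0<..<1} t \<partial>lborel)"
    by (rule ball_measure_radial_moment[OF u]) measurable
  also have "(\<integral>\<^sup>+t. ennreal (real (CARD('n) + k) * t ^ (CARD('n) + k - 1)) * h t * indicator {0<..<1} t \<partial>lborel)
     = (\<integral>\<^sup>+t. ennreal (real (CARD('n) + k) * t ^ (CARD('n) - 1)) * indicator {0..1} t \<partial>lborel)"
  proof (rule nn_integral_cong_AE)
    have "AE t in lborel. t \<noteq> 0 \<and> t \<noteq> (1::real)"
      using AE_lborel_singleton[of "0::real"] AE_lborel_singleton[of "1::real"] by eventually_elim auto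
    then show "AE t in lborel. ennreal (real (CARD('n) + k) * t ^ (CARD('n) + k - 1)) * h t * indicator {0<..<1} t
       = ennreal (real (CARD('n) + k) * t ^ (CARD('n) - 1)) * indicator {0..1} t"
    proof eventually_elim
      case (elim t)
      have "t ^ (CARD('n) + k - 1) * inverse (t ^ k) = t ^ (CARD('n) - 1)" if "t > 0"
      proof -
        have "CARD('n) + k - 1 = (CARD('n) - 1) + k" using N by linarith
        then have "t ^ (CARD('n) + k - 1) = t ^ (CARD('n) - 1) * t ^ k" by (simp only: power_add)
        then show ?thesis using that by simp
      qed
      then show ?case using elim
        by (auto simp: indicator_def h_def ennreal_mult'[symmetric] mult.assoc)
    qed
  qed
  also have "\<dots> = ennreal (real (CARD('n) + k) / CARD('n) * 1 ^ CARD('n) - real (CARD('n) + k) / CARD('n) * 0 ^ CARD('n))"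
    by (rule nn_integral_FTC_Icc) (auto intro!: derivative_eq_intros)
  also have "ennreal (fact k * fact CARD('n) / fact (CARD('n) + k)) * \<dots> = ennreal (1 / bcoef (real CARD('n)) k)"
  proof -
    have f1: "fact (CARD('n) + k) = (real CARD('n) + real k) * fact (CARD('n) + k - 1)"
      using N by (subst fact_reduce) auto
    have f2: "fact CARD('n) = real CARD('n) * fact (CARD('n) - 1)"
      using N by (subst fact_reduce) auto
    have "fact k * fact CARD('n) / fact (CARD('n) + k) * (real (CARD('n) + k) / CARD('n)) = 1 / bcoef (real CARD('n)) k"
    proof -
      have "real CARD('n) + real k \<noteq> 0" by (intro less_imp_neq[symmetric] add_pos_nonneg) auto
      then show ?thesis
        unfolding bcoef_def pochhammer_fact_quotient[OF N] f1 f2 by (simp add: divide_simps)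
    qed
    then show ?thesis using N by (simp add: zero_power flip: ennreal_mult')
  qed
  finally show ?thesis using Hardy by simp
next
  case (Bergman s)
  have s: "s > -1" using X Bergman by simp
  define N where "N = CARD('n)"
  have N: "0 < N" by (simp add: N_def)
  define C where "C = Gamma (real N + s + 1) / (Gamma (real N + 1) * Gamma (s + 1))"
  have C: "C \<ge> 0"
    using s by (auto simp: C_def intro!: divide_nonneg_nonneg mult_nonneg_nonneg Gamma_real_nonneg)
  define h :: "real \<Rightarrow> ennreal" where "h t = ennreal (C * (1 - t) powr s)" for t
  have [measurable]: "h \<in> borel_measurable borel" unfolding h_def[abs_def] by measurable
  have w: "ennreal (bergman_weight s z) = h ((norm z)\<^sup>2)" for z :: "complex ^ 'n"
    by (simp add: h_def C_def N_def bergman_weight_def)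
  have "(\<integral>\<^sup>+z. ennreal (cmod (cip z u) ^ (2*k)) \<partial>space_measure X)
     = (\<integral>\<^sup>+z. ennreal (cmod (cip z u) ^ (2*k)) * h ((norm z)\<^sup>2) \<partial>ball_measure)"
    using Bergman
    by (simp add: space_measure_def nn_integral_density w mult.commute measurable_cong_sets[OF sets_ball_measure refl])
  also have "\<dots> = ennreal (fact k * fact N / fact (N + k)) *
      (\<integral>\<^sup>+t. ennreal (real (N + k) * t ^ (N + k - 1)) * h t * indicator {0<..<1} t \<partial>lborel)"
    unfolding N_def by (rule ball_measure_radial_moment[OF u]) measurable
  also have "(\<integral>\<^sup>+t. ennreal (real (N + k) * t ^ (N + k - 1)) * h t * indicator {0<..<1} t \<partial>lborel)
     = (\<integral>\<^sup>+t. ennreal (C * real (N + k)) * ennreal (indicator {0..1} t * (t powr (real (N + k) - 1) * (1 - t) powr ((s + 1) - 1))) \<partial>lborel)"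
  proof (rule nn_integral_cong_AE)
    have "AE t in lborel. t \<noteq> 0 \<and> t \<noteq> (1::real)"
      using AE_lborel_singleton[of "0::real"] AE_lborel_singleton[of "1::real"] by eventually_elim auto
    then show "AE t in lborel. ennreal (real (N + k) * t ^ (N + k - 1)) * h t * indicator {0<..<1} t
       = ennreal (C * real (N + k)) * ennreal (indicator {0..1} t * (t powr (real (N + k) - 1) * (1 - t) powr ((s + 1) - 1)))"
    proof eventually_elim
      case (elim t)
      have "t powr (real (N + k) - 1) = t ^ (N + k - 1)" if "t > 0"
        using that N by (subst powr_realpow[symmetric]) (auto simp: of_nat_diff)
      then show ?case using elim C
        by (auto simp: indicator_def h_def ennreal_mult'[symmetric] mult_ac)
    qed
  qed
  also have "\<dots> = ennreal (C * real (N + k)) * ennreal (Beta (real (N + k)) (s + 1))"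
    using nn_integral_has_integral_lebesgue[OF _ has_integral_Beta_real[of "real (N + k)" "s + 1"]] N s
    by (subst nn_integral_cmult) auto
  \<comment> \<open>The factor \<open>real (N + k)\<close> completes
    \<open>Gamma (real (N + k))\<close> to \<open>fact (N + k)\<close>, and \<open>C\<close> cancels
    everything but the quotient of Gamma values that is the Pochhammer symbol.\<close>
  also have "ennreal (fact k * fact N / fact (N + k)) * \<dots> = ennreal (1 / bcoef (real N + s + 1) k)"
  proof -
    have g: "Gamma (real N + 1) = fact N" using Gamma_fact[of N, where 'a=real] by (simp add: add.commute)
    have g2: "real (N + k) * Gamma (real (N + k)) = fact (N + k)"
    proof -
      have "real (N + k) \<notin> \<int>\<^sub>\<le>\<^sub>0" using N by (auto elim!: nonpos_Ints_cases)
      from Gamma_plus1[OF this] Gamma_fact[of "N + k", where 'a=real] show ?thesis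
        by (simp only: add.commute[of 1])
    qed
    have p: "pochhammer (real N + s + 1) k = Gamma (real N + s + 1 + k) / Gamma (real N + s + 1)"
      using s N by (intro pochhammer_Gamma) (auto elim!: nonpos_Ints_cases)
    have pos: "Gamma (real N + s + 1) > 0" "Gamma (s + 1) > 0" "Gamma (real N + s + 1 + k) > 0"
      using s N by (auto intro!: Gamma_real_pos)
    have "fact k * fact N / fact (N + k) * (C * real (N + k) * Beta (real (N + k)) (s + 1))
       = fact k * fact N / fact (N + k) * (C * (real (N + k) * Gamma (real (N + k))) * Gamma (s + 1) / Gamma (real N + s + 1 + k))"
      by (simp add: Beta_def add_ac)
    also have "\<dots> = 1 / bcoef (real N + s + 1) k"
      unfolding g2 C_def bcoef_def p g using pos by (simp add: field_simps)
    finally show ?thesis using C s N pos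
      by (simp add: ennreal_mult'[symmetric] Beta_def Gamma_real_nonneg)
  qed
  finally show ?thesis using Bergman by (simp add: N_def)
qed

lemma prob_space_measure:
  assumes X: "admissible X"
  shows "emeasure (space_measure X :: (complex ^ 'n) measure) UNIV = 1"
proof -
  define u :: "complex ^ 'n" where "u = axis undefined 1"
  have u: "norm u = 1" by (simp add: u_def)
  show ?thesis using space_moment[OF X u, of 0] by (simp add: bcoef_def)
qed

lemma finite_space_measure:
  "admissible X \<Longrightarrow> finite_measure (space_measure X :: (complex ^ 'n) measure)"
  by (rule finite_measureI) (simp add: prob_space_measure)

text \<open>Lebesgue measure is preserved, the weights depend on the norm only, and
  \<open>sgn\<close> commutes with a norm preserving linear map.\<close>

lemma distr_space_measure:
  fixes U :: "complex ^ 'n \<Rightarrow> complex ^ 'n"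
  assumes X: "admissible X" and U: "orthogonal_transformation U"
  shows "distr (space_measure X) borel U = space_measure X"
proof -
  have [measurable]: "U \<in> borel_measurable borel"
    using U by (rule orthogonal_transformation_measurable)
  have nU: "norm (U z) = norm z" for z using U by (simp add: orthogonal_transformation_norm)
  let ?g = "\<lambda>z :: complex ^ 'n. indicator (ball 0 1) z / emeasure lborel (ball (0 :: complex ^ 'n) 1)"
  have B: "ball_measure = density lborel ?g" by (simp add: ball_measure_def uniform_measure_def)
  have ginv: "?g (U z) = ?g z" for z by (simp add: indicator_def nU)
  have [measurable]: "?g \<in> borel_measurable borel"
    by (intro borel_measurable_divide_ennreal borel_measurable_indicator borel_measurable_const) auto
  show ?thesis
  proof (cases X)
    case Hardy
    have [measurable]: "(sgn :: complex ^ 'n \<Rightarrow> _) \<in> borel_measurable borel"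
      by (rule borel_measurable_sgn_eucl)
    have "U \<circ> sgn = sgn \<circ> U"
      using orthogonal_transformation_scaleR[OF U] by (auto simp: sgn_div_norm nU)
    then have "distr (distr ball_measure borel sgn) borel U = distr (distr ball_measure borel U) borel sgn"
      by (simp add: distr_distr measurable_cong_sets[OF sets_ball_measure refl])
    also have "distr ball_measure borel U = ball_measure"
      unfolding B using U ginv by (intro distr_density_orthogonal) auto
    finally show ?thesis using Hardy by (simp add: space_measure_def sphere_measure_def)
  next
    case (Bergman s)
    have "space_measure X = density lborel (\<lambda>z. ?g z * ennreal (bergman_weight s z))"
      using Bergman by (simp add: space_measure_def B density_density_eq)
    then show ?thesis
      using ginv by (simp only:) (rule distr_density_orthogonal[OF U]; simp add: bergman_weight_def nU)
  qed
qed

text \<open>On the sphere \<open>r *\<^sub>R z\<close> has norm at most \<open>r < 1\<close>, and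
  the Bergman measure lives on the ball. Almost every evaluation point thus lies where functions in
  the space are holomorphic.\<close>

lemma AE_space_measure:
  fixes r :: real
  assumes "r \<in> radii X"
  shows "AE z in space_measure X. norm (r *\<^sub>R (z :: complex ^ 'n)) < 1"
proof (cases X)
  case Hardy
  have "norm (r *\<^sub>R sgn z) < 1" for z :: "complex ^ 'n"
    using assms Hardy by (auto simp: radii_def norm_sgn)
  then have "AE z in distr ball_measure borel sgn. norm (r *\<^sub>R (z :: complex ^ 'n)) < 1"
    by (subst AE_distr_iff) (simp_all add: borel_measurable_sgn_eucl measurable_cong_sets[OF sets_ball_measure refl])
  moreover have "space_measure X = distr ball_measure borel (sgn :: complex ^ 'n \<Rightarrow> _)"
    using Hardy by (simp add: space_measure_def sphere_measure_def)
  ultimately show ?thesis by (simp only:)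
next
  case (Bergman s)
  have "AE z in lborel. z \<in> ball (0 :: complex ^ 'n) 1 \<longrightarrow> norm z < 1" by auto
  then have "AE z in ball_measure. norm (z :: complex ^ 'n) < 1"
    unfolding ball_measure_def
    by (intro AE_uniform_measureI) auto
  then have "AE z in density ball_measure (\<lambda>z. ennreal (bergman_weight s z)). norm (z :: complex ^ 'n) < 1"
    by (subst AE_density) (auto simp: measurable_cong_sets[OF sets_ball_measure refl])
  moreover have "space_measure X = density ball_measure (\<lambda>z :: complex ^ 'n. ennreal (bergman_weight s z))" "r = 1"
    using assms Bergman by (simp_all add: space_measure_def radii_def)
  ultimately show ?thesis by (simp only: scaleR_one)
qed

lemma sqnorm_eq:
  fixes f :: "complex ^ 'n \<Rightarrow> complex"
  assumes X: "admissible X" and [measurable]: "f \<in> borel_measurable borel"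
  shows "sqnorm X f = (SUP r\<in>radii X. \<integral>\<^sup>+z. ennreal ((cmod (f (r *\<^sub>R z)))\<^sup>2) \<partial>space_measure X)"
proof (cases X)
  case (Bergman s)
  have "s > -1" using X Bergman by simp
  then show ?thesis using Bergman
    by (simp add: radii_def space_measure_def nn_integral_density measurable_cong_sets[OF sets_ball_measure refl]
      ennreal_mult'' bergman_weight_nonneg mult.commute)
qed (simp add: radii_def space_measure_def)

section \<open>Point evaluation along a slice\<close>

lemma holomorphic_mv_line:
  fixes f :: "complex ^ 'n \<Rightarrow> complex"
  assumes f: "holomorphic_mv f S" and A: "\<And>\<tau>. \<tau> \<in> A \<Longrightarrow> p + \<tau> *s q \<in> S"
  shows "(\<lambda>\<tau>. f (p + \<tau> *s q)) holomorphic_on A"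
proof (rule holomorphic_onI)
  fix \<tau> assume "\<tau> \<in> A"
  then obtain D where D: "(f has_derivative D) (at (p + \<tau> *s q))" "\<And>a v. D (a *s v) = a * D v"
    using f A unfolding holomorphic_mv_def by blast
  have "((\<lambda>\<tau>. p + \<tau> *s q) has_derivative (\<lambda>h. 0 + h *s q)) (at \<tau>)"
    by (intro has_derivative_add has_derivative_const has_derivative_ident
        bounded_linear.has_derivative[OF bounded_linear_smult_left])
  from has_derivative_compose[OF this D(1)]
  have "((\<lambda>\<tau>. f (p + \<tau> *s q)) has_derivative (\<lambda>h. D q * h)) (at \<tau>)"
    by (simp add: D(2) mult.commute)
  then have "((\<lambda>\<tau>. f (p + \<tau> *s q)) has_field_derivative D q) (at \<tau>)"
    by (simp add: has_field_derivative_def)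
  then show "(\<lambda>\<tau>. f (p + \<tau> *s q)) field_differentiable at \<tau> within A"
    using field_differentiable_def field_differentiable_at_within by blast
qed

lemma holomorphic_mv_continuous_on:
  "holomorphic_mv f S \<Longrightarrow> continuous_on S f"
  unfolding holomorphic_mv_def
  by (intro continuous_at_imp_continuous_on ballI) (blast dest: has_derivative_continuous)

lemma borel_measurable_holomorphic_mv:
  fixes f :: "complex ^ 'n \<Rightarrow> complex"
  assumes "holomorphic_mv f unit_ball" "\<And>z. z \<notin> unit_ball \<Longrightarrow> f z = 0"
  shows "f \<in> borel_measurable borel"
proof -
  have "(\<lambda>z. indicator (ball 0 1) z *\<^sub>R f z) \<in> borel_measurable borel"
    by (rule borel_measurable_continuous_on_indicator)
      (auto intro: holomorphic_mv_continuous_on assms)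
  moreover have "(\<lambda>z. indicator (ball 0 1) z *\<^sub>R f z) = f"
    using assms(2) by (auto simp: indicator_def fun_eq_iff)
  ultimately show ?thesis by simp
qed

lemma carrier_of_measurable: "f \<in> carrier_of X \<Longrightarrow> f \<in> borel_measurable borel"
  unfolding carrier_of_def by (auto intro: borel_measurable_holomorphic_mv)

text \<open>Subharmonicity of \<open>|h|^2\<close> at the centre, read off from Parseval's identity
  by keeping only the coefficient of order 0. The radius \<open>\<rho> > 1\<close> makes the Taylor
  series absolutely summable on the unit circle.\<close>

lemma circle_mean_square_ge:
  assumes h: "h holomorphic_on ball 0 \<rho>" and \<rho>: "\<rho> > 1"
  shows "ennreal (2 * pi) * ennreal ((cmod (h 0))\<^sup>2)
    \<le> (\<integral>\<^sup>+\<theta>. ennreal ((cmod (h (cis \<theta>)))\<^sup>2) * indicator {0..2*pi} \<theta> \<partial>lborel)"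
proof -
  define a where "a k = (deriv ^^ k) h 0 / fact k" for k
  have sums: "(\<lambda>k. a k * w ^ k) sums h w" if "cmod w < \<rho>" for w
    using holomorphic_power_series[OF h, of w] that by (simp add: a_def)
  have "summable (\<lambda>k. a k * of_real ((1 + \<rho>) / 2) ^ k)"
    using sums[of "of_real ((1 + \<rho>) / 2)"] \<rho> by (simp only: norm_of_real sums_iff) auto
  from powser_insidea[OF this, of 1] \<rho> have sa: "summable (\<lambda>k. cmod (a k))"
    by (simp del: of_real_divide of_real_add)
  have "h (cis \<theta>) = (\<Sum>k. a k * cis \<theta> ^ k)" for \<theta>
    using sums[of "cis \<theta>"] \<rho> by (simp add: sums_iff)
  then have "(\<integral>\<^sup>+\<theta>. ennreal ((cmod (h (cis \<theta>)))\<^sup>2) * indicator {0..2*pi} \<theta> \<partial>lborel)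
    = ennreal (2 * pi) * (\<Sum>k. ennreal ((cmod (a k))\<^sup>2))"
    using parseval_circle[OF sa] by simp
  moreover have "ennreal ((cmod (h 0))\<^sup>2) \<le> (\<Sum>k. ennreal ((cmod (a k))\<^sup>2))"
  proof -
    have "a 0 = h 0" by (simp add: a_def)
    then have "ennreal ((cmod (h 0))\<^sup>2) = (\<Sum>k\<in>{0}. ennreal ((cmod (a k))\<^sup>2))" by simp
    also have "\<dots> \<le> (\<Sum>k. ennreal ((cmod (a k))\<^sup>2))" by (rule sum_le_suminf) auto
    finally show ?thesis .
  qed
  ultimately show ?thesis by (simp add: mult_left_mono)
qed

lemma sigma_finite_space_measure:
  "admissible X \<Longrightarrow> sigma_finite_measure (space_measure X :: (complex ^ 'n) measure)"
  using finite_space_measure[of X, where 'n='n] unfolding finite_measure_def by blast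

text \<open>Rotating the complement of \<open>u\<close> moves \<open>z\<close> on a circle around
  its projection \<open>cip z u *s u\<close>, and the mean of \<open>|f|^2\<close> over that circle
  dominates the value at the centre. The measure is invariant under the rotation, so the inequality
  can be integrated.\<close>

lemma space_integral_slice_le:
  fixes f :: "complex ^ 'n \<Rightarrow> complex"
  assumes X: "admissible X" and f: "holomorphic_mv f unit_ball" and fm [measurable]: "f \<in> borel_measurable borel"
    and u: "norm u = 1" and r: "r \<in> radii X"
  shows "(\<integral>\<^sup>+z. ennreal ((cmod (f (r *\<^sub>R (cip z u *s u))))\<^sup>2) \<partial>space_measure X)
    \<le> (\<integral>\<^sup>+z. ennreal ((cmod (f (r *\<^sub>R z)))\<^sup>2) \<partial>space_measure X)"
proof -
  have "ennreal (2 * pi) * (\<integral>\<^sup>+z. ennreal ((cmod (f (r *\<^sub>R (cip z u *s u))))\<^sup>2) \<partial>space_measure X)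
    = (\<integral>\<^sup>+z. ennreal (2 * pi) * ennreal ((cmod (f (r *\<^sub>R (cip z u *s u))))\<^sup>2) \<partial>space_measure X)"
    by (rule nn_integral_cmult[symmetric]) (simp add: measurable_cong_sets[OF sets_space_measure refl])
  also have "\<dots> \<le> (\<integral>\<^sup>+z. (\<integral>\<^sup>+\<theta>. ennreal ((cmod (f (r *\<^sub>R (cperp_rot u (cis \<theta>) z))))\<^sup>2) * indicator {0..2*pi} \<theta> \<partial>lborel) \<partial>space_measure X)"
  proof (rule nn_integral_mono_AE)
    show "AE z in space_measure X. ennreal (2 * pi) * ennreal ((cmod (f (r *\<^sub>R (cip z u *s u))))\<^sup>2)
      \<le> (\<integral>\<^sup>+\<theta>. ennreal ((cmod (f (r *\<^sub>R (cperp_rot u (cis \<theta>) z))))\<^sup>2) * indicator {0..2*pi} \<theta> \<partial>lborel)"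
      using AE_space_measure[OF r]
    proof eventually_elim
      case (elim z)
      define x where "x = norm (r *\<^sub>R z)"
      define p where "p = r *\<^sub>R (cip z u *s u)"
      define v where "v = r *\<^sub>R (z - cip z u *s u)"
      \<comment> \<open>The radius exceeds 1 and satisfies \<open>\<rho> * x < 1\<close>. By
        orthogonality the points \<open>p + \<tau> *s v\<close> with
        \<open>cmod \<tau> < \<rho>\<close> have norm at most \<open>\<rho> * x\<close>.\<close>
      define \<rho> where "\<rho> = 2 / (1 + x)"
      have x: "0 \<le> x" "x < 1" using elim by (auto simp: x_def)
      have \<rho>: "\<rho> > 1" using x by (simp add: \<rho>_def field_simps)
      have "p + \<tau> *s v \<in> ball 0 1" if "cmod \<tau> < \<rho>" for \<tau>
      proof -
        have p: "p = (of_real r * cip z u) *s u" by (simp add: p_def scaleR_eq_smult)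
        have v0: "cip v u = 0" by (simp add: v_def cip_scaleR_left u)
        have "(norm (p + \<tau> *s v))\<^sup>2 = (cmod (of_real r * cip z u))\<^sup>2 + (cmod \<tau>)\<^sup>2 * (norm v)\<^sup>2"
          unfolding p by (subst norm_orthogonal_decomposition[OF u]) (simp_all add: cip_scale_left v0 norm_smult power_mult_distrib)
        also have "\<dots> \<le> \<rho>\<^sup>2 * (cmod (of_real r * cip z u))\<^sup>2 + \<rho>\<^sup>2 * (norm v)\<^sup>2"
        proof (rule add_mono)
          show "(cmod (of_real r * cip z u))\<^sup>2 \<le> \<rho>\<^sup>2 * (cmod (of_real r * cip z u))\<^sup>2"
            using mult_right_mono[of 1 "\<rho>\<^sup>2" "(cmod (of_real r * cip z u))\<^sup>2"] \<rho> by (simp add: one_le_power)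
          show "(cmod \<tau>)\<^sup>2 * (norm v)\<^sup>2 \<le> \<rho>\<^sup>2 * (norm v)\<^sup>2"
            using that by (intro mult_right_mono power_mono) auto
        qed
        also have "\<dots> = \<rho>\<^sup>2 * (norm (p + v))\<^sup>2"
          unfolding p by (subst norm_orthogonal_decomposition[OF u v0]) (simp add: distrib_left)
        also have "p + v = r *\<^sub>R z" by (simp add: p_def v_def scaleR_right_diff_distrib)
        also have "\<rho>\<^sup>2 * (norm (r *\<^sub>R z))\<^sup>2 = (\<rho> * x)\<^sup>2" by (simp add: x_def power_mult_distrib)
        also have "\<dots> < 1"
        proof -
          have "\<rho> * x < 1" "0 \<le> \<rho> * x" using x by (auto simp: \<rho>_def field_simps)
          then show ?thesis by (simp add: abs_square_less_1)
        qed
        finally show ?thesis by (simp add: abs_square_less_1)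
      qed
      then have "(\<lambda>\<tau>. f (p + \<tau> *s v)) holomorphic_on ball 0 \<rho>"
        by (intro holomorphic_mv_line[OF f]) auto
      from circle_mean_square_ge[OF this \<rho>]
      have "ennreal (2 * pi) * ennreal ((cmod (f p))\<^sup>2)
        \<le> (\<integral>\<^sup>+\<theta>. ennreal ((cmod (f (p + cis \<theta> *s v)))\<^sup>2) * indicator {0..2*pi} \<theta> \<partial>lborel)"
        by simp
      moreover have "p + cis \<theta> *s v = r *\<^sub>R (cperp_rot u (cis \<theta>) z)" for \<theta>
        by (simp add: p_def v_def cperp_rot_def scaleR_eq_smult algebra_simps vec_eq_iff)
      ultimately show ?case by (simp add: p_def)
    qed
  qed
  also have "\<dots> = ennreal (2 * pi) * (\<integral>\<^sup>+z. ennreal ((cmod (f (r *\<^sub>R z)))\<^sup>2) \<partial>space_measure X)"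
  proof (rule nn_integral_rotation_average[symmetric])
    show "distr (space_measure X) borel (cperp_rot u (cis \<theta>)) = space_measure X" for \<theta>
      by (rule distr_space_measure[OF X orthogonal_transformation_cperp_rot[OF u]]) simp
    show "continuous_on UNIV (\<lambda>p. cperp_rot u (cis (fst p)) (snd p))"
      unfolding cperp_rot_def by (intro continuous_intros)
    show "(\<lambda>z. ennreal ((cmod (f (r *\<^sub>R z)))\<^sup>2)) \<in> borel_measurable borel" by measurable
  qed (rule sigma_finite_space_measure[OF X] sets_space_measure)+
  finally show ?thesis by (subst (asm) ennreal_mult_le_mult_iff) auto
qed

text \<open>Averaging over unimodular multiples of \<open>z\<close> and applying Parseval's identity
  replaces the square of the series by the series of squares, which is integrated term by term with
  the moments. No finiteness is assumed; both sides may be infinite.\<close>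

lemma space_integral_powser:
  fixes u :: "complex ^ 'n" and G :: "complex \<Rightarrow> complex"
  assumes X: "admissible X" and u: "norm u = 1" and r: "r \<in> radii X"
    and Gm [measurable]: "G \<in> borel_measurable borel"
    and G: "\<And>l. cmod l < 1 \<Longrightarrow> (\<lambda>k. a k * l ^ k) sums G l"
  shows "(\<integral>\<^sup>+z. ennreal ((cmod (G (of_real r * cip z u)))\<^sup>2) \<partial>space_measure X)
    = (\<Sum>k. ennreal ((cmod (a k))\<^sup>2 * r ^ (2*k) / bcoef (kernel_exponent X CARD('n)) k))"
proof -
  have r0: "0 < r" using radii_bounds[OF r] by simp
  have "ennreal (2 * pi) * (\<integral>\<^sup>+z. ennreal ((cmod (G (of_real r * cip z u)))\<^sup>2) \<partial>space_measure X)
    = (\<integral>\<^sup>+z. (\<integral>\<^sup>+\<theta>. ennreal ((cmod (G (of_real r * cip (cis \<theta> *s z) u)))\<^sup>2) * indicator {0..2*pi} \<theta> \<partial>lborel) \<partial>space_measure X)"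
  proof (rule nn_integral_rotation_average)
    show "distr (space_measure X) borel (\<lambda>z. cis \<theta> *s (z :: complex ^ 'n)) = space_measure X" for \<theta>
      by (rule distr_space_measure[OF X orthogonal_transformation_smult]) simp
    show "continuous_on UNIV (\<lambda>p. cis (fst p) *s (snd p :: complex ^ 'n))"
      by (intro continuous_intros)
  qed (auto simp: X sets_space_measure sigma_finite_space_measure)
  also have "\<dots> = (\<integral>\<^sup>+z. ennreal (2 * pi) * (\<Sum>k. ennreal ((cmod (a k))\<^sup>2 * r ^ (2*k)) * ennreal (cmod (cip z u) ^ (2*k))) \<partial>space_measure X)"
  proof (rule nn_integral_cong_AE)
    show "AE z in space_measure X. (\<integral>\<^sup>+\<theta>. ennreal ((cmod (G (of_real r * cip (cis \<theta> *s z) u)))\<^sup>2) * indicator {0..2*pi} \<theta> \<partial>lborel)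
      = ennreal (2 * pi) * (\<Sum>k. ennreal ((cmod (a k))\<^sup>2 * r ^ (2*k)) * ennreal (cmod (cip z u) ^ (2*k)))"
      using AE_space_measure[OF r]
    proof eventually_elim
      case (elim z)
      define l where "l = of_real r * cip z u"
      have l: "cmod l < 1"
        using elim cmod_cip_le[of "r *\<^sub>R z" u] u by (simp add: l_def cip_scaleR_left norm_mult)
      define x where "x = (1 + cmod l) / 2"
      have x: "cmod l < x" "x < 1" using l by (auto simp: x_def)
      have "summable (\<lambda>k. a k * of_real x ^ k)"
        using G[of "of_real x"] x order_trans[OF norm_ge_zero less_imp_le[OF x(1)]] by (auto simp: sums_iff)
      from powser_insidea[OF this, of l] x
      have sa: "summable (\<lambda>k. cmod (a k * l ^ k))" by simp
      have "G (of_real r * cip (cis \<theta> *s z) u) = (\<Sum>k. (a k * l ^ k) * cis \<theta> ^ k)" for \<theta>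
        using G[of "cis \<theta> * l"] l
        by (simp add: sums_iff norm_mult cip_scale_left power_mult_distrib mult_ac l_def)
      moreover have "(cmod (a k * l ^ k))\<^sup>2 = (cmod (a k))\<^sup>2 * r ^ (2*k) * cmod (cip z u) ^ (2*k)" for k
        using r0 by (simp add: l_def norm_mult norm_power power_mult_distrib power_even_eq)
      ultimately show ?case
        using parseval_circle[OF sa] r0 by (simp add: ennreal_mult'[symmetric])
    qed
  qed
  also have "\<dots> = ennreal (2 * pi) * (\<Sum>k. ennreal ((cmod (a k))\<^sup>2 * r ^ (2*k)) * (\<integral>\<^sup>+z. ennreal (cmod (cip z u) ^ (2*k)) \<partial>space_measure X))"
    by (simp add: nn_integral_cmult nn_integral_suminf measurable_cong_sets[OF sets_space_measure refl])
  also have "\<dots> = ennreal (2 * pi) * (\<Sum>k. ennreal ((cmod (a k))\<^sup>2 * r ^ (2*k) / bcoef (kernel_exponent X CARD('n)) k))"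
    unfolding space_moment[OF X u]
    using r0 bcoef_pos[OF kernel_exponent_pos[OF X, where 'n='n]] by (simp add: ennreal_mult'[symmetric] less_imp_le)
  finally show ?thesis by (simp add: ennreal_mult_cancel_left)
qed

section \<open>The kernel series and sharp point estimates\<close>

text \<open>The generalised binomial series: \<open>(- \<beta>) gchoose k\<close> times
  \<open>(- 1) ^ k\<close> is \<open>bcoef \<beta> k\<close>.\<close>

lemma kernel_series:
  assumes "cmod x < 1"
  shows "(\<lambda>k. of_real (bcoef \<beta> k) * x ^ k) sums ((1 - x) powr (- of_real \<beta>))"
proof -
  have "((- of_real \<beta>) gchoose k) * (- x) ^ k = of_real (bcoef \<beta> k) * x ^ k" for k
  proof -
    have "(- 1) ^ k * (- 1) ^ k = (1 :: complex)" by (simp flip: power_mult_distrib)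
    then show ?thesis
      unfolding gbinomial_pochhammer power_minus[of x k]
      by (simp add: bcoef_def pochhammer_of_real mult_ac)
  qed
  then show ?thesis using gen_binomial_complex[of "- x" "- of_real \<beta>"] assms by simp
qed

lemma kernel_series_real:
  fixes x :: real
  assumes "0 \<le> x" "x < 1"
  shows "(\<lambda>k. bcoef \<beta> k * x ^ k) sums ((1 - x) powr (- \<beta>))"
proof -
  have "(\<lambda>k. of_real (bcoef \<beta> k * x ^ k)) sums (complex_of_real ((1 - x) powr (- \<beta>)))"
    using kernel_series[of "of_real x" \<beta>] assms by (simp add: powr_of_real[symmetric])
  then show ?thesis by (simp only: sums_of_real_iff)
qed

text \<open>Cauchy-Schwarz with the weights \<open>bcoef \<beta> k\<close>; the second factor is the
  kernel series at \<open>|l|^2\<close>. The constant is exactly 1, and the lower bound for the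
  essential norm inherits this sharpness.\<close>

lemma weighted_powser_bound:
  assumes \<beta>: "\<beta> > 0" and S: "\<And>n. (\<Sum>k<n. (cmod (a k))\<^sup>2 / bcoef \<beta> k) \<le> S"
    and l: "cmod l < 1" and v: "(\<lambda>k. a k * l ^ k) sums v"
  shows "(cmod v)\<^sup>2 * (1 - (cmod l)\<^sup>2) powr \<beta> \<le> S"
proof -
  have b: "bcoef \<beta> k > 0" for k using \<beta> by (rule bcoef_pos)
  have l2: "0 \<le> (cmod l)\<^sup>2" "(cmod l)\<^sup>2 < 1" using l by (simp_all add: abs_square_less_1)
  have "(cmod (\<Sum>k<n. a k * l ^ k))\<^sup>2 \<le> S * (1 - (cmod l)\<^sup>2) powr (- \<beta>)" for n
  proof -
    have S0: "0 \<le> S" using S[of 0] by simp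
    have "cmod (\<Sum>k<n. a k * l ^ k) \<le> (\<Sum>k<n. (cmod (a k) / sqrt (bcoef \<beta> k)) * (sqrt (bcoef \<beta> k) * cmod l ^ k))"
      by (rule order_trans[OF norm_sum]) (auto simp: norm_mult norm_power b less_imp_neq[symmetric] intro!: sum_mono)
    then have "(cmod (\<Sum>k<n. a k * l ^ k))\<^sup>2 \<le> (\<Sum>k<n. (cmod (a k) / sqrt (bcoef \<beta> k)) * (sqrt (bcoef \<beta> k) * cmod l ^ k))\<^sup>2"
      by (rule power_mono) simp
    also have "\<dots> \<le> (\<Sum>k<n. (cmod (a k) / sqrt (bcoef \<beta> k))\<^sup>2) * (\<Sum>k<n. (sqrt (bcoef \<beta> k) * cmod l ^ k)\<^sup>2)"
      by (rule Cauchy_Schwarz_ineq_sum)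
    also have "\<dots> = (\<Sum>k<n. (cmod (a k))\<^sup>2 / bcoef \<beta> k) * (\<Sum>k<n. bcoef \<beta> k * ((cmod l)\<^sup>2) ^ k)"
      using b by (simp add: power_divide power_mult_distrib less_imp_le power_commutes flip: power_mult) (simp add: mult.commute)
    also have "\<dots> \<le> S * (1 - (cmod l)\<^sup>2) powr (- \<beta>)"
    proof (rule mult_mono[OF S])
      show "(\<Sum>k<n. bcoef \<beta> k * ((cmod l)\<^sup>2) ^ k) \<le> (1 - (cmod l)\<^sup>2) powr (- \<beta>)"
        using kernel_series_real[OF l2, of \<beta>] b l2
        by (subst sums_unique[OF kernel_series_real[OF l2]], intro sum_le_suminf) (auto simp: sums_iff less_imp_le)
    qed (use S0 b in \<open>auto intro!: sum_nonneg simp: less_imp_le\<close>)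
    finally show ?thesis .
  qed
  moreover have "(\<lambda>n. (cmod (\<Sum>k<n. a k * l ^ k))\<^sup>2) \<longlonglongrightarrow> (cmod v)\<^sup>2"
    using v by (intro tendsto_intros) (simp add: sums_def)
  ultimately have "(cmod v)\<^sup>2 \<le> S * (1 - (cmod l)\<^sup>2) powr (- \<beta>)"
    by (intro LIMSEQ_le_const2) auto
  then show ?thesis using l2 by (simp add: powr_minus field_simps)
qed

text \<open>Combines the slice inequality with the integral of a power series: the Taylor
  coefficients of the slice function, weighted by the moments, are controlled by the norm. The bound
  concerns partial sums, so for the Hardy space it suffices to let \<open>r\<close> tend to 1 in a
  polynomial.\<close>

lemma carrier_slice_series:
  fixes f :: "complex ^ 'n \<Rightarrow> complex" and u :: "complex ^ 'n"
  assumes X: "admissible X" and f: "f \<in> carrier_of X" and u: "norm u = 1"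
  obtains a where "\<And>l. cmod l < 1 \<Longrightarrow> (\<lambda>k. a k * l ^ k) sums f (l *s u)"
    "\<And>n. (\<Sum>k<n. (cmod (a k))\<^sup>2 / bcoef (kernel_exponent X CARD('n)) k) \<le> (fnorm X f)\<^sup>2"
proof -
  define \<beta> where "\<beta> = kernel_exponent X CARD('n)"
  have b: "bcoef \<beta> k > 0" for k using kernel_exponent_pos[OF X, where 'n='n] by (simp add: \<beta>_def bcoef_pos)
  have hol: "holomorphic_mv f unit_ball" and fin: "sqnorm X f < \<infinity>"
    using f by (auto simp: carrier_of_def)
  have fm [measurable]: "f \<in> borel_measurable borel" using f by (rule carrier_of_measurable)
  define g where "g l = f (l *s u)" for l
  have gm: "g \<in> borel_measurable borel" unfolding g_def[abs_def] by measurable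
  define a where "a k = (deriv ^^ k) g 0 / fact k" for k
  have "(\<lambda>l. f (0 + l *s u)) holomorphic_on ball 0 1"
    by (rule holomorphic_mv_line[OF hol]) (simp add: norm_smult u)
  then have hg: "g holomorphic_on ball 0 1" by (simp add: g_def[abs_def])
  have sums: "(\<lambda>k. a k * l ^ k) sums g l" if "cmod l < 1" for l
    using holomorphic_power_series[OF hg, of l] that by (simp add: a_def)
  have le: "(\<Sum>k<n. (cmod (a k))\<^sup>2 * r ^ (2*k) / bcoef \<beta> k) \<le> (fnorm X f)\<^sup>2" if r: "r \<in> radii X" for r n
  proof -
    have "ennreal (\<Sum>k<n. (cmod (a k))\<^sup>2 * r ^ (2*k) / bcoef \<beta> k)
      = (\<Sum>k<n. ennreal ((cmod (a k))\<^sup>2 * r ^ (2*k) / bcoef \<beta> k))"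
      using radii_bounds[OF r] b by (subst sum_ennreal) (auto simp: less_imp_le)
    also have "\<dots> \<le> (\<Sum>k. ennreal ((cmod (a k))\<^sup>2 * r ^ (2*k) / bcoef \<beta> k))"
      by (rule sum_le_suminf) auto
    also have "\<dots> = (\<integral>\<^sup>+z. ennreal ((cmod (g (of_real r * cip z u)))\<^sup>2) \<partial>space_measure X)"
      unfolding \<beta>_def by (rule space_integral_powser[OF X u r gm sums, symmetric])
    also have "\<dots> = (\<integral>\<^sup>+z. ennreal ((cmod (f (r *\<^sub>R (cip z u *s u))))\<^sup>2) \<partial>space_measure X)"
      by (simp add: g_def scaleR_eq_smult)
    also have "\<dots> \<le> (\<integral>\<^sup>+z. ennreal ((cmod (f (r *\<^sub>R z)))\<^sup>2) \<partial>space_measure X)"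
      by (rule space_integral_slice_le[OF X hol fm u r])
    also have "\<dots> \<le> sqnorm X f"
      unfolding sqnorm_eq[OF X fm] using r by (rule SUP_upper)
    also have "\<dots> = ennreal ((fnorm X f)\<^sup>2)"
      using fin by (simp add: fnorm_def)
    finally show ?thesis by (simp add: ennreal_le_iff)
  qed
  show ?thesis
  proof
    show "(\<lambda>k. a k * l ^ k) sums f (l *s u)" if "cmod l < 1" for l
      using sums[OF that] by (simp add: g_def)
    show "(\<Sum>k<n. (cmod (a k))\<^sup>2 / bcoef (kernel_exponent X CARD('n)) k) \<le> (fnorm X f)\<^sup>2" for n
    proof (cases X)
      case Hardy
      have "((\<lambda>r. \<Sum>k<n. (cmod (a k))\<^sup>2 * r ^ (2*k) / bcoef \<beta> k) \<longlongrightarrow> (\<Sum>k<n. (cmod (a k))\<^sup>2 * 1 ^ (2*k) / bcoef \<beta> k)) (at_left 1)"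
        by (intro tendsto_intros) (simp add: b less_imp_neq[symmetric])
      moreover have "\<forall>\<^sub>F r in at_left 1. (\<Sum>k<n. (cmod (a k))\<^sup>2 * r ^ (2*k) / bcoef \<beta> k) \<le> (fnorm X f)\<^sup>2"
        using eventually_at_left_real[of 0 "1::real", OF zero_less_one]
        by (rule eventually_mono) (rule le, simp add: Hardy radii_def)
      ultimately show ?thesis
        by (intro tendsto_upperbound[where F="at_left (1::real)"]) (auto simp: \<beta>_def)
    next
      case (Bergman s)
      then show ?thesis using le[of 1 n] by (simp add: radii_def \<beta>_def)
    qed
  qed
qed

lemma carrier_point_bound:
  fixes f :: "complex ^ 'n \<Rightarrow> complex" and u :: "complex ^ 'n"
  assumes X: "admissible X" and f: "f \<in> carrier_of X" and u: "norm u = 1" and l: "cmod l < 1"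
  shows "(cmod (f (l *s u)))\<^sup>2 * (1 - (cmod l)\<^sup>2) powr kernel_exponent X CARD('n) \<le> (fnorm X f)\<^sup>2"
proof -
  obtain a where a: "\<And>l. cmod l < 1 \<Longrightarrow> (\<lambda>k. a k * l ^ k) sums f (l *s u)"
    "\<And>n. (\<Sum>k<n. (cmod (a k))\<^sup>2 / bcoef (kernel_exponent X CARD('n)) k) \<le> (fnorm X f)\<^sup>2"
    using carrier_slice_series[OF X f u] by blast
  show ?thesis by (rule weighted_powser_bound[OF kernel_exponent_pos[OF X] a(2) l a(1)[OF l]])
qed

text \<open>Weak convergence of the normalised kernels to 0. A Taylor polynomial of the slice
  function is bounded on the disc, hence killed by the vanishing factor; the tail has small weighted
  norm, and \<open>weighted_powser_bound\<close> controls it uniformly up to the boundary.\<close>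

lemma carrier_point_little_o:
  fixes f :: "complex ^ 'n \<Rightarrow> complex" and u :: "complex ^ 'n"
  assumes X: "admissible X" and f: "f \<in> carrier_of X" and u: "norm u = 1"
    and l: "\<forall>\<^sub>F x in F. cmod (l x) < 1" and l1: "((\<lambda>x. cmod (l x)) \<longlongrightarrow> 1) F"
  shows "((\<lambda>x. (cmod (f (l x *s u)))\<^sup>2 * (1 - (cmod (l x))\<^sup>2) powr kernel_exponent X CARD('n)) \<longlongrightarrow> 0) F"
proof -
  define \<beta> where "\<beta> = kernel_exponent X CARD('n)"
  have \<beta>: "\<beta> > 0" unfolding \<beta>_def by (rule kernel_exponent_pos[OF X])
  have b: "bcoef \<beta> k > 0" for k using \<beta> by (rule bcoef_pos)
  obtain a where a: "\<And>l. cmod l < 1 \<Longrightarrow> (\<lambda>k. a k * l ^ k) sums f (l *s u)"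
    "\<And>n. (\<Sum>k<n. (cmod (a k))\<^sup>2 / bcoef \<beta> k) \<le> (fnorm X f)\<^sup>2"
    using carrier_slice_series[OF X f u] unfolding \<beta>_def by blast
  define s where "s k = (cmod (a k))\<^sup>2 / bcoef \<beta> k" for k
  have s0: "s k \<ge> 0" for k using b[of k] by (simp add: s_def)
  have sm: "summable s"
    by (rule summableI_nonneg_bounded[of _ "(fnorm X f)\<^sup>2"]) (use a(2) s0 in \<open>auto simp: s_def\<close>)
  show ?thesis
    unfolding \<beta>_def[symmetric]
  proof (rule tendstoI)
    fix e :: real assume e: "e > 0"
    \<comment> \<open>Squaring a sum of two terms costs a factor 2, so a tail of
      \<open>e / 8\<close> contributes \<open>e / 4\<close>. The polynomial part contributes less
      than another \<open>e / 4\<close>.\<close>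
    obtain n where n: "\<And>m. m \<ge> n \<Longrightarrow> norm ((\<Sum>k. s k) - (\<Sum>k<m. s k)) < e / 8"
      using summable_LIMSEQ[OF sm] e unfolding LIMSEQ_iff by (metis divide_pos_pos norm_minus_commute zero_less_numeral)
    define a' where "a' k = (if k < n then 0 else a k)" for k
    have a': "(\<Sum>k<m. (cmod (a' k))\<^sup>2 / bcoef \<beta> k) \<le> e / 8" for m
    proof -
      have "(\<Sum>k<m. (cmod (a' k))\<^sup>2 / bcoef \<beta> k) = (\<Sum>k\<in>{n..<m}. s k)"
        by (rule sum.mono_neutral_cong_right) (auto simp: a'_def s_def)
      also have "\<dots> \<le> (\<Sum>k. s k) - (\<Sum>k<n. s k)"
      proof -
        have "(\<Sum>k<n. s k) + (\<Sum>k\<in>{n..<m}. s k) = (\<Sum>k\<in>{..<n} \<union> {n..<m}. s k)"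
          by (rule sum.union_disjoint[symmetric]) auto
        also have "\<dots> \<le> (\<Sum>k. s k)" by (rule sum_le_suminf[OF sm]) (auto simp: s0)
        finally show ?thesis by simp
      qed
      also have "\<dots> \<le> e / 8" using n[of n] by (simp only: real_norm_def) linarith
      finally show ?thesis .
    qed
    define C where "C = (\<Sum>k<n. cmod (a k))"
    have bound: "(cmod (f (w *s u)))\<^sup>2 * (1 - (cmod w)\<^sup>2) powr \<beta> \<le> 2 * C\<^sup>2 * (1 - (cmod w)\<^sup>2) powr \<beta> + e / 4"
      if w: "cmod w < 1" for w
    proof -
      define P where "P = (\<Sum>k<n. a k * w ^ k)"
      have "(\<lambda>k. a k * w ^ k - (if k < n then a k * w ^ k else 0)) sums (f (w *s u) - P)"
        unfolding P_def by (intro sums_diff a(1)[OF w] sums_If_finite_set[of "{..<n}", simplified])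
      moreover have "a k * w ^ k - (if k < n then a k * w ^ k else 0) = a' k * w ^ k" for k
        by (simp add: a'_def)
      ultimately have "(\<lambda>k. a' k * w ^ k) sums (f (w *s u) - P)" by simp
      from weighted_powser_bound[OF \<beta> a' w this]
      have t: "(cmod (f (w *s u) - P))\<^sup>2 * (1 - (cmod w)\<^sup>2) powr \<beta> \<le> e / 8" .
      have PC: "cmod P \<le> C"
        unfolding P_def C_def
        by (rule order_trans[OF norm_sum], rule sum_mono)
          (use w in \<open>auto simp: norm_mult norm_power intro!: mult_left_le power_le_one\<close>)
      have "cmod (f (w *s u)) \<le> cmod P + cmod (f (w *s u) - P)"
        using norm_triangle_ineq[of P "f (w *s u) - P"] by simp
      then have "(cmod (f (w *s u)))\<^sup>2 \<le> (cmod P + cmod (f (w *s u) - P))\<^sup>2" by (rule power_mono) simp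
      also have "\<dots> \<le> 2 * (cmod P)\<^sup>2 + 2 * (cmod (f (w *s u) - P))\<^sup>2"
        using sum_squares_bound[of "cmod P" "cmod (f (w *s u) - P)"] by (simp add: power2_sum)
      also have "\<dots> \<le> 2 * C\<^sup>2 + 2 * (cmod (f (w *s u) - P))\<^sup>2"
        using PC by (simp add: power_mono)
      finally have "(cmod (f (w *s u)))\<^sup>2 * (1 - (cmod w)\<^sup>2) powr \<beta>
        \<le> (2 * C\<^sup>2 + 2 * (cmod (f (w *s u) - P))\<^sup>2) * (1 - (cmod w)\<^sup>2) powr \<beta>"
        by (rule mult_right_mono) simp
      then show ?thesis using t by (simp add: algebra_simps)
    qed
    have "((\<lambda>x. 2 * C\<^sup>2 * (1 - (cmod (l x))\<^sup>2) powr \<beta>) \<longlongrightarrow> 2 * C\<^sup>2 * 0) F"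
    proof (intro tendsto_mult tendsto_const)
      have "((\<lambda>x. 1 - (cmod (l x))\<^sup>2) \<longlongrightarrow> 1 - 1\<^sup>2) F" by (intro tendsto_intros l1)
      then show "((\<lambda>x. (1 - (cmod (l x))\<^sup>2) powr \<beta>) \<longlongrightarrow> 0) F"
        using \<beta> l by (intro tendsto_zero_powrI[where b=\<beta>]) (auto elim!: eventually_mono simp: abs_square_le_1)
    qed
    then have "\<forall>\<^sub>F x in F. 2 * C\<^sup>2 * (1 - (cmod (l x))\<^sup>2) powr \<beta> < e / 4"
      using e by (intro order_tendstoD(2)) auto
    then show "\<forall>\<^sub>F x in F. dist ((cmod (f (l x *s u)))\<^sup>2 * (1 - (cmod (l x))\<^sup>2) powr \<beta>) 0 < e"
      using l
    proof eventually_elim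
      case (elim x)
      then show ?case using bound[of "l x"] e by simp
    qed
  qed
qed

section \<open>The Julia-Caratheodory theorem\<close>

lemma schwarz_pick_identity:
  fixes a b :: complex
  shows "(cmod (1 - cnj b * a))\<^sup>2 - (cmod (a - b))\<^sup>2 = (1 - (cmod a)\<^sup>2) * (1 - (cmod b)\<^sup>2)"
  unfolding cmod_power2 by (simp add: power2_eq_square algebra_simps)

lemma one_minus_cnj_mult_nonzero:
  assumes "cmod a < 1" "cmod b < 1" shows "1 - cnj b * a \<noteq> 0"
proof
  assume "1 - cnj b * a = 0"
  then have "cnj b * a = 1" by (metis eq_iff_diff_eq_0)
  then have "cmod (cnj b * a) = 1" by simp
  moreover have "cmod (cnj b * a) < 1" using assms norm_mult_less[of "cnj b" 1 a 1] by simp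
  ultimately show False by simp
qed

text \<open>Moebius maps move \<open>w\<close> and \<open>f w\<close> to the origin, where the
  Schwarz lemma applies. The inequality is stated without denominators so that one of the points can
  be sent to the boundary.\<close>

lemma schwarz_pick:
  assumes f: "f holomorphic_on ball 0 1" and f1: "\<And>z. cmod z < 1 \<Longrightarrow> cmod (f z) < 1"
    and z: "cmod z < 1" and w: "cmod w < 1"
  shows "(cmod (1 - f z * cnj (f w)))\<^sup>2 * ((1 - (cmod z)\<^sup>2) * (1 - (cmod w)\<^sup>2))
    \<le> (cmod (1 - z * cnj w))\<^sup>2 * ((1 - (cmod (f z))\<^sup>2) * (1 - (cmod (f w))\<^sup>2))"
proof -
  let ?M = "Moebius_function 0"
  define g where "g \<xi> = ?M (f w) (f (?M (- w) \<xi>))" for \<xi>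
  have mw: "cmod (- w) < 1" using w by simp
  have inball: "cmod (?M (- w) \<xi>) < 1" if "cmod \<xi> < 1" for \<xi>
    using Moebius_function_norm_lt_1[OF mw that] .
  have hol: "g holomorphic_on ball 0 1"
  proof -
    have "(f \<circ> ?M (- w)) holomorphic_on ball 0 1"
      using f by (rule holomorphic_on_compose_gen[OF Moebius_function_holomorphic[OF mw]]) (use inball in auto)
    then have "(?M (f w) \<circ> (f \<circ> ?M (- w))) holomorphic_on ball 0 1"
      by (rule holomorphic_on_compose_gen[OF _ Moebius_function_holomorphic[OF f1[OF w]]]) (use inball f1 in auto)
    then show ?thesis by (simp add: g_def[abs_def] o_def)
  qed
  have g0: "g 0 = 0" by (simp add: g_def Moebius_function_of_zero Moebius_function_eq_zero)
  have g1: "cmod (g \<xi>) < 1" if "cmod \<xi> < 1" for \<xi>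
    unfolding g_def by (intro Moebius_function_norm_lt_1 f1 w inball that)
  let ?\<xi> = "?M w z"
  have \<xi>: "cmod ?\<xi> < 1" by (rule Moebius_function_norm_lt_1[OF w z])
  have "cmod (g ?\<xi>) \<le> cmod ?\<xi>" by (rule Schwarz_Lemma(1)[OF hol g0 g1 \<xi>])
  also have "g ?\<xi> = ?M (f w) (f z)"
    unfolding g_def using Moebius_function_compose[of "- w" w z] w z by simp
  finally have le: "cmod ((f z - f w) / (1 - cnj (f w) * f z)) \<le> cmod ((z - w) / (1 - cnj w * z))"
    by (simp add: Moebius_function_simple)
  \<comment> \<open>The inequality \<open>A / B \<le> C / D\<close> is equivalent to
    \<open>B * (D - C) \<le> D * (B - A)\<close>, and the Schwarz-Pick identity evaluates both
    differences.\<close>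
  define A B C D where "A = (cmod (f z - f w))\<^sup>2" and "B = (cmod (1 - cnj (f w) * f z))\<^sup>2"
    and "C = (cmod (z - w))\<^sup>2" and "D = (cmod (1 - cnj w * z))\<^sup>2"
  have B: "B > 0" and D: "D > 0"
    using one_minus_cnj_mult_nonzero[OF f1[OF z] f1[OF w]] one_minus_cnj_mult_nonzero[OF z w]
    by (simp_all add: B_def D_def)
  have "A / B \<le> C / D"
    using power_mono[OF le, of 2] by (simp add: norm_divide power_divide A_def B_def C_def D_def)
  then have "A * D \<le> C * B" using B D by (simp add: field_simps)
  moreover have "B - A = (1 - (cmod (f z))\<^sup>2) * (1 - (cmod (f w))\<^sup>2)"
    unfolding A_def B_def by (rule schwarz_pick_identity)
  moreover have "D - C = (1 - (cmod z)\<^sup>2) * (1 - (cmod w)\<^sup>2)"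
    unfolding C_def D_def by (rule schwarz_pick_identity)
  ultimately have "B * ((1 - (cmod z)\<^sup>2) * (1 - (cmod w)\<^sup>2)) \<le> D * ((1 - (cmod (f z))\<^sup>2) * (1 - (cmod (f w))\<^sup>2))"
    by (metis add_le_cancel_left diff_le_eq le_diff_eq mult.commute right_diff_distrib diff_left_mono)
  then show ?thesis by (simp add: B_def D_def mult.commute)
qed

text \<open>On the complex line through \<open>z\<close> and \<open>w\<close> the ball is a disc, and the kernel \<open>1 - \<langle>z, w\<rangle>\<close> of the ball
  is a constant multiple of the kernel of that disc.\<close>

lemma schwarz_pick_ball:
  fixes F :: "complex ^ 'n \<Rightarrow> complex"
  assumes F: "holomorphic_mv F unit_ball" and F1: "\<And>z. norm z < 1 \<Longrightarrow> cmod (F z) < 1"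
    and z: "norm z < 1" and w: "norm w < 1"
  shows "(cmod (1 - F z * cnj (F w)))\<^sup>2 * ((1 - (norm z)\<^sup>2) * (1 - (norm w)\<^sup>2))
    \<le> (cmod (1 - cip z w))\<^sup>2 * ((1 - (cmod (F z))\<^sup>2) * (1 - (cmod (F w))\<^sup>2))"
proof -
  obtain u :: "complex ^ 'n" and k where u: "norm u = 1" and zw: "z - w = k *s u"
  proof (cases "z = w")
    case True
    have "norm (axis undefined 1 :: complex ^ 'n) = 1" by simp
    moreover have "z - w = 0 *s (axis undefined 1 :: complex ^ 'n)" using True by simp
    ultimately show ?thesis using that by blast
  next
    case False
    have "norm (sgn (z - w)) = 1" using False by (simp add: norm_sgn)
    moreover have "z - w = of_real (norm (z - w)) *s sgn (z - w)"
      using False by (simp add: sgn_div_norm flip: scaleR_eq_smult)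
    ultimately show ?thesis using that by blast
  qed
  \<comment> \<open>Since \<open>z - w\<close> is a multiple of \<open>u\<close>, both points have
    the same component \<open>c\<close> orthogonal to \<open>u\<close>. Their complex line meets the
    ball in a disc of radius \<open>\<rho>\<close> around \<open>c\<close>, in which
    \<open>a\<close> and \<open>b\<close> below are the normalised coordinates.\<close>
  define c where "c = w - cip w u *s u"
  define \<rho> where "\<rho> = sqrt (1 - (norm c)\<^sup>2)"
  have cu: "cip c u = 0" and uc: "cip u c = 0"
    unfolding c_def using u cnj_cip[of "w - cip w u *s u" u] by (simp_all add: cip_perp[OF u])
  have wd: "w = cip w u *s u + c" by (simp add: c_def)
  have zd: "z = cip z u *s u + c"
  proof -
    have "z = w + k *s u" using zw by (simp add: algebra_simps)
    moreover from this have "cip z u = cip w u + k" by (simp add: cip_add_left cip_scale_left cip_self u)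
    ultimately show ?thesis by (simp add: c_def algebra_simps vec_eq_iff)
  qed
  have nz: "(norm z)\<^sup>2 = (cmod (cip z u))\<^sup>2 + (norm c)\<^sup>2" and nw: "(norm w)\<^sup>2 = (cmod (cip w u))\<^sup>2 + (norm c)\<^sup>2"
    using norm_orthogonal_decomposition[OF u cu] zd wd by metis+
  have nw1: "(norm w)\<^sup>2 < 1" and nz1: "(norm z)\<^sup>2 < 1" using w z by (simp_all add: abs_square_less_1)
  have c1: "(norm c)\<^sup>2 < 1" using nw nw1 by (smt (verit) zero_le_power2)
  have \<rho>: "\<rho> > 0" and \<rho>2: "\<rho>\<^sup>2 = 1 - (norm c)\<^sup>2" using c1 by (simp_all add: \<rho>_def)
  define f where "f l = F (c + l *s (of_real \<rho> *s u))" for l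
  have inb: "norm (c + l *s (of_real \<rho> *s u)) < 1" if "cmod l < 1" for l
  proof -
    have "(norm ((l * of_real \<rho>) *s u + c))\<^sup>2 = (cmod l)\<^sup>2 * \<rho>\<^sup>2 + (norm c)\<^sup>2"
      by (simp add: norm_orthogonal_decomposition[OF u cu] norm_mult power_mult_distrib)
    also have "\<dots> < 1 * \<rho>\<^sup>2 + (norm c)\<^sup>2"
      using that \<rho> by (intro add_strict_right_mono mult_strict_right_mono) (simp_all add: abs_square_less_1)
    finally show ?thesis by (simp add: \<rho>2 abs_square_less_1 add.commute)
  qed
  have hf: "f holomorphic_on ball 0 1"
    unfolding f_def[abs_def] by (rule holomorphic_mv_line[OF F]) (use inb in auto)
  define a b where "a = cip z u / of_real \<rho>" and "b = cip w u / of_real \<rho>"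
  have fa: "f a = F z" and fb: "f b = F w"
    using zd wd \<rho> by (simp_all add: f_def a_def b_def add.commute)
  have ca: "cip z u = a * of_real \<rho>" and cb: "cip w u = b * of_real \<rho>"
    using \<rho> by (simp_all add: a_def b_def)
  have na: "1 - (cmod a)\<^sup>2 = (1 - (norm z)\<^sup>2) / \<rho>\<^sup>2"
  proof -
    have "(norm z)\<^sup>2 = \<rho>\<^sup>2 * (cmod a)\<^sup>2 + (1 - \<rho>\<^sup>2)"
      using nz \<rho>2 \<rho> by (simp add: ca norm_mult power_mult_distrib mult.commute)
    then have "(1 - (cmod a)\<^sup>2) * \<rho>\<^sup>2 = 1 - (norm z)\<^sup>2" by (simp add: algebra_simps)
    then show ?thesis using \<rho> by (simp add: eq_divide_eq)
  qed
  have nb: "1 - (cmod b)\<^sup>2 = (1 - (norm w)\<^sup>2) / \<rho>\<^sup>2"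
  proof -
    have "(norm w)\<^sup>2 = \<rho>\<^sup>2 * (cmod b)\<^sup>2 + (1 - \<rho>\<^sup>2)"
      using nw \<rho>2 \<rho> by (simp add: cb norm_mult power_mult_distrib mult.commute)
    then have "(1 - (cmod b)\<^sup>2) * \<rho>\<^sup>2 = 1 - (norm w)\<^sup>2" by (simp add: algebra_simps)
    then show ?thesis using \<rho> by (simp add: eq_divide_eq)
  qed
  have "0 < (1 - (norm z)\<^sup>2) / \<rho>\<^sup>2" "0 < (1 - (norm w)\<^sup>2) / \<rho>\<^sup>2" using nz1 nw1 \<rho> by simp_all
  then have "(cmod a)\<^sup>2 < 1" "(cmod b)\<^sup>2 < 1" using na nb by linarith+
  then have a1: "cmod a < 1" and b1: "cmod b < 1" by (simp_all add: abs_square_less_1)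
  have "cip z w = of_real ((norm c)\<^sup>2) + cip z u * cnj (cip w u)"
    by (subst zd, subst wd) (simp add: cip_add_left cip_add_right cip_scale_left cip_scale_right cip_self u cu uc)
  also have "of_real ((norm c)\<^sup>2) = 1 - complex_of_real (\<rho>\<^sup>2)" by (simp add: \<rho>2)
  finally have "1 - cip z w = of_real (\<rho>\<^sup>2) * (1 - a * cnj b)"
    unfolding ca cb by (simp add: algebra_simps power2_eq_square)
  then have ab: "cmod (1 - cip z w) = \<rho>\<^sup>2 * cmod (1 - a * cnj b)"
    by (simp add: norm_mult norm_power)
  have scale: "K\<^sup>2 * (A * ((p / K) * (q / K))) = A * (p * q)" if "K > 0" for K A p q :: real
    using that by (simp add: power2_eq_square)
  have "(cmod (1 - f a * cnj (f b)))\<^sup>2 * ((1 - (cmod a)\<^sup>2) * (1 - (cmod b)\<^sup>2))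
    \<le> (cmod (1 - a * cnj b))\<^sup>2 * ((1 - (cmod (f a))\<^sup>2) * (1 - (cmod (f b))\<^sup>2))"
    by (rule schwarz_pick[OF hf _ a1 b1]) (use inb F1 in \<open>auto simp: f_def\<close>)
  then have "(\<rho>\<^sup>2)\<^sup>2 * ((cmod (1 - F z * cnj (F w)))\<^sup>2 * (((1 - (norm z)\<^sup>2) / \<rho>\<^sup>2) * ((1 - (norm w)\<^sup>2) / \<rho>\<^sup>2)))
    \<le> (\<rho>\<^sup>2)\<^sup>2 * ((cmod (1 - a * cnj b))\<^sup>2 * ((1 - (cmod (F z))\<^sup>2) * (1 - (cmod (F w))\<^sup>2)))"
    unfolding fa fb na nb by (rule mult_left_mono) simp
  also have "\<dots> = (cmod (1 - cip z w))\<^sup>2 * ((1 - (cmod (F z))\<^sup>2) * (1 - (cmod (F w))\<^sup>2))"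
    unfolding ab by (simp only: power_mult_distrib mult.assoc)
  finally show ?thesis by (subst (asm) scale) (use \<rho> in auto)
qed

lemma holomorphic_mv_cip:
  fixes \<phi> :: "complex ^ 'm \<Rightarrow> complex ^ 'n"
  assumes "\<And>i. holomorphic_mv (\<lambda>z. \<phi> z $ i) S"
  shows "holomorphic_mv (\<lambda>z. cip (\<phi> z) v) S"
  unfolding holomorphic_mv_def
proof
  fix z assume z: "z \<in> S"
  have "\<exists>D. ((\<lambda>z. \<phi> z $ i) has_derivative D) (at z) \<and> (\<forall>a v. D (a *s v) = a * D v)" for i
    using assms[of i] z by (auto simp: holomorphic_mv_def)
  then obtain D where D: "\<And>i. ((\<lambda>z. \<phi> z $ i) has_derivative D i) (at z)" "\<And>i a v. D i (a *s v) = a * D i v"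
    by metis
  have "((\<lambda>z. cip (\<phi> z) v) has_derivative (\<lambda>h. \<Sum>i\<in>UNIV. D i h * cnj (v $ i))) (at z)"
    unfolding cip_def by (intro has_derivative_sum has_derivative_mult_left D(1))
  moreover have "(\<Sum>i\<in>UNIV. D i (a *s h) * cnj (v $ i)) = a * (\<Sum>i\<in>UNIV. D i h * cnj (v $ i))" for a h
    by (simp add: D(2) sum_distrib_left mult.assoc)
  ultimately show "\<exists>D. ((\<lambda>z. cip (\<phi> z) v) has_derivative D) (at z) \<and> (\<forall>a v. D (a *s v) = a * D v)"
    by blast
qed

section \<open>Julia's inequality in the ball\<close>

text \<open>Schwarz-Pick for \<open>z\<close> and \<open>x k\<close> is applied to
  \<open>cip (\<phi> y) (a k)\<close> divided by \<open>|a k|\<close>, where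
  \<open>a k = \<phi> (x k)\<close>. This scalar function takes the value \<open>|a k|\<close> at
  \<open>x k\<close>, so it captures the full distance of \<open>\<phi> (x k)\<close> from the
  boundary. After division by \<open>1 - norm (x k)\<close> the limit involves the boundary data
  alone.\<close>

lemma julia_inequality:
  fixes \<phi> :: "complex ^ 'n \<Rightarrow> complex ^ 'n"
  assumes \<phi>: "analytic_self_map \<phi>" and xb: "\<And>k. norm (x k) < 1" and x: "x \<longlonglongrightarrow> \<zeta>" and \<zeta>: "norm \<zeta> = 1"
    and \<eta>: "(\<lambda>k. \<phi> (x k)) \<longlonglongrightarrow> \<eta>"
    and d: "\<And>k. 1 - norm (\<phi> (x k)) \<le> \<delta> k * (1 - norm (x k))" "\<delta> \<longlonglongrightarrow> d"
  shows "norm \<eta> = 1"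
    and "norm z < 1 \<Longrightarrow> (cmod (1 - cip (\<phi> z) \<eta>))\<^sup>2 * (1 - (norm z)\<^sup>2) \<le> d * (cmod (1 - cip z \<zeta>))\<^sup>2 * (1 - (cmod (cip (\<phi> z) \<eta>))\<^sup>2)"
proof -
  have \<phi>b: "norm (\<phi> z) < 1" if "norm z < 1" for z
    using \<phi> that by (force simp: analytic_self_map_def)
  have nx: "(\<lambda>k. norm (x k)) \<longlonglongrightarrow> 1" using tendsto_norm[OF x] \<zeta> by simp
  have n\<eta>: "(\<lambda>k. norm (\<phi> (x k))) \<longlonglongrightarrow> norm \<eta>" by (rule tendsto_norm[OF \<eta>])
  have "(\<lambda>k. \<delta> k * (1 - norm (x k))) \<longlonglongrightarrow> d * (1 - 1)" by (intro tendsto_intros d nx)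
  then have "1 - norm \<eta> \<le> 0"
    by (intro LIMSEQ_le[OF tendsto_diff[OF tendsto_const n\<eta>]]) (use d(1) in auto)
  moreover have "norm \<eta> \<le> 1"
    by (rule LIMSEQ_le_const2[OF n\<eta>]) (use \<phi>b[OF xb] in \<open>auto intro!: exI[of _ 0] less_imp_le\<close>)
  ultimately show \<eta>1: "norm \<eta> = 1" by simp
  show "(cmod (1 - cip (\<phi> z) \<eta>))\<^sup>2 * (1 - (norm z)\<^sup>2) \<le> d * (cmod (1 - cip z \<zeta>))\<^sup>2 * (1 - (cmod (cip (\<phi> z) \<eta>))\<^sup>2)"
    if z: "norm z < 1"
  proof -
    define a where "a k = \<phi> (x k)" for k
    define n where "n k = norm (a k)" for k
    have n1: "n \<longlonglongrightarrow> 1" using n\<eta> \<eta>1 by (simp add: n_def[abs_def] a_def[abs_def])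
    have a: "a \<longlonglongrightarrow> \<eta>" using \<eta> by (simp add: a_def[abs_def])
    have key: "(cmod (1 - cip (\<phi> z) (a k)))\<^sup>2 * (1 - (norm z)\<^sup>2) * (1 + norm (x k))
      \<le> (cmod (1 - cip z (x k)))\<^sup>2 * (1 - (cmod (cip (\<phi> z) (a k)) / n k)\<^sup>2) * \<delta> k * (1 + n k)"
      if nk: "n k > 0" for k
    proof -
      define F where "F y = cip (\<phi> y) ((1 / n k) *\<^sub>R a k)" for y
      have hF: "holomorphic_mv F unit_ball"
        unfolding F_def[abs_def] using \<phi> by (intro holomorphic_mv_cip) (auto simp: analytic_self_map_def)
      have F1: "cmod (F y) < 1" if "norm y < 1" for y
        using cmod_cip_le[of "\<phi> y" "(1 / n k) *\<^sub>R a k"] \<phi>b[OF that] nk by (simp add: F_def n_def)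
      have Fx: "F (x k) = of_real (n k)"
        using nk by (simp add: F_def cip_scaleR_right cip_self flip: a_def)
          (simp add: n_def power2_eq_square)
      have Fz: "F z = cip (\<phi> z) (a k) / of_real (n k)" by (simp add: F_def cip_scaleR_right)
      have xk: "1 - norm (x k) > 0" using xb[of k] by simp
      have nk1: "n k < 1" using \<phi>b[OF xb] by (simp add: n_def a_def)
      have "(cmod (1 - cip (\<phi> z) (a k)))\<^sup>2 * ((1 - (norm z)\<^sup>2) * (1 - (norm (x k))\<^sup>2))
        \<le> (cmod (1 - cip z (x k)))\<^sup>2 * ((1 - (cmod (F z))\<^sup>2) * (1 - (n k)\<^sup>2))"
        using schwarz_pick_ball[OF hF F1 z xb[of k]] nk by (simp add: Fx Fz)
      also have "\<dots> \<le> (cmod (1 - cip z (x k)))\<^sup>2 * ((1 - (cmod (F z))\<^sup>2) * (\<delta> k * (1 - norm (x k)) * (1 + n k)))"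
      proof (intro mult_left_mono)
        have "1 - (n k)\<^sup>2 = (1 - n k) * (1 + n k)" by (simp add: power2_eq_square algebra_simps)
        also have "\<dots> \<le> \<delta> k * (1 - norm (x k)) * (1 + n k)"
          using d(1)[of k] nk by (intro mult_right_mono) (simp_all add: n_def a_def)
        finally show "1 - (n k)\<^sup>2 \<le> \<delta> k * (1 - norm (x k)) * (1 + n k)" .
        show "0 \<le> 1 - (cmod (F z))\<^sup>2" using F1[OF z] by (simp add: abs_square_le_1)
      qed simp
      finally have "(1 - norm (x k)) * ((cmod (1 - cip (\<phi> z) (a k)))\<^sup>2 * (1 - (norm z)\<^sup>2) * (1 + norm (x k)))
        \<le> (1 - norm (x k)) * ((cmod (1 - cip z (x k)))\<^sup>2 * (1 - (cmod (F z))\<^sup>2) * \<delta> k * (1 + n k))"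
        by (simp add: power2_eq_square[of "norm (x k)"] algebra_simps)
      then show ?thesis using xk nk by (simp add: Fz norm_divide)
    qed
    have "(cmod (1 - cip (\<phi> z) \<eta>))\<^sup>2 * (1 - (norm z)\<^sup>2) * (1 + 1)
      \<le> (cmod (1 - cip z \<zeta>))\<^sup>2 * (1 - (cmod (cip (\<phi> z) \<eta>) / 1)\<^sup>2) * d * (1 + 1)"
    proof (rule tendsto_le[OF sequentially_bot])
      show "(\<lambda>k. (cmod (1 - cip z (x k)))\<^sup>2 * (1 - (cmod (cip (\<phi> z) (a k)) / n k)\<^sup>2) * \<delta> k * (1 + n k))
        \<longlonglongrightarrow> (cmod (1 - cip z \<zeta>))\<^sup>2 * (1 - (cmod (cip (\<phi> z) \<eta>) / 1)\<^sup>2) * d * (1 + 1)"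
        by (intro tendsto_intros x a n1 d) simp
      show "(\<lambda>k. (cmod (1 - cip (\<phi> z) (a k)))\<^sup>2 * (1 - (norm z)\<^sup>2) * (1 + norm (x k)))
        \<longlonglongrightarrow> (cmod (1 - cip (\<phi> z) \<eta>))\<^sup>2 * (1 - (norm z)\<^sup>2) * (1 + 1)"
        by (intro tendsto_intros a nx)
      have "\<forall>\<^sub>F k in sequentially. n k > 0" using order_tendstoD(1)[OF n1, of 0] by simp
      then show "\<forall>\<^sub>F k in sequentially. (cmod (1 - cip (\<phi> z) (a k)))\<^sup>2 * (1 - (norm z)\<^sup>2) * (1 + norm (x k))
        \<le> (cmod (1 - cip z (x k)))\<^sup>2 * (1 - (cmod (cip (\<phi> z) (a k)) / n k)\<^sup>2) * \<delta> k * (1 + n k)"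
        by eventually_elim (rule key)
    qed
    then show ?thesis by (simp add: mult_ac)
  qed
qed

section \<open>From radial to nontangential limits\<close>

text \<open>A Harnack type inequality: a Cayley transform centred at \<open>Q 0\<close> turns
  \<open>Q\<close> into a function from the disc to itself that vanishes at 0, and the Schwarz lemma
  gives the estimate.\<close>

lemma positive_real_part_bound:
  assumes Q: "Q holomorphic_on ball 0 1" and Re: "\<And>z. cmod z < 1 \<Longrightarrow> 0 \<le> Re (Q z)" and w: "cmod w < 1"
  shows "cmod (Q w - Q 0) \<le> 2 * cmod w / (1 - cmod w) * Re (Q 0)"
proof -
  have reflection: "(cmod (x + cnj y))\<^sup>2 - (cmod (x - y))\<^sup>2 = 4 * Re x * Re y" for x y
    unfolding cmod_power2 by (simp add: power2_eq_square algebra_simps)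
  \<comment> \<open>The shift by \<open>e\<close> makes the real parts strictly positive, so the
    denominator of the transform never vanishes. Afterwards \<open>e\<close> tends to 0.\<close>
  have bound: "cmod (Q w - Q 0) \<le> 2 * cmod w / (1 - cmod w) * (Re (Q 0) + e)" if e: "e > 0" for e
  proof -
    define c where "c = Q 0 + of_real e"
    define g where "g z = (Q z - Q 0) / (Q z + of_real e + cnj c)" for z
    have den: "cmod (Q z - Q 0) < cmod (Q z + of_real e + cnj c)" if "cmod z < 1" for z
    proof -
      have "(cmod (Q z + of_real e + cnj c))\<^sup>2 - (cmod (Q z - Q 0))\<^sup>2 = 4 * (Re (Q z) + e) * (Re (Q 0) + e)"
        using reflection[of "Q z + of_real e" c] by (simp add: c_def)
      also have "\<dots> > 0" using Re[OF that] Re[of 0] e by simp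
      finally have "(cmod (Q z - Q 0))\<^sup>2 < (cmod (Q z + of_real e + cnj c))\<^sup>2" by simp
      then show ?thesis by (rule power_less_imp_less_base) simp
    qed
    have nz: "Q z + of_real e + cnj c \<noteq> 0" if "cmod z < 1" for z using den[OF that] by auto
    have "g holomorphic_on ball 0 1"
      unfolding g_def[abs_def] by (intro holomorphic_intros Q) (use nz in auto)
    moreover have "g 0 = 0" by (simp add: g_def)
    moreover have "cmod (g z) < 1" if "cmod z < 1" for z
      using den[OF that] nz[OF that] by (simp add: g_def norm_divide divide_less_eq)
    ultimately have "cmod (g w) \<le> cmod w"
      by (rule Schwarz_Lemma(1)[OF _ _ _ w])
    then have "cmod (Q w - Q 0) \<le> cmod w * cmod (Q w + of_real e + cnj c)"
      using nz[OF w] by (simp add: g_def norm_divide divide_le_eq)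
    also have "Q w + of_real e + cnj c = (Q w - Q 0) + of_real (2 * (Re (Q 0) + e))"
      by (simp add: c_def complex_eq_iff)
    also have "cmod w * cmod \<dots> \<le> cmod w * (cmod (Q w - Q 0) + 2 * (Re (Q 0) + e))"
      using Re[of 0] e by (intro mult_left_mono order_trans[OF norm_triangle_ineq]) (auto simp del: of_real_mult of_real_add)
    finally have "cmod (Q w - Q 0) * (1 - cmod w) \<le> 2 * cmod w * (Re (Q 0) + e)"
      by (simp add: algebra_simps)
    then show ?thesis using w by (simp add: field_simps)
  qed
  have "((\<lambda>e. 2 * cmod w / (1 - cmod w) * (Re (Q 0) + e)) \<longlongrightarrow> 2 * cmod w / (1 - cmod w) * (Re (Q 0) + 0)) (at_right 0)"
    by (intro tendsto_intros)
  then show ?thesis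
    using tendsto_lowerbound[of "\<lambda>e. 2 * cmod w / (1 - cmod w) * (Re (Q 0) + e)" _ "at_right 0" "cmod (Q w - Q 0)"] bound
    by (auto simp: eventually_at_right_less eventually_at_filter)
qed

lemma filterlim_radial:
  fixes \<zeta> :: "'a::real_normed_vector"
  assumes \<zeta>: "norm \<zeta> = 1"
  shows "filterlim (\<lambda>r. r *\<^sub>R \<zeta>) (at \<zeta> within ball 0 1) (at_left 1)"
proof -
  have "((\<lambda>r. r *\<^sub>R \<zeta>) \<longlongrightarrow> 1 *\<^sub>R \<zeta>) (at_left (1::real))" by (intro tendsto_intros)
  moreover have "\<forall>\<^sub>F r in at_left (1::real). r *\<^sub>R \<zeta> \<in> ball 0 1 \<and> r *\<^sub>R \<zeta> \<noteq> \<zeta>"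
    using eventually_at_left_real[of 0 "1::real", OF zero_less_one]
  proof eventually_elim
    case (elim r)
    then have "norm (r *\<^sub>R \<zeta>) < 1" using \<zeta> by simp
    then show ?case using \<zeta> by (metis less_irrefl mem_ball_0)
  qed
  ultimately show ?thesis by (simp add: filterlim_at)
qed

lemma Re_cayley:
  assumes "a \<noteq> 1"
  shows "Re ((1 + a) / (1 - a)) = (1 - (cmod a)\<^sup>2) / (cmod (1 - a))\<^sup>2"
proof -
  have "Re ((1 + a) * cnj (1 - a)) = 1 - (cmod a)\<^sup>2"
    unfolding cmod_power2 by (simp add: power2_eq_square algebra_simps)
  then show ?thesis by (simp add: complex_div_cnj[of "1 + a"] Re_divide_of_real)
qed

text \<open>Hypothesis \<open>J\<close> says that \<open>P\<close>, the Cayley transform of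
  \<open>G\<close> minus \<open>1 / d\<close> times that of the identity, has nonnegative real part.
  The radial hypothesis makes \<open>s * P (1 - s)\<close> tend to 0, and the Harnack estimate
  carries this over to the oblique point, which keeps a bounded hyperbolic distance from the radius.
  The behaviour of \<open>G\<close> is then recovered from \<open>P\<close>.\<close>

lemma nontangential_limit:
  fixes G :: "complex \<Rightarrow> complex" and d M :: real
  assumes G: "G holomorphic_on ball 0 1" and G1: "\<And>l. cmod l < 1 \<Longrightarrow> cmod (G l) < 1"
    and d: "d > 0"
    and J: "\<And>l. cmod l < 1 \<Longrightarrow> (cmod (1 - G l))\<^sup>2 * (1 - (cmod l)\<^sup>2) \<le> d * (cmod (1 - l))\<^sup>2 * (1 - (cmod (G l))\<^sup>2)"
    and rad: "((\<lambda>s. (1 - G (of_real (1 - s))) / of_real s) \<longlongrightarrow> of_real d) (at_right 0)"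
  shows "((\<lambda>t. (1 - G (1 - of_real t * (1 + \<i> * of_real M))) / of_real t) \<longlongrightarrow> of_real d * (1 + \<i> * of_real M)) (at_right 0)"
proof -
  define P where "P l = (1 + G l) / (1 - G l) - (1 + l) / (1 - l) / of_real d" for l
  have ne: "1 - G l \<noteq> 0" "1 - l \<noteq> 0" "G l \<noteq> 1" "l \<noteq> 1" if "cmod l < 1" for l using G1[OF that] that by auto
  have RP: "Re (P l) \<ge> 0" if l: "cmod l < 1" for l
  proof -
    have "Re ((1 + l) / (1 - l) / of_real d) = (1 - (cmod l)\<^sup>2) / (cmod (1 - l))\<^sup>2 / d"
      using Re_cayley[OF ne(4)[OF l]] by (simp only: Re_divide_of_real)
    also have "\<dots> \<le> (1 - (cmod (G l))\<^sup>2) / (cmod (1 - G l))\<^sup>2"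
      using J[OF l] ne[OF l] d by (simp add: field_simps)
    also have "\<dots> = Re ((1 + G l) / (1 - G l))"
      using Re_cayley[OF ne(3)[OF l]] by simp
    finally show ?thesis by (simp add: P_def)
  qed
  have hP: "P holomorphic_on ball 0 1"
    unfolding P_def[abs_def] by (intro holomorphic_intros G) (use ne d in auto)
  \<comment> \<open>The discs with centre \<open>1 - s\<close> and radius \<open>s\<close> touch the
    unit circle at 1. With \<open>s = t * k\<close> the oblique point is
    \<open>(1 - s) + s * u\<close>, where \<open>u\<close> lies in the open unit disc and is the
    same for all \<open>t\<close>; the Harnack constant is therefore uniform.\<close>
  define k where "k = 1 + M\<^sup>2"
  have k: "k \<ge> 1" by (simp add: k_def)
  define u where "u = - (\<i> * of_real M) / (1 - \<i> * of_real M)"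
  have u1: "cmod u < 1"
  proof -
    have "(cmod (1 - \<i> * of_real M))\<^sup>2 = 1 + M\<^sup>2" by (simp add: cmod_power2)
    then have "(cmod (\<i> * of_real M))\<^sup>2 < (cmod (1 - \<i> * of_real M))\<^sup>2"
      by (simp add: norm_mult)
    then have "cmod (\<i> * of_real M) < cmod (1 - \<i> * of_real M)"
      by (rule power_less_imp_less_base) simp
    moreover from this have "0 < cmod (1 - \<i> * of_real M)" using norm_ge_zero le_less_trans by blast
    ultimately show ?thesis unfolding u_def norm_divide norm_minus_cancel by (simp add: divide_less_eq)
  qed
  define C where "C = 2 * cmod u / (1 - cmod u)"
  have C0: "C \<ge> 0" using u1 by (simp add: C_def)
  have ku: "of_real k * u = of_real (M\<^sup>2) - \<i> * of_real M"
  proof -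
    have nz: "1 - \<i> * of_real M \<noteq> 0" by (simp add: complex_eq_iff)
    have "of_real k = (1 - \<i> * of_real M) * (1 + \<i> * of_real M)"
      by (simp add: k_def complex_eq_iff power2_eq_square)
    then have "of_real k * u = - (1 + \<i> * of_real M) * (\<i> * of_real M)"
      using nz by (simp add: u_def) (simp add: algebra_simps)
    then show ?thesis by (simp add: complex_eq_iff power2_eq_square)
  qed
  define lam where "lam t = 1 - of_real t * (1 + \<i> * of_real M)" for t
  have lamk: "lam t = of_real (1 - t * k) + of_real (t * k) * u" for t
  proof -
    have "of_real (t * k) * u = of_real t * (of_real (M\<^sup>2) - \<i> * of_real M)"
      using ku by (simp add: mult.assoc)
    then show ?thesis by (simp add: lam_def k_def algebra_simps)
  qed
  have disc: "cmod (of_real (1 - s) + of_real s * v) < 1" if "0 < s" "s \<le> 1" "cmod v < 1" for s v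
  proof -
    have "cmod (of_real (1 - s) + of_real s * v) \<le> (1 - s) + s * cmod v"
      using that by (intro order_trans[OF norm_triangle_ineq]) (simp add: norm_mult del: of_real_diff)
    also have "\<dots> < (1 - s) + s * 1" using that by simp
    finally show ?thesis by simp
  qed
  have bound: "cmod (of_real t * P (lam t)) \<le> (C + 1) * cmod (of_real (t * k) * P (of_real (1 - t * k)))"
    if t: "0 < t" "t * k \<le> 1" for t
  proof -
    define s where "s = t * k"
    have s: "0 < s" "s \<le> 1" "t \<le> s" using t k by (simp_all add: s_def)
    have "(\<lambda>v. P (of_real (1 - s) + of_real s * v)) holomorphic_on ball 0 1"
    proof (rule holomorphic_on_compose_gen[OF _ hP, unfolded o_def])
      show "(\<lambda>v. of_real (1 - s) + of_real s * v) holomorphic_on ball 0 1"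
        by (intro holomorphic_intros)
    qed (use disc s in auto)
    from positive_real_part_bound[OF this _ u1] disc[OF s(1,2)] RP
    have "cmod (P (lam t) - P (of_real (1 - s))) \<le> C * Re (P (of_real (1 - s)))"
      by (simp add: lamk C_def flip: s_def)
    also have "\<dots> \<le> C * cmod (P (of_real (1 - s)))"
      using C0 by (intro mult_left_mono complex_Re_le_cmod)
    finally have "cmod (P (lam t)) \<le> (C + 1) * cmod (P (of_real (1 - s)))"
      using norm_triangle_ineq2[of "P (lam t)" "P (of_real (1 - s))"] by (simp add: algebra_simps)
    then have "t * cmod (P (lam t)) \<le> s * ((C + 1) * cmod (P (of_real (1 - s))))"
      using s t C0 by (intro mult_mono) auto
    then show ?thesis using s t unfolding s_def[symmetric] norm_mult
      by (simp add: mult.left_commute del: of_real_diff)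
  qed
  have ev1: "\<forall>\<^sub>F s in at_right (0::real). 0 < s \<and> s < 1"
    using eventually_at_right_real[of 0 "1::real"] by (auto elim: eventually_mono)
  have r1: "((\<lambda>s. of_real s / (1 - G (of_real (1 - s)))) \<longlongrightarrow> 1 / of_real d) (at_right 0)"
    using tendsto_inverse[OF rad] d by (simp add: inverse_eq_divide)
  have of0: "((\<lambda>s. complex_of_real s) \<longlongrightarrow> of_real 0) (at_right 0)"
    by (intro tendsto_of_real tendsto_ident_at)
  have g1: "((\<lambda>s. 1 + (1 - (1 - G (of_real (1 - s))) / of_real s * of_real s)) \<longlongrightarrow> 1 + (1 - of_real d * of_real 0)) (at_right 0)"
    by (intro tendsto_intros rad of0)
  \<comment> \<open>Near 1 on the radius both parts of \<open>P\<close> grow like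
    \<open>2 / (d * s)\<close>, so their leading terms cancel.\<close>
  have Prad: "((\<lambda>s. of_real s * P (of_real (1 - s))) \<longlongrightarrow> 0) (at_right 0)"
  proof (rule Lim_transform_eventually)
    have "((\<lambda>s. of_real s / (1 - G (of_real (1 - s))) * (1 + (1 - (1 - G (of_real (1 - s))) / of_real s * of_real s))
        - (2 - of_real s) / of_real d) \<longlongrightarrow> 1 / of_real d * (1 + (1 - of_real d * of_real 0)) - (2 - of_real 0) / of_real d) (at_right 0)"
      by (intro tendsto_diff tendsto_mult tendsto_divide r1 g1 of0 tendsto_const) (use d in auto)
    then show "((\<lambda>s. of_real s / (1 - G (of_real (1 - s))) * (1 + (1 - (1 - G (of_real (1 - s))) / of_real s * of_real s))
        - (2 - of_real s) / of_real d) \<longlongrightarrow> 0) (at_right 0)"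
      by simp
    show "\<forall>\<^sub>F s in at_right 0. of_real s / (1 - G (of_real (1 - s))) * (1 + (1 - (1 - G (of_real (1 - s))) / of_real s * of_real s))
        - (2 - of_real s) / of_real d = of_real s * P (of_real (1 - s))"
      using ev1
    proof eventually_elim
      case (elim s)
      have "1 + (1 - (1 - G (of_real (1 - s))) / of_real s * of_real s) = 1 + G (of_real (1 - s))" using elim by simp
      moreover have "of_real s * ((1 + complex_of_real (1 - s)) / (1 - of_real (1 - s)) / of_real d) = (2 - of_real s) / of_real d"
        using elim by simp
      ultimately show ?case unfolding P_def right_diff_distrib by (simp only: times_divide_eq_left times_divide_eq_right)
    qed
  qed
  have fk: "filterlim (\<lambda>t. t * k) (at_right 0) (at_right 0)"
  proof -
    have "((\<lambda>t. t * k) \<longlongrightarrow> 0 * k) (at_right 0)" by (intro tendsto_intros)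
    then show ?thesis using k ev1 by (auto simp: filterlim_at elim!: eventually_mono)
  qed
  have tP: "((\<lambda>t. of_real t * P (lam t)) \<longlongrightarrow> 0) (at_right 0)"
  proof (rule Lim_null_comparison)
    have "((\<lambda>t. (C + 1) * cmod (of_real (t * k) * P (of_real (1 - t * k)))) \<longlongrightarrow> (C + 1) * cmod 0) (at_right 0)"
      by (intro tendsto_intros filterlim_compose[OF Prad fk])
    then show "((\<lambda>t. (C + 1) * cmod (of_real (t * k) * P (of_real (1 - t * k)))) \<longlongrightarrow> 0) (at_right 0)" by simp
    have "\<forall>\<^sub>F t in at_right 0. 0 < t * k \<and> t * k < 1"
      using eventually_compose_filterlim[OF ev1 fk] .
    then show "\<forall>\<^sub>F t in at_right 0. cmod (of_real t * P (lam t)) \<le> (C + 1) * cmod (of_real (t * k) * P (of_real (1 - t * k)))"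
    proof eventually_elim
      case (elim t)
      then have "0 < t" using k by (simp add: zero_less_mult_iff)
      then show ?case using elim by (intro bound) auto
    qed
  qed
  define w where "w = 1 + \<i> * complex_of_real M"
  have w: "w \<noteq> 0" by (simp add: w_def complex_eq_iff)
  have lim: "((\<lambda>t. (of_real t * P (lam t) + (2 - of_real t * w) / (w * of_real d) + of_real t) / 2) \<longlongrightarrow> (0 + (2 - of_real 0 * w) / (w * of_real d) + of_real 0) / 2) (at_right 0)"
    by (intro tendsto_intros tP of0) (use w d in auto)
  \<comment> \<open>The Cayley transform is inverted: \<open>1 / (1 - G)\<close> is half of
    \<open>(1 + G) / (1 - G) + 1\<close>.\<close>
  have "((\<lambda>t. of_real t / (1 - G (lam t))) \<longlongrightarrow> 1 / (w * of_real d)) (at_right 0)"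
  proof (rule Lim_transform_eventually)
    show "((\<lambda>t. (of_real t * P (lam t) + (2 - of_real t * w) / (w * of_real d) + of_real t) / 2) \<longlongrightarrow> 1 / (w * of_real d)) (at_right 0)"
      using lim by simp
    have "\<forall>\<^sub>F t in at_right 0. 0 < t * k \<and> t * k < 1"
      using eventually_compose_filterlim[OF ev1 fk] .
    then show "\<forall>\<^sub>F t in at_right 0. (of_real t * P (lam t) + (2 - of_real t * w) / (w * of_real d) + of_real t) / 2 = of_real t / (1 - G (lam t))"
    proof eventually_elim
      case (elim t)
      have t: "t \<noteq> 0" using elim by auto
      have "cmod (lam t) < 1" unfolding lamk using disc[of "t * k" u] u1 elim by simp
      from ne(1)[OF this] have n1: "1 - G (lam t) \<noteq> 0" .
      define A B where "A = of_real t * ((1 + G (lam t)) / (1 - G (lam t)))"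
        and "B = of_real t * ((1 + lam t) / (1 - lam t) / of_real d)"
      have "B = (2 - of_real t * w) / (w * of_real d)"
        using t w d by (simp add: B_def lam_def w_def[symmetric] field_simps)
      moreover have "A + of_real t = 2 * (of_real t / (1 - G (lam t)))"
        using n1 by (simp add: A_def field_simps)
      moreover have "of_real t * P (lam t) = A - B"
        by (simp only: P_def right_diff_distrib A_def B_def)
      ultimately have "of_real t * P (lam t) + (2 - of_real t * w) / (w * of_real d) + of_real t = 2 * (of_real t / (1 - G (lam t)))"
        by (metis diff_add_cancel)
      then show ?case by (metis nonzero_mult_div_cancel_left zero_neq_numeral)
    qed
  qed
  from tendsto_inverse[OF this] w d
  show ?thesis by (simp add: lam_def w_def mult.commute)
qed

text \<open>Points realising the lower limit provide a candidate \<open>\<eta>\<close> by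
  compactness. Julia's inequality for this \<open>\<eta>\<close> forces convergence along the
  radius, which identifies it with the radial limit. On the radius the quotient
  \<open>(1 - G r) / (1 - r)\<close> has modulus at most \<open>2 * d / (1 + r)\<close> by Julia and
  real part almost at least \<open>d\<close> by definition of the lower limit; together these pin it
  to \<open>d\<close>.\<close>

theorem julia_caratheodory:
  fixes \<phi> :: "complex ^ 'n \<Rightarrow> complex ^ 'n"
  assumes \<phi>: "analytic_self_map \<phi>" and \<zeta>: "norm \<zeta> = 1" and fin: "ang_dilation \<phi> \<zeta> < \<infinity>"
  obtains d where "ang_dilation \<phi> \<zeta> = ereal d" "d > 0" "norm (radial_lim \<phi> \<zeta>) = 1"
    "\<And>M. ((\<lambda>t. (1 - cip (\<phi> ((1 - of_real t * (1 + \<i> * of_real M)) *s \<zeta>)) (radial_lim \<phi> \<zeta>)) / of_real t)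
      \<longlongrightarrow> of_real d * (1 + \<i> * of_real M)) (at_right 0)"
proof -
  define ratio where "ratio z = (1 - norm (\<phi> z)) / (1 - norm z)" for z
  define L where "L = ang_dilation \<phi> \<zeta>"
  have L: "L = Liminf (at \<zeta> within ball 0 1) (\<lambda>z. ereal (ratio z))"
    by (simp add: L_def ang_dilation_def ratio_def)
  have \<phi>b: "norm (\<phi> z) < 1" if "norm z < 1" for z
    using \<phi> that by (force simp: analytic_self_map_def)
  have ntriv: "at \<zeta> within ball 0 1 \<noteq> bot"
  proof
    assume "at \<zeta> within ball 0 1 = bot"
    then have "filterlim (\<lambda>r. r *\<^sub>R \<zeta>) bot (at_left (1::real))" using filterlim_radial[OF \<zeta>] by simp
    then show False by (simp add: filterlim_def bot_unique filtermap_bot_iff)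
  qed
  have inb: "\<forall>\<^sub>F z in at \<zeta> within ball 0 1. norm z < 1"
    by (simp add: eventually_at_filter)
  have "0 \<le> L"
    unfolding L
  proof (rule Liminf_bounded)
    show "\<forall>\<^sub>F z in at \<zeta> within ball 0 1. 0 \<le> ereal (ratio z)"
      using inb by eventually_elim (use \<phi>b in \<open>auto simp: ratio_def intro!: divide_nonneg_nonneg less_imp_le\<close>)
  qed
  then obtain d where d: "L = ereal d" "d \<ge> 0" using fin by (cases L) (auto simp: L_def)
  have "\<exists>x. norm x < 1 \<and> dist x \<zeta> < 1 / (real k + 1) \<and> ratio x < d + 1 / (real k + 1)" for k
  proof (rule ccontr)
    define e where "e = 1 / (real k + 1)"
    have e: "e > 0" by (simp add: e_def)
    assume "\<not> ?thesis"
    then have ge: "ratio x \<ge> d + e" if "norm x < 1" "dist x \<zeta> < e" for x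
      using that by (force simp: e_def)
    have "ereal (d + e) \<le> L"
      unfolding L
    proof (rule Liminf_bounded)
      show "\<forall>\<^sub>F z in at \<zeta> within ball 0 1. ereal (d + e) \<le> ereal (ratio z)"
        unfolding eventually_at using e ge by (intro exI[of _ e]) auto
    qed
    then show False using d e by simp
  qed
  then obtain x where x: "\<And>k. norm (x k) < 1" "\<And>k. dist (x k) \<zeta> < 1 / (real k + 1)" "\<And>k. ratio (x k) < d + 1 / (real k + 1)"
    by metis
  have lim0: "(\<lambda>k. 1 / (real k + 1)) \<longlonglongrightarrow> 0"
    using LIMSEQ_inverse_real_of_nat by (simp add: inverse_eq_divide add.commute)
  have xlim: "x \<longlonglongrightarrow> \<zeta>"
  proof (rule iffD2[OF tendsto_dist_iff], rule Lim_null_comparison[OF _ lim0], intro always_eventually allI)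
    fix k show "norm (dist (x k) \<zeta>) \<le> 1 / (real k + 1)"
      using x(2)[of k] by simp
  qed
  have "\<phi> (x k) \<in> cball 0 1" for k using \<phi>b[OF x(1)[of k]] by simp
  then obtain \<eta> s where s: "strict_mono (s :: nat \<Rightarrow> nat)" "((\<lambda>k. \<phi> (x k)) \<circ> s) \<longlonglongrightarrow> \<eta>"
    using seq_compactE[OF compact_imp_seq_compact[OF compact_cball[of 0 1]], of "\<lambda>k. \<phi> (x k)"] by blast
  define \<delta> where "\<delta> k = d + 1 / (real (s k) + 1)" for k
  have \<delta>: "\<delta> \<longlonglongrightarrow> d"
    using tendsto_add[OF tendsto_const[of d] LIMSEQ_subseq_LIMSEQ[OF lim0 s(1)]] by (simp add: \<delta>_def[abs_def] o_def)
  have r\<delta>: "1 - norm (\<phi> (x (s k))) \<le> \<delta> k * (1 - norm (x (s k)))" for k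
    using x(3)[of "s k"] x(1)[of "s k"] by (simp add: ratio_def \<delta>_def divide_less_eq less_imp_le)
  note ji = julia_inequality[OF \<phi>, of "x \<circ> s" \<zeta> \<eta> \<delta> d, unfolded o_def, OF x(1)
      LIMSEQ_subseq_LIMSEQ[OF xlim s(1), unfolded o_def] \<zeta> s(2)[unfolded o_def] r\<delta> \<delta>]
  have \<eta>: "norm \<eta> = 1" by (rule ji(1))
  define G where "G l = cip (\<phi> (l *s \<zeta>)) \<eta>" for l
  have G1: "cmod (G l) < 1" if "cmod l < 1" for l
    using cmod_cip_le[of "\<phi> (l *s \<zeta>)" \<eta>] \<phi>b[of "l *s \<zeta>"] that \<zeta> \<eta> by (simp add: G_def norm_smult)
  have J: "(cmod (1 - G l))\<^sup>2 * (1 - (cmod l)\<^sup>2) \<le> d * (cmod (1 - l))\<^sup>2 * (1 - (cmod (G l))\<^sup>2)" if "cmod l < 1" for l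
    using ji(2)[of "l *s \<zeta>"] that \<zeta> by (simp add: G_def norm_smult cip_scale_left cip_self)
  \<comment> \<open>If \<open>d\<close> were 0, Julia's inequality at the origin would give
    \<open>G 0 = 1\<close>, although \<open>G\<close> maps into the open disc.\<close>
  have d0: "d > 0"
  proof (rule ccontr)
    assume "\<not> d > 0"
    then have "(cmod (1 - G 0))\<^sup>2 \<le> 0" using J[of 0] d(2) by simp
    then have "cmod (G 0) = 1" by (simp add: eq_commute[of 1])
    then show False using G1[of 0] by simp
  qed
  have "holomorphic_mv (\<lambda>z. cip (\<phi> z) \<eta>) (ball 0 1)"
    using \<phi> by (intro holomorphic_mv_cip) (auto simp: analytic_self_map_def)
  from holomorphic_mv_line[OF this, of "ball 0 1" 0 \<zeta>] \<zeta>
  have hG: "G holomorphic_on ball 0 1" by (simp add: G_def[abs_def] norm_smult)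
  \<comment> \<open>Julia's inequality at \<open>l = r\<close> contains \<open>1 - g^2\<close>,
    which is at most \<open>2 * m\<close> because \<open>1 - g \<le> m\<close>. One factor
    \<open>m\<close> and one factor \<open>1 - r\<close> then cancel.\<close>
  have H_le: "cmod (1 - G (of_real r)) \<le> 2 * d * (1 - r) / (1 + r)" if r: "0 < r" "r < 1" for r
  proof -
    define m where "m = cmod (1 - G (of_real r))"
    define g where "g = cmod (G (of_real r))"
    have g: "0 \<le> g" "g < 1" using G1[of "of_real r"] r by (simp_all add: g_def)
    have mg: "1 - g \<le> m" using norm_triangle_ineq2[of 1 "G (of_real r)"] by (simp add: m_def g_def)
    then have m: "m > 0" using g by simp
    have "m\<^sup>2 * (1 - r\<^sup>2) \<le> d * (1 - r)\<^sup>2 * (1 - g\<^sup>2)"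
    proof -
      have "cmod (1 - complex_of_real r) = cmod (of_real (1 - r))" by simp
      then have "cmod (1 - complex_of_real r) = 1 - r" using r by (simp only: norm_of_real)
      then show ?thesis using J[of "of_real r"] r by (simp add: m_def g_def)
    qed
    also have "\<dots> = d * (1 - r)\<^sup>2 * ((1 - g) * (1 + g))" by (simp add: power2_eq_square algebra_simps)
    also have "\<dots> \<le> d * (1 - r)\<^sup>2 * (m * 2)"
      using mg g m d0 by (intro mult_left_mono mult_mono) auto
    finally have "((1 - r) * m) * (m * (1 + r)) \<le> ((1 - r) * m) * (2 * d * (1 - r))"
      by (simp add: power2_eq_square algebra_simps)
    then have "m * (1 + r) \<le> 2 * d * (1 - r)" using m r by simp
    then show ?thesis using r by (simp add: m_def pos_le_divide_eq)
  qed
  have ev1: "\<forall>\<^sub>F r in at_left (1::real). 0 < r \<and> r < 1"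
    using eventually_at_left_real[of 0 "1::real"] by (auto elim: eventually_mono)
  have up: "((\<lambda>r. 2 * d * (1 - r) / (1 + r)) \<longlongrightarrow> 2 * d * (1 - 1) / (1 + 1)) (at_left 1)"
    by (intro tendsto_intros) auto
  have "((\<lambda>r. (norm (\<phi> (r *\<^sub>R \<zeta>) - \<eta>))\<^sup>2) \<longlongrightarrow> 0) (at_left 1)"
  proof (rule tendsto_sandwich[OF _ _ tendsto_const])
    show "((\<lambda>r. 2 * (2 * d * (1 - r) / (1 + r))) \<longlongrightarrow> 0) (at_left 1)"
      using tendsto_mult[OF tendsto_const[of 2] up] by simp
    show "\<forall>\<^sub>F r in at_left 1. (norm (\<phi> (r *\<^sub>R \<zeta>) - \<eta>))\<^sup>2 \<le> 2 * (2 * d * (1 - r) / (1 + r))"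
      using ev1
    proof eventually_elim
      case (elim r)
      have "(norm (\<phi> (r *\<^sub>R \<zeta>) - \<eta>))\<^sup>2 \<le> 2 * (1 - Re (cip (\<phi> (r *\<^sub>R \<zeta>)) \<eta>))"
        using elim \<zeta> \<eta> by (intro norm_diff_unit_sq_le) (auto intro!: less_imp_le[OF \<phi>b])
      also have "1 - Re (cip (\<phi> (r *\<^sub>R \<zeta>)) \<eta>) \<le> cmod (1 - G (of_real r))"
        using complex_Re_le_cmod[of "1 - G (of_real r)"] by (simp add: G_def scaleR_eq_smult)
      finally show ?case using H_le[of r] elim by simp
    qed
  qed simp
  from tendsto_real_sqrt[OF this] have "((\<lambda>r. \<phi> (r *\<^sub>R \<zeta>)) \<longlongrightarrow> \<eta>) (at_left 1)"
    by (subst tendsto_dist_iff) (simp add: dist_norm)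
  then have rl: "radial_lim \<phi> \<zeta> = \<eta>"
    unfolding radial_lim_def by (intro tendsto_Lim) auto
  have rad: "((\<lambda>r. (1 - G (of_real r)) / of_real (1 - r)) \<longlongrightarrow> of_real d) (at_left 1)"
  proof (rule tendstoI)
    fix e :: real assume e: "e > 0"
    \<comment> \<open>Chosen so that the defect in the real part costs
      \<open>2 * d * \<epsilon> = e^2 / 2\<close> in the expansion of \<open>|H - d|^2\<close>; the
      other half comes from the upper bound for \<open>|H|\<close>.\<close>
    define \<epsilon> where "\<epsilon> = e\<^sup>2 / (4 * d)"
    have \<epsilon>: "\<epsilon> > 0" "2 * d * \<epsilon> = e\<^sup>2 / 2" using e d0 by (simp_all add: \<epsilon>_def)
    have "ereal (d - \<epsilon>) < L" using d \<epsilon> by simp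
    then have "\<forall>\<^sub>F z in at \<zeta> within ball 0 1. ereal (d - \<epsilon>) < ereal (ratio z)"
      unfolding L by (rule less_LiminfD)
    then have low: "\<forall>\<^sub>F r in at_left 1. d - \<epsilon> < ratio (r *\<^sub>R \<zeta>)"
      using eventually_compose_filterlim[OF _ filterlim_radial[OF \<zeta>], of "\<lambda>z. d - \<epsilon> < ratio z"] by simp
    have "((\<lambda>r. (2 * d / (1 + r))\<^sup>2 - d\<^sup>2) \<longlongrightarrow> (2 * d / (1 + 1))\<^sup>2 - d\<^sup>2) (at_left 1)"
      by (intro tendsto_intros) auto
    then have "\<forall>\<^sub>F r in at_left 1. (2 * d / (1 + r))\<^sup>2 - d\<^sup>2 < e\<^sup>2 / 2"
      using e by (intro order_tendstoD(2)) auto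
    then show "\<forall>\<^sub>F r in at_left 1. dist ((1 - G (of_real r)) / of_real (1 - r)) (of_real d) < e"
      using low ev1
    proof eventually_elim
      case (elim r)
      define H where "H = (1 - G (of_real r)) / of_real (1 - r)"
      have "cmod H = cmod (1 - G (of_real r)) / (1 - r)"
        using elim unfolding H_def norm_divide norm_of_real by simp
      also have "\<dots> \<le> 2 * d / (1 + r)"
        using H_le[of r] elim by (simp add: divide_le_eq)
      finally have H: "(cmod H)\<^sup>2 \<le> (2 * d / (1 + r))\<^sup>2" by (rule power_mono) simp
      have "Re H = (1 - Re (G (of_real r))) / (1 - r)"
        unfolding H_def Re_divide_of_real by simp
      also have "\<dots> \<ge> ratio (r *\<^sub>R \<zeta>)"
      proof -
        have "Re (G (of_real r)) \<le> norm (\<phi> (r *\<^sub>R \<zeta>))"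
          using complex_Re_le_cmod[of "G (of_real r)"] cmod_cip_le[of "\<phi> (r *\<^sub>R \<zeta>)" \<eta>] \<eta>
          by (simp add: G_def scaleR_eq_smult)
        then show ?thesis using elim \<zeta> by (simp add: ratio_def divide_right_mono)
      qed
      finally have ReH: "Re H > d - \<epsilon>" using elim by simp
      have "(cmod (H - of_real d))\<^sup>2 = (cmod H)\<^sup>2 - 2 * d * Re H + d\<^sup>2"
        unfolding cmod_power2 by (simp add: power2_eq_square algebra_simps)
      also have "\<dots> < (2 * d / (1 + r))\<^sup>2 - 2 * d * (d - \<epsilon>) + d\<^sup>2"
      proof -
        have "2 * d * (d - \<epsilon>) < 2 * d * Re H"
          by (rule mult_strict_left_mono[OF ReH]) (use d0 in simp)
        then show ?thesis using H by linarith
      qed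
      also have "\<dots> = (2 * d / (1 + r))\<^sup>2 - d\<^sup>2 + e\<^sup>2 / 2"
        using \<epsilon>(2) by (simp add: power2_eq_square right_diff_distrib)
      also have "\<dots> < e\<^sup>2" using elim by simp
      finally have "cmod (H - of_real d) < e" using e by (intro power_less_imp_less_base[of _ 2 e]) auto
      then show ?case by (simp add: H_def dist_norm)
    qed
  qed
  have fl: "filterlim (\<lambda>s. 1 - s) (at_left (1::real)) (at_right 0)"
  proof -
    have "((\<lambda>s. 1 - s) \<longlongrightarrow> 1 - 0) (at_right (0::real))" by (intro tendsto_intros)
    then show ?thesis using eventually_at_right_real[of 0 "1::real"] by (auto simp: filterlim_at elim: eventually_mono)
  qed
  have rad': "((\<lambda>s. (1 - G (of_real (1 - s))) / of_real s) \<longlongrightarrow> of_real d) (at_right 0)"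
    using filterlim_compose[OF rad fl] by simp
  show ?thesis
  proof (rule that)
    show "ang_dilation \<phi> \<zeta> = ereal d" using d by (simp add: L_def)
    show "norm (radial_lim \<phi> \<zeta>) = 1" by (simp add: rl \<eta>)
    show "((\<lambda>t. (1 - cip (\<phi> ((1 - of_real t * (1 + \<i> * of_real M)) *s \<zeta>)) (radial_lim \<phi> \<zeta>)) / of_real t)
      \<longlongrightarrow> of_real d * (1 + \<i> * of_real M)) (at_right 0)" for M
      using nontangential_limit[OF hG G1 d0 J rad'] unfolding rl G_def .
  qed (rule d0)
qed

section \<open>Operators on the spaces\<close>

lemma zero_in_carrier: "(\<lambda>z :: complex ^ 'n. 0) \<in> carrier_of X"
  and fnorm_zero: "fnorm X (\<lambda>z :: complex ^ 'n. 0) = 0"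
proof -
  have "holomorphic_mv (\<lambda>z :: complex ^ 'n. 0) unit_ball"
    unfolding holomorphic_mv_def by (intro ballI exI[of _ "\<lambda>_. 0"]) auto
  moreover have *: "sqnorm X (\<lambda>z :: complex ^ 'n. 0) = 0" by (cases X) simp_all
  ultimately show "(\<lambda>z :: complex ^ 'n. 0) \<in> carrier_of X" by (simp add: carrier_of_def)
  show "fnorm X (\<lambda>z :: complex ^ 'n. 0) = 0" by (simp add: fnorm_def *)
qed

lemma fnorm_nonneg [simp]: "fnorm X f \<ge> 0"
  by (simp add: fnorm_def)

lemma sqnorm_carrier: "f \<in> carrier_of X \<Longrightarrow> sqnorm X f = ennreal ((fnorm X f)\<^sup>2)"
  by (simp add: fnorm_def carrier_of_def)

lemma carrier_of_iff:
  "f \<in> carrier_of X \<longleftrightarrow> holomorphic_mv f unit_ball \<and> (\<forall>z. z \<notin> unit_ball \<longrightarrow> f z = 0) \<and> sqnorm X f < \<infinity>"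
  by (simp add: carrier_of_def)

lemma holomorphic_mv_lincomb:
  assumes "holomorphic_mv f S" "holomorphic_mv g S"
  shows "holomorphic_mv (\<lambda>z. a * f z + b * g z) S"
  unfolding holomorphic_mv_def
proof
  fix z assume "z \<in> S"
  then obtain D E where D: "(f has_derivative D) (at z)" "\<And>a v. D (a *s v) = a * D v"
    and E: "(g has_derivative E) (at z)" "\<And>a v. E (a *s v) = a * E v"
    using assms unfolding holomorphic_mv_def by metis
  have "((\<lambda>z. a * f z + b * g z) has_derivative (\<lambda>h. a * D h + b * E h)) (at z)"
    by (intro has_derivative_add has_derivative_mult_right D E)
  then show "\<exists>D. ((\<lambda>z. a * f z + b * g z) has_derivative D) (at z) \<and> (\<forall>a v. D (a *s v) = a * D v)"
    by (intro exI conjI) (assumption, simp add: D E algebra_simps)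
qed

text \<open>The pointwise inequality \<open>|x + y|^2 \<le> 2 * |x|^2 + 2 * |y|^2\<close> is
  integrated directly. The lost factor is harmless because only membership and boundedness are drawn
  from it.\<close>

lemma lincomb_carrier:
  fixes f g :: "complex ^ 'n \<Rightarrow> complex"
  assumes X: "admissible X" and f: "f \<in> carrier_of X" and g: "g \<in> carrier_of X"
  shows "(\<lambda>z. a * f z + b * g z) \<in> carrier_of X"
    and "(fnorm X (\<lambda>z. a * f z + b * g z))\<^sup>2 \<le> 2 * (cmod a)\<^sup>2 * (fnorm X f)\<^sup>2 + 2 * (cmod b)\<^sup>2 * (fnorm X g)\<^sup>2"
proof -
  have [measurable]: "f \<in> borel_measurable borel" "g \<in> borel_measurable borel"
    using f g by (auto intro: carrier_of_measurable)
  let ?h = "\<lambda>z. a * f z + b * g z"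
  let ?A = "2 * (cmod a)\<^sup>2" and ?B = "2 * (cmod b)\<^sup>2"
  have pw: "(cmod (?h z))\<^sup>2 \<le> ?A * (cmod (f z))\<^sup>2 + ?B * (cmod (g z))\<^sup>2" for z
  proof -
    have "(cmod (?h z))\<^sup>2 \<le> (cmod (a * f z) + cmod (b * g z))\<^sup>2"
      by (intro power_mono norm_triangle_ineq) simp
    also have "\<dots> \<le> 2 * (cmod (a * f z))\<^sup>2 + 2 * (cmod (b * g z))\<^sup>2"
      using sum_squares_bound[of "cmod (a * f z)" "cmod (b * g z)"] by (simp add: power2_sum)
    finally show ?thesis by (simp add: norm_mult power_mult_distrib)
  qed
  have "sqnorm X ?h \<le> ennreal ?A * sqnorm X f + ennreal ?B * sqnorm X g"
  proof -
    have hm: "?h \<in> borel_measurable borel" by measurable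
    have fm: "f \<in> borel_measurable borel" and gm: "g \<in> borel_measurable borel" by measurable
    show ?thesis
      unfolding sqnorm_eq[OF X hm] sqnorm_eq[OF X fm] sqnorm_eq[OF X gm]
    proof (rule SUP_least)
      fix r assume r: "r \<in> radii X"
      have "(\<integral>\<^sup>+z. ennreal ((cmod (?h (r *\<^sub>R z)))\<^sup>2) \<partial>space_measure X)
        \<le> (\<integral>\<^sup>+z. ennreal ?A * ennreal ((cmod (f (r *\<^sub>R z)))\<^sup>2) + ennreal ?B * ennreal ((cmod (g (r *\<^sub>R z)))\<^sup>2) \<partial>space_measure X)"
        using pw by (intro nn_integral_mono) (simp add: ennreal_mult'[symmetric] ennreal_plus[symmetric] ennreal_leI del: ennreal_plus)
      also have "\<dots> = ennreal ?A * (\<integral>\<^sup>+z. ennreal ((cmod (f (r *\<^sub>R z)))\<^sup>2) \<partial>space_measure X)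
        + ennreal ?B * (\<integral>\<^sup>+z. ennreal ((cmod (g (r *\<^sub>R z)))\<^sup>2) \<partial>space_measure X)"
        by (subst nn_integral_add) (simp_all add: nn_integral_cmult measurable_cong_sets[OF sets_space_measure refl])
      also have "\<dots> \<le> ennreal ?A * (SUP r\<in>radii X. \<integral>\<^sup>+z. ennreal ((cmod (f (r *\<^sub>R z)))\<^sup>2) \<partial>space_measure X)
        + ennreal ?B * (SUP r\<in>radii X. \<integral>\<^sup>+z. ennreal ((cmod (g (r *\<^sub>R z)))\<^sup>2) \<partial>space_measure X)"
        by (intro add_mono mult_left_mono SUP_upper r) auto
      finally show "(\<integral>\<^sup>+z. ennreal ((cmod (?h (r *\<^sub>R z)))\<^sup>2) \<partial>space_measure X) \<le> \<dots>" .
    qed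
  qed
  also have "\<dots> = ennreal (?A * (fnorm X f)\<^sup>2 + ?B * (fnorm X g)\<^sup>2)"
    using f g by (simp add: sqnorm_carrier ennreal_mult'[symmetric] ennreal_plus[symmetric] del: ennreal_plus)
  finally have le: "sqnorm X ?h \<le> ennreal (?A * (fnorm X f)\<^sup>2 + ?B * (fnorm X g)\<^sup>2)" .
  show h: "?h \<in> carrier_of X"
    using f g le_less_trans[OF le ennreal_less_top] by (auto simp: carrier_of_iff intro!: holomorphic_mv_lincomb)
  show "(fnorm X ?h)\<^sup>2 \<le> ?A * (fnorm X f)\<^sup>2 + ?B * (fnorm X g)\<^sup>2"
    using le unfolding sqnorm_carrier[OF h] by (subst (asm) ennreal_le_iff) auto
qed

lemma sum_carrier:
  fixes f :: "'i \<Rightarrow> complex ^ 'n \<Rightarrow> complex"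
  assumes X: "admissible X" and "finite I" and f: "\<And>i. i \<in> I \<Longrightarrow> f i \<in> carrier_of X"
  shows "(\<lambda>z. \<Sum>i\<in>I. c i * f i z) \<in> carrier_of X"
  using assms(2) f
proof (induction I rule: finite_induct)
  case empty then show ?case by (simp add: zero_in_carrier)
next
  case (insert i I)
  have "(\<lambda>z. c i * f i z + 1 * (\<Sum>i\<in>I. c i * f i z)) \<in> carrier_of X"
    using insert by (intro lincomb_carrier(1)[OF X]) auto
  then show ?case using insert by simp
qed

lemma fnorm_sum_bounded:
  fixes F :: "'i \<Rightarrow> (complex ^ 'n \<Rightarrow> complex) \<Rightarrow> complex ^ 'n \<Rightarrow> complex"
  assumes X: "admissible X" and "finite I" and f: "\<And>i f. i \<in> I \<Longrightarrow> f \<in> S \<Longrightarrow> F i f \<in> carrier_of X"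
    and b: "\<And>i. i \<in> I \<Longrightarrow> \<exists>B. \<forall>f\<in>S. fnorm X (F i f) \<le> B"
  shows "\<exists>B. \<forall>f\<in>S. fnorm X (\<lambda>z. \<Sum>i\<in>I. c i * F i f z) \<le> B"
  using assms(2) f b
proof (induction I rule: finite_induct)
  case empty then show ?case by (auto simp: fnorm_zero)
next
  case (insert i I)
  obtain B1 where B1: "\<And>f. f \<in> S \<Longrightarrow> fnorm X (F i f) \<le> B1" using insert.prems(2)[of i] by blast
  have "\<exists>B. \<forall>f\<in>S. fnorm X (\<lambda>z. \<Sum>i\<in>I. c i * F i f z) \<le> B"
    using insert by simp
  then obtain B2 where B2: "\<And>f. f \<in> S \<Longrightarrow> fnorm X (\<lambda>z. \<Sum>i\<in>I. c i * F i f z) \<le> B2" by blast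
  have "fnorm X (\<lambda>z. \<Sum>i\<in>insert i I. c i * F i f z) \<le> sqrt (2 * (cmod (c i))\<^sup>2 * B1\<^sup>2 + 2 * (cmod 1)\<^sup>2 * B2\<^sup>2)"
    if fS: "f \<in> S" for f
  proof (rule real_le_rsqrt)
    have "(fnorm X (\<lambda>z. c i * F i f z + 1 * (\<Sum>i\<in>I. c i * F i f z)))\<^sup>2
      \<le> 2 * (cmod (c i))\<^sup>2 * (fnorm X (F i f))\<^sup>2 + 2 * (cmod 1)\<^sup>2 * (fnorm X (\<lambda>z. \<Sum>i\<in>I. c i * F i f z))\<^sup>2"
      using insert fS by (intro lincomb_carrier(2)[OF X] sum_carrier[OF X]) auto
    also have "\<dots> \<le> 2 * (cmod (c i))\<^sup>2 * B1\<^sup>2 + 2 * (cmod 1)\<^sup>2 * B2\<^sup>2"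
      using B1[OF fS] B2[OF fS] by (intro add_mono mult_left_mono power_mono) auto
    finally show "(fnorm X (\<lambda>z. \<Sum>i\<in>insert i I. c i * F i f z))\<^sup>2 \<le> \<dots>" using insert by simp
  qed
  then show ?case by blast
qed

text \<open>Images whose norms exceed every bound have no convergent subsequence. Boundedness
  matters because the real supremum in \<open>op_norm\<close> carries information only for a set
  that is bounded above.\<close>

lemma compact_op_bounded:
  fixes K :: "(complex ^ 'n \<Rightarrow> complex) \<Rightarrow> complex ^ 'n \<Rightarrow> complex"
  assumes X: "admissible X" and K: "compact_op X K"
  shows "\<exists>B. \<forall>f\<in>{f \<in> carrier_of X. fnorm X f \<le> 1}. fnorm X (K f) \<le> B"
proof (rule ccontr)
  assume "\<not> ?thesis"
  then have "\<exists>f. f \<in> carrier_of X \<and> fnorm X f \<le> 1 \<and> fnorm X (K f) > real k" for k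
    by (auto simp: not_le)
  then obtain f where f: "\<And>k. f k \<in> carrier_of X" "\<And>k. fnorm X (f k) \<le> 1" "\<And>k. fnorm X (K (f k)) > real k"
    by metis
  obtain r g where r: "strict_mono (r :: nat \<Rightarrow> nat)" and g: "g \<in> carrier_of X"
    and lim: "(\<lambda>k. fnorm X (\<lambda>z. K (f (r k)) z - g z)) \<longlonglongrightarrow> 0"
    using K f(1,2) unfolding compact_op_def by blast
  have Kc: "K (f k) \<in> carrier_of X" for k
    using K f(1) by (simp add: compact_op_def linear_op_def)
  have dc: "(\<lambda>z. K (f k) z - g z) \<in> carrier_of X" for k
    using lincomb_carrier(1)[OF X Kc g, of 1 k "-1"] by simp
  have "(fnorm X (K (f (r k))))\<^sup>2 \<le> 2 * (fnorm X (\<lambda>z. K (f (r k)) z - g z))\<^sup>2 + 2 * (fnorm X g)\<^sup>2" for k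
    using lincomb_carrier(2)[OF X dc[of "r k"] g, of 1 1] by simp
  moreover have "(real k)\<^sup>2 \<le> (fnorm X (K (f (r k))))\<^sup>2" for k
  proof -
    have "real k \<le> real (r k)" using strict_mono_imp_increasing[OF r] by simp
    also have "\<dots> \<le> fnorm X (K (f (r k)))" using f(3)[of "r k"] by simp
    finally show ?thesis by (rule power_mono) simp
  qed
  ultimately have le: "(real k)\<^sup>2 \<le> 2 * (fnorm X (\<lambda>z. K (f (r k)) z - g z))\<^sup>2 + 2 * (fnorm X g)\<^sup>2" for k
    by (rule order_trans[rotated])
  have "(\<lambda>k. 2 * (fnorm X (\<lambda>z. K (f (r k)) z - g z))\<^sup>2 + 2 * (fnorm X g)\<^sup>2) \<longlonglongrightarrow> 2 * 0\<^sup>2 + 2 * (fnorm X g)\<^sup>2"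
    by (intro tendsto_intros lim)
  then have "Bseq (\<lambda>k. 2 * (fnorm X (\<lambda>z. K (f (r k)) z - g z))\<^sup>2 + 2 * (fnorm X g)\<^sup>2)"
    by (rule convergentI[THEN convergent_imp_Bseq])
  then obtain C where C: "\<And>k. norm (2 * (fnorm X (\<lambda>z. K (f (r k)) z - g z))\<^sup>2 + 2 * (fnorm X g)\<^sup>2) \<le> C"
    by (auto simp: Bseq_def)
  obtain k :: nat where k: "max 1 C < real k" using reals_Archimedean2 by blast
  have "(real k)\<^sup>2 \<le> C" using le[of k] C[of k] by simp
  moreover have "real k * 1 \<le> real k * real k" using k by (intro mult_left_mono) auto
  ultimately show False using k by (simp add: power2_eq_square)
qed

text \<open>Sharp in the scalar, as required for normalising the test functions without
  loss.\<close>

lemma fnorm_scale_le: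
  fixes f :: "complex ^ 'n \<Rightarrow> complex"
  assumes X: "admissible X" and f: "f \<in> carrier_of X"
  shows "fnorm X (\<lambda>z. a * f z) \<le> cmod a * fnorm X f"
proof -
  have fm [measurable]: "f \<in> borel_measurable borel" using f by (rule carrier_of_measurable)
  have am: "(\<lambda>z. a * f z) \<in> borel_measurable borel" by measurable
  have "sqnorm X (\<lambda>z. a * f z) \<le> ennreal ((cmod a)\<^sup>2) * sqnorm X f"
    unfolding sqnorm_eq[OF X am] sqnorm_eq[OF X fm]
  proof (rule SUP_least)
    fix r assume r: "r \<in> radii X"
    have "(\<integral>\<^sup>+z. ennreal ((cmod (a * f (r *\<^sub>R z)))\<^sup>2) \<partial>space_measure X)
      = ennreal ((cmod a)\<^sup>2) * (\<integral>\<^sup>+z. ennreal ((cmod (f (r *\<^sub>R z)))\<^sup>2) \<partial>space_measure X)"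
      by (simp add: norm_mult power_mult_distrib ennreal_mult' nn_integral_cmult measurable_cong_sets[OF sets_space_measure refl])
    also have "\<dots> \<le> ennreal ((cmod a)\<^sup>2) * (SUP r\<in>radii X. \<integral>\<^sup>+z. ennreal ((cmod (f (r *\<^sub>R z)))\<^sup>2) \<partial>space_measure X)"
      by (intro mult_left_mono SUP_upper r) auto
    finally show "(\<integral>\<^sup>+z. ennreal ((cmod (a * f (r *\<^sub>R z)))\<^sup>2) \<partial>space_measure X) \<le> \<dots>" .
  qed
  also have "\<dots> = ennreal ((cmod a * fnorm X f)\<^sup>2)"
    using f by (simp add: sqnorm_carrier ennreal_mult'[symmetric] power_mult_distrib)
  finally have le: "sqnorm X (\<lambda>z. a * f z) \<le> ennreal ((cmod a * fnorm X f)\<^sup>2)" .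
  have c: "(\<lambda>z. a * f z) \<in> carrier_of X" using lincomb_carrier(1)[OF X f f, of a 0] by simp
  have "(fnorm X (\<lambda>z. a * f z))\<^sup>2 \<le> (cmod a * fnorm X f)\<^sup>2"
    using le unfolding sqnorm_carrier[OF c] by (subst (asm) ennreal_le_iff) auto
  then show ?thesis by (rule power2_le_imp_le) simp
qed

text \<open>Keeps the infimum that defines \<open>ess_norm\<close> from being taken over the empty
  set.\<close>

lemma compact_op_zero: "compact_op X (\<lambda>f (z :: complex ^ 'n). 0)"
  unfolding compact_op_def linear_op_def
proof (intro conjI allI impI)
  fix f :: "nat \<Rightarrow> complex ^ 'n \<Rightarrow> complex"
  have "strict_mono (\<lambda>k :: nat. k)" by (simp add: strict_mono_def)
  then show "\<exists>(r :: nat \<Rightarrow> nat) (g :: complex ^ 'n \<Rightarrow> complex). strict_mono r \<and> g \<in> carrier_of X \<and> (\<lambda>k. fnorm X (\<lambda>z. 0 - g z)) \<longlonglongrightarrow> 0"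
    using zero_in_carrier[of X, where 'n='n] fnorm_zero[of X, where 'n='n]
    by (intro exI[of _ "\<lambda>k :: nat. k"] exI[of _ "\<lambda>z :: complex ^ 'n. 0 :: complex"]) simp
qed (simp_all add: zero_in_carrier)

section \<open>Combinations of reproducing kernels\<close>

lemma cmod_powr_real: "cmod (w powr (- of_real \<beta>)) = cmod w powr (- \<beta>)"
  using norm_powr_real_powr'[of "- of_real \<beta>" w] by simp

lemma Re_pos_not_nonpos_Reals: "Re w > 0 \<Longrightarrow> w \<notin> \<real>\<^sub>\<le>\<^sub>0"
  by (auto simp: complex_nonpos_Reals_iff)

text \<open>The combination of the kernels at the points \<open>l i *s \<eta>\<close> for one common
  unit vector \<open>\<eta>\<close>, in the variable \<open>x = cip z \<eta>\<close>.\<close>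

definition kernel_sum :: "real \<Rightarrow> 'i set \<Rightarrow> ('i \<Rightarrow> complex) \<Rightarrow> ('i \<Rightarrow> complex) \<Rightarrow> complex \<Rightarrow> complex"
  where "kernel_sum \<beta> J \<alpha> l x = (\<Sum>i\<in>J. \<alpha> i * (1 - cnj (l i) * x) powr (- of_real \<beta>))"

text \<open>The squared norm of that combination in the space: the pairing of the kernels at
  \<open>l i *s \<eta>\<close> and \<open>l j *s \<eta>\<close> is the value of the former at the
  latter point.\<close>

definition kernel_gram :: "real \<Rightarrow> 'i set \<Rightarrow> ('i \<Rightarrow> complex) \<Rightarrow> ('i \<Rightarrow> complex) \<Rightarrow> complex"
  where "kernel_gram \<beta> J \<alpha> l =
    (\<Sum>i\<in>J. \<Sum>j\<in>J. \<alpha> i * cnj (\<alpha> j) * (1 - cnj (l i) * l j) powr (- of_real \<beta>))"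

lemma Re_one_minus_pos: "cmod x < 1 \<Longrightarrow> Re (1 - x) > 0"
  using complex_Re_le_cmod[of x] by simp

lemma cmod_mult_less_1: "cmod a < 1 \<Longrightarrow> cmod b < 1 \<Longrightarrow> cmod (a * b) < 1"
  using norm_mult_less[of a 1 b 1] by simp

text \<open>Expanding every entry in the kernel series and exchanging the sums turns the Gram form
  into a weighted series of squares. This gives its sign and the comparison with the
  integral.\<close>

lemma kernel_gram_sums:
  assumes l: "\<And>i. i \<in> J \<Longrightarrow> cmod (l i) < 1"
  shows "(\<lambda>k. bcoef \<beta> k * (cmod (\<Sum>i\<in>J. \<alpha> i * cnj (l i) ^ k))\<^sup>2) sums Re (kernel_gram \<beta> J \<alpha> l)"
proof -
  define S where "S k = (\<Sum>i\<in>J. \<alpha> i * cnj (l i) ^ k)" for k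
  have "(\<lambda>k. \<Sum>i\<in>J. \<Sum>j\<in>J. \<alpha> i * cnj (\<alpha> j) * (of_real (bcoef \<beta> k) * (cnj (l i) * l j) ^ k)) sums kernel_gram \<beta> J \<alpha> l"
    unfolding kernel_gram_def
    by (intro sums_sum sums_mult kernel_series cmod_mult_less_1) (auto simp: l)
  moreover have "(\<Sum>i\<in>J. \<Sum>j\<in>J. \<alpha> i * cnj (\<alpha> j) * (of_real (bcoef \<beta> k) * (cnj (l i) * l j) ^ k)) = of_real (bcoef \<beta> k * (cmod (S k))\<^sup>2)" for k
  proof -
    have "of_real (bcoef \<beta> k * (cmod (S k))\<^sup>2) = of_real (bcoef \<beta> k) * (S k * cnj (S k))"
      by (simp only: of_real_mult complex_norm_square)
    also have "S k * cnj (S k) = (\<Sum>i\<in>J. \<Sum>j\<in>J. (\<alpha> i * cnj (l i) ^ k) * cnj (\<alpha> j * cnj (l j) ^ k))"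
      by (simp only: S_def cnj_sum sum_product)
    also have "of_real (bcoef \<beta> k) * \<dots> = (\<Sum>i\<in>J. \<Sum>j\<in>J. \<alpha> i * cnj (\<alpha> j) * (of_real (bcoef \<beta> k) * (cnj (l i) * l j) ^ k))"
      unfolding sum_distrib_left
      by (intro sum.cong refl) (simp add: power_mult_distrib mult_ac)
    finally show ?thesis by simp
  qed
  ultimately show ?thesis unfolding S_def[symmetric] by (simp only:) (drule sums_Re, simp only: Re_complex_of_real)
qed

lemma kernel_gram_nonneg:
  assumes "\<beta> > 0" "\<And>i. i \<in> J \<Longrightarrow> cmod (l i) < 1"
  shows "0 \<le> Re (kernel_gram \<beta> J \<alpha> l)"
proof -
  have "(\<lambda>k. bcoef \<beta> k * (cmod (\<Sum>i\<in>J. \<alpha> i * cnj (l i) ^ k))\<^sup>2) sums Re (kernel_gram \<beta> J \<alpha> l)"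
    by (rule kernel_gram_sums) (rule assms(2))
  then show ?thesis
    by (rule sums_le[OF _ sums_zero, rotated]) (simp add: bcoef_pos[OF assms(1)] less_imp_le)
qed

text \<open>The coefficient of \<open>x ^ k\<close> is \<open>bcoef \<beta> k * S k\<close> and the
  moment contributes \<open>1 / bcoef \<beta> k\<close>, so the terms are those of the Gram series
  up to the factor \<open>r ^ (2*k) \<le> 1\<close>.\<close>

lemma kernel_sum_integral_le:
  fixes e :: "complex ^ 'n"
  assumes X: "admissible X" and e: "norm e = 1" and r: "r \<in> radii X"
    and J: "finite J" and l: "\<And>i. i \<in> J \<Longrightarrow> cmod (l i) < 1"
  defines "\<beta> \<equiv> kernel_exponent X CARD('n)"
  shows "(\<integral>\<^sup>+z. ennreal ((cmod (kernel_sum \<beta> J \<alpha> l (of_real r * cip z e)))\<^sup>2) \<partial>space_measure X)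
    \<le> ennreal (Re (kernel_gram \<beta> J \<alpha> l))"
proof -
  have \<beta>: "\<beta> > 0" unfolding \<beta>_def by (rule kernel_exponent_pos[OF X])
  have b: "bcoef \<beta> k > 0" for k using \<beta> by (rule bcoef_pos)
  \<comment> \<open>Cut off outside the disc, since the powers meet their branch cut beyond it while
    the integral formula asks for a Borel function on the whole plane. Almost every argument lies in
    the disc.\<close>
  define G where "G x = indicator (ball 0 1) x *\<^sub>R kernel_sum \<beta> J \<alpha> l x" for x
  define S where "S k = (\<Sum>i\<in>J. \<alpha> i * cnj (l i) ^ k)" for k
  have Gm: "G \<in> borel_measurable borel"
    unfolding G_def[abs_def]
  proof (rule borel_measurable_continuous_on_indicator)
    have cont_term: "continuous_on (ball 0 1) (\<lambda>x. (1 - cnj (l i) * x) powr (- of_real \<beta>))" if i: "i \<in> J" for i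
    proof -
      have re: "Re (1 - cnj (l i) * x) > 0" if "x \<in> ball 0 1" for x
        using that l[OF i] by (intro Re_one_minus_pos cmod_mult_less_1) auto
      show ?thesis
      proof (rule continuous_on_powr_complex)
        show "ball 0 1 \<subseteq> {x. 0 \<le> Re (1 - cnj (l i) * x) \<or> Im (1 - cnj (l i) * x) \<noteq> 0}"
          using less_imp_le[OF re] by blast
        show "0 < Re (- complex_of_real \<beta>)" if "x \<in> ball 0 1" "1 - cnj (l i) * x = 0" for x
          using re[OF that(1)] that(2) by simp
      qed (intro continuous_intros)+
    qed
    show "continuous_on (ball 0 1) (kernel_sum \<beta> J \<alpha> l)"
      unfolding kernel_sum_def[abs_def]
      by (intro continuous_on_sum continuous_on_mult continuous_on_const cont_term)
  qed simp
  have Gs: "(\<lambda>k. of_real (bcoef \<beta> k) * S k * x ^ k) sums G x" if x: "cmod x < 1" for x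
  proof -
    have "(\<lambda>k. \<Sum>i\<in>J. \<alpha> i * (of_real (bcoef \<beta> k) * (cnj (l i) * x) ^ k)) sums kernel_sum \<beta> J \<alpha> l x"
      unfolding kernel_sum_def
      by (intro sums_sum sums_mult kernel_series cmod_mult_less_1) (auto simp: l x)
    moreover have "(\<Sum>i\<in>J. \<alpha> i * (of_real (bcoef \<beta> k) * (cnj (l i) * x) ^ k)) = of_real (bcoef \<beta> k) * S k * x ^ k" for k
      by (simp add: S_def sum_distrib_left sum_distrib_right power_mult_distrib mult_ac)
    ultimately show ?thesis using x by (simp add: G_def)
  qed
  have gram: "(\<lambda>k. bcoef \<beta> k * (cmod (S k))\<^sup>2) sums Re (kernel_gram \<beta> J \<alpha> l)"
    unfolding S_def by (rule kernel_gram_sums[OF l])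
  have "(\<integral>\<^sup>+z. ennreal ((cmod (kernel_sum \<beta> J \<alpha> l (of_real r * cip z e)))\<^sup>2) \<partial>space_measure X)
    = (\<integral>\<^sup>+z. ennreal ((cmod (G (of_real r * cip z e)))\<^sup>2) \<partial>space_measure X)"
  proof (rule nn_integral_cong_AE)
    show "AE z in space_measure X. ennreal ((cmod (kernel_sum \<beta> J \<alpha> l (of_real r * cip z e)))\<^sup>2)
      = ennreal ((cmod (G (of_real r * cip z e)))\<^sup>2)"
      using AE_space_measure[OF r]
    proof eventually_elim
      case (elim z)
      have "cmod (of_real r * cip z e) < 1"
        using elim cmod_cip_le[of "r *\<^sub>R z" e] e by (simp add: cip_scaleR_left)
      then show ?case by (simp add: G_def)
    qed
  qed
  also have "\<dots> = (\<Sum>k. ennreal ((cmod (of_real (bcoef \<beta> k) * S k))\<^sup>2 * r ^ (2*k) / bcoef \<beta> k))"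
    unfolding \<beta>_def by (rule space_integral_powser[OF X e r Gm Gs[unfolded \<beta>_def]])
  also have "\<dots> \<le> (\<Sum>k. ennreal (bcoef \<beta> k * (cmod (S k))\<^sup>2))"
  proof (rule suminf_le)
    show "ennreal ((cmod (of_real (bcoef \<beta> k) * S k))\<^sup>2 * r ^ (2*k) / bcoef \<beta> k) \<le> ennreal (bcoef \<beta> k * (cmod (S k))\<^sup>2)" for k
    proof (rule ennreal_leI)
      have "(cmod (of_real (bcoef \<beta> k) * S k))\<^sup>2 * r ^ (2*k) / bcoef \<beta> k = bcoef \<beta> k * (cmod (S k))\<^sup>2 * r ^ (2*k)"
        using b[of k] by (simp add: norm_mult power_mult_distrib power2_eq_square)
      also have "\<dots> \<le> bcoef \<beta> k * (cmod (S k))\<^sup>2 * 1"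
        using b[of k] radii_bounds[OF r] by (intro mult_left_mono power_le_one) auto
      finally show "(cmod (of_real (bcoef \<beta> k) * S k))\<^sup>2 * r ^ (2*k) / bcoef \<beta> k \<le> bcoef \<beta> k * (cmod (S k))\<^sup>2" by simp
    qed
  qed auto
  also have "\<dots> = ennreal (Re (kernel_gram \<beta> J \<alpha> l))"
    using gram b by (subst suminf_ennreal2) (auto simp: sums_iff less_imp_le)
  finally show ?thesis .
qed

section \<open>Weak interaction between different boundary points\<close>

text \<open>All terms except possibly the one at \<open>e0\<close> are small. The inequality
  \<open>2 * h * R \<le> \<tau> * h^2 + R^2 / \<tau>\<close> puts a factor close to 1 on the large
  term and the big constant on the small ones, which keeps the norm estimate sharp in the limit. The
  index \<open>e0\<close> may lie outside \<open>E\<close>.\<close>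

lemma square_sum_one_dominant:
  fixes g :: "'a \<Rightarrow> real" and C :: real
  assumes E: "finite E" and g: "\<And>e. e \<in> E \<Longrightarrow> 0 \<le> g e" and C: "\<And>e. e \<in> E - {e0} \<Longrightarrow> g e \<le> C" "0 \<le> C" and \<tau>: "0 < \<tau>"
  shows "(\<Sum>e\<in>E. g e)\<^sup>2 \<le> (1 + \<tau>) * (\<Sum>e\<in>E. (g e)\<^sup>2) + (1 + 1 / \<tau>) * (card E * C)\<^sup>2"
proof -
  define h where "h = (if e0 \<in> E then g e0 else 0)"
  define R where "R = (\<Sum>e\<in>E - {e0}. g e)"
  have sum: "(\<Sum>e\<in>E. g e) = h + R"
    using E by (simp add: h_def R_def sum.remove)
  have h: "0 \<le> h" "h\<^sup>2 \<le> (\<Sum>e\<in>E. (g e)\<^sup>2)"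
    using g E by (auto simp: h_def intro!: member_le_sum[of e0 E "\<lambda>e. (g e)\<^sup>2"] sum_nonneg)
  have R0: "0 \<le> R" unfolding R_def using g by (intro sum_nonneg) auto
  have "R \<le> real (card (E - {e0})) * C" unfolding R_def by (rule sum_bounded_above) (use C in auto)
  also have "\<dots> \<le> real (card E) * C" using C E by (intro mult_right_mono) (auto intro: card_mono)
  finally have R: "R\<^sup>2 \<le> (card E * C)\<^sup>2" using R0 by (rule power_mono)
  have "0 \<le> (\<tau> * h - R)\<^sup>2 / \<tau>" using \<tau> by simp
  also have "\<dots> = \<tau> * h\<^sup>2 - 2 * h * R + R\<^sup>2 / \<tau>" using \<tau> by (simp add: power2_eq_square field_simps)
  finally have "(h + R)\<^sup>2 \<le> (1 + \<tau>) * h\<^sup>2 + (1 + 1 / \<tau>) * R\<^sup>2" by (simp add: power2_sum algebra_simps)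
  also have "\<dots> \<le> (1 + \<tau>) * (\<Sum>e\<in>E. (g e)\<^sup>2) + (1 + 1 / \<tau>) * (card E * C)\<^sup>2"
    using h R \<tau> by (intro add_mono mult_left_mono) auto
  finally show ?thesis by (simp add: sum)
qed

text \<open>The factor 8 anticipates a triangle inequality: two distances with squares below
  \<open>2 * \<delta>\<close> add up to one with square below \<open>8 * \<delta>\<close>. The
  element 1 of \<open>D\<close> covers a set \<open>E\<close> with at most one point.\<close>

lemma separation_exists:
  fixes E :: "'a::real_normed_vector set"
  assumes "finite E"
  obtains \<delta> where "0 < \<delta>" "\<And>e e'. e \<in> E \<Longrightarrow> e' \<in> E \<Longrightarrow> e \<noteq> e' \<Longrightarrow> 8 * \<delta> \<le> (norm (e - e'))\<^sup>2"
proof -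
  define D where "D = insert 1 ((\<lambda>p. (norm (fst p - snd p))\<^sup>2 / 8) ` {p \<in> E \<times> E. fst p \<noteq> snd p})"
  have D: "finite D" "D \<noteq> {}" using assms by (auto simp: D_def)
  show ?thesis
  proof
    show "0 < Min D" using D by (subst Min_gr_iff) (auto simp: D_def)
    show "8 * Min D \<le> (norm (e - e'))\<^sup>2" if "e \<in> E" "e' \<in> E" "e \<noteq> e'" for e e'
    proof -
      have "(norm (e - e'))\<^sup>2 / 8 \<in> D"
        unfolding D_def using that by (intro insertI2 image_eqI[of _ _ "(e, e')"]) auto
      then have "Min D \<le> (norm (e - e'))\<^sup>2 / 8" using D by (intro Min_le) auto
      then show ?thesis by simp
    qed
  qed
qed

text \<open>A kernel is large only near its own boundary point, and by separation \<open>z\<close>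
  is near at most one of them. If it is near none, \<open>e0\<close> is arbitrary.\<close>

lemma one_near_boundary_point:
  fixes z :: "complex ^ 'n"
  assumes z: "norm z \<le> 1" and E1: "\<And>e. e \<in> E \<Longrightarrow> norm e = 1"
    and sep: "\<And>e e'. e \<in> E \<Longrightarrow> e' \<in> E \<Longrightarrow> e \<noteq> e' \<Longrightarrow> 8 * \<delta> \<le> (norm (e - e'))\<^sup>2"
  shows "\<exists>e0. \<forall>e\<in>E - {e0}. \<delta> \<le> cmod (1 - cip z e)"
proof (cases "\<exists>e0\<in>E. cmod (1 - cip z e0) < \<delta>")
  case False
  then show ?thesis by (intro exI[of _ undefined]) (auto simp: not_less)
next
  case True
  then obtain e0 where e0: "e0 \<in> E" "cmod (1 - cip z e0) < \<delta>" by blast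
  have near: "(norm (z - e))\<^sup>2 < 2 * \<delta>" if "e \<in> E" "cmod (1 - cip z e) < \<delta>" for e
  proof -
    have "(norm (z - e))\<^sup>2 \<le> 2 * (1 - Re (cip z e))" using z E1[OF that(1)] by (intro norm_diff_unit_sq_le) auto
    also have "1 - Re (cip z e) \<le> cmod (1 - cip z e)" using complex_Re_le_cmod[of "1 - cip z e"] by simp
    finally show ?thesis using that by simp
  qed
  have "\<delta> \<le> cmod (1 - cip z e)" if e: "e \<in> E - {e0}" for e
  proof (rule ccontr)
    assume "\<not> ?thesis"
    then have n: "(norm (z - e))\<^sup>2 < 2 * \<delta>" "(norm (z - e0))\<^sup>2 < 2 * \<delta>" using near e e0 by auto
    have "norm (e - e0) \<le> norm (z - e0) + norm (z - e)"
      using norm_triangle_ineq4[of "z - e0" "z - e"] by simp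
    then have "(norm (e - e0))\<^sup>2 \<le> (norm (z - e0) + norm (z - e))\<^sup>2" by (rule power_mono) simp
    also have "\<dots> \<le> 2 * (norm (z - e0))\<^sup>2 + 2 * (norm (z - e))\<^sup>2"
      using sum_squares_bound[of "norm (z - e0)" "norm (z - e)"] by (simp add: power2_sum)
    also have "\<dots> < 8 * \<delta>" using n by simp
    finally show False using sep[of e e0] e e0 by simp
  qed
  then show ?thesis by blast
qed

lemma holomorphic_mv_compose_cip:
  assumes "\<And>z. z \<in> S \<Longrightarrow> h field_differentiable at (cip z p)"
  shows "holomorphic_mv (\<lambda>z. h (cip z p)) S"
  unfolding holomorphic_mv_def
proof
  fix z assume "z \<in> S"
  then obtain h' where "(h has_field_derivative h') (at (cip z p))"
    using assms field_differentiable_def by blast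
  then have "(h has_derivative (\<lambda>x. h' * x)) (at (cip z p))" by (simp add: has_field_derivative_def)
  from has_derivative_compose[OF bounded_linear.has_derivative[OF bounded_linear_cip_left has_derivative_ident] this]
  have "((\<lambda>z. h (cip z p)) has_derivative (\<lambda>v. h' * cip v p)) (at z)" .
  then show "\<exists>D. ((\<lambda>z. h (cip z p)) has_derivative D) (at z) \<and> (\<forall>a v. D (a *s v) = a * D v)"
    by (intro exI conjI) (assumption, simp add: cip_scale_left)
qed

lemma holomorphic_mv_sum:
  assumes "finite I" "\<And>i. i \<in> I \<Longrightarrow> holomorphic_mv (f i) S"
  shows "holomorphic_mv (\<lambda>z. \<Sum>i\<in>I. c i * f i z) S"
  using assms
proof (induction I rule: finite_induct)
  case empty
  show ?case unfolding holomorphic_mv_def by (intro ballI exI[of _ "\<lambda>_. 0"]) auto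
next
  case (insert i I)
  then have "holomorphic_mv (\<lambda>z. c i * f i z + 1 * (\<Sum>i\<in>I. c i * f i z)) S"
    by (intro holomorphic_mv_lincomb) auto
  then show ?case using insert by simp
qed

lemma holomorphic_mv_cong_open:
  assumes f: "holomorphic_mv f S" and S: "open S" and eq: "\<And>z. z \<in> S \<Longrightarrow> f z = g z"
  shows "holomorphic_mv g S"
  unfolding holomorphic_mv_def
proof
  fix z assume z: "z \<in> S"
  then obtain D where D: "(f has_derivative D) (at z)" "\<forall>a v. D (a *s v) = a * D v"
    using f by (auto simp: holomorphic_mv_def)
  have "(g has_derivative D) (at z)"
    by (rule has_derivative_transform_within_open[OF D(1) S z eq])
  then show "\<exists>D. (g has_derivative D) (at z) \<and> (\<forall>a v. D (a *s v) = a * D v)" using D(2) by blast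
qed

text \<open>The kernels at the points \<open>l i *s \<eta> i\<close>, with the extension by 0 that
  membership in \<open>carrier_of\<close> demands.\<close>

definition test_fun :: "real \<Rightarrow> 'i set \<Rightarrow> ('i \<Rightarrow> complex) \<Rightarrow> ('i \<Rightarrow> complex) \<Rightarrow> ('i \<Rightarrow> complex ^ 'n) \<Rightarrow> complex ^ 'n \<Rightarrow> complex"
  where "test_fun \<beta> I \<alpha> l \<eta> z =
    (if z \<in> unit_ball then \<Sum>i\<in>I. \<alpha> i * (1 - cnj (l i) * cip z (\<eta> i)) powr (- of_real \<beta>) else 0)"

text \<open>Kernels attached to different boundary points interact weakly: near a point of the ball all but one
  of them are bounded by a constant independent of \<open>l\<close>.\<close>

lemma test_fun_carrier:
  fixes \<eta> :: "'i \<Rightarrow> complex ^ 'n" and \<alpha> :: "'i \<Rightarrow> complex"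
  assumes X: "admissible X" and I: "finite I" and \<eta>: "\<And>i. i \<in> I \<Longrightarrow> norm (\<eta> i) = 1"
    and l: "\<And>i. i \<in> I \<Longrightarrow> cmod (l i) < 1" "\<And>i. i \<in> I \<Longrightarrow> cmod (1 - l i) \<le> \<delta> / 2"
    and \<delta>: "0 < \<delta>" "\<And>e e'. e \<in> \<eta> ` I \<Longrightarrow> e' \<in> \<eta> ` I \<Longrightarrow> e \<noteq> e' \<Longrightarrow> 8 * \<delta> \<le> (norm (e - e'))\<^sup>2"
    and \<tau>: "0 < \<tau>"
  defines "\<beta> \<equiv> kernel_exponent X CARD('n)"
  defines "f \<equiv> test_fun \<beta> I \<alpha> l \<eta>"
  shows "f \<in> carrier_of X"
    and "(fnorm X f)\<^sup>2 \<le> (1 + \<tau>) * (\<Sum>e\<in>\<eta> ` I. Re (kernel_gram \<beta> {i \<in> I. \<eta> i = e} \<alpha> l))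
      + (1 + 1 / \<tau>) * (card (\<eta> ` I) * (\<Sum>i\<in>I. cmod (\<alpha> i) * (\<delta> / 2) powr (- \<beta>)))\<^sup>2"
proof -
  have \<beta>: "\<beta> > 0" unfolding \<beta>_def by (rule kernel_exponent_pos[OF X])
  let ?E = "\<eta> ` I"
  define J where "J e = {i \<in> I. \<eta> i = e}" for e
  define C where "C = (\<Sum>i\<in>I. cmod (\<alpha> i) * (\<delta> / 2) powr (- \<beta>))"
  have C0: "C \<ge> 0" by (simp add: C_def sum_nonneg)
  have J: "finite (J e)" "J e \<subseteq> I" for e using I by (auto simp: J_def)
  have lJ: "cmod (l i) < 1" if "i \<in> J e" for i e using J(2)[of e] l(1) that by blast
  have ip: "cmod (cip z (\<eta> i)) < 1" if "norm z < 1" "i \<in> I" for z i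
    using cmod_cip_le[of z "\<eta> i"] \<eta>[OF that(2)] that(1) by simp
  have hol: "holomorphic_mv f unit_ball"
  proof (rule holomorphic_mv_cong_open)
    show "holomorphic_mv (\<lambda>z. \<Sum>i\<in>I. \<alpha> i * (1 - cnj (l i) * cip z (\<eta> i)) powr (- of_real \<beta>)) unit_ball"
    proof (rule holomorphic_mv_sum[OF I])
      fix i assume i: "i \<in> I"
      show "holomorphic_mv (\<lambda>z. (1 - cnj (l i) * cip z (\<eta> i)) powr (- of_real \<beta>)) unit_ball"
      proof (rule holomorphic_mv_compose_cip[where h="\<lambda>x. (1 - cnj (l i) * x) powr (- of_real \<beta>)"])
        fix z :: "complex ^ 'n" assume "z \<in> unit_ball"
        then have "1 - cnj (l i) * cip z (\<eta> i) \<notin> \<real>\<^sub>\<le>\<^sub>0"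
          using i by (intro Re_pos_not_nonpos_Reals Re_one_minus_pos cmod_mult_less_1) (auto simp: l ip)
        then show "(\<lambda>x. (1 - cnj (l i) * x) powr (- of_real \<beta>)) field_differentiable at (cip z (\<eta> i))"
          unfolding field_differentiable_def by (intro exI) (auto intro!: derivative_eq_intros)
      qed
    qed
  qed (auto simp: f_def test_fun_def)
  have f0: "f z = 0" if "z \<notin> unit_ball" for z using that by (simp add: f_def test_fun_def)
  have fm: "f \<in> borel_measurable borel" by (rule borel_measurable_holomorphic_mv[OF hol f0])
  \<comment> \<open>Indices with the same boundary point are grouped. Within a group the exact Gram
    form is used, between groups only the crude bound \<open>far\<close>.\<close>
  have decomp: "f z = (\<Sum>e\<in>?E. kernel_sum \<beta> (J e) \<alpha> l (cip z e))" if z: "norm z < 1" for z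
  proof -
    have "f z = (\<Sum>e\<in>?E. \<Sum>i\<in>J e. \<alpha> i * (1 - cnj (l i) * cip z (\<eta> i)) powr (- of_real \<beta>))"
      using sum.image_gen[OF I, of "\<lambda>i. \<alpha> i * (1 - cnj (l i) * cip z (\<eta> i)) powr (- of_real \<beta>)" \<eta>] z
      by (simp add: f_def test_fun_def J_def)
    also have "\<dots> = (\<Sum>e\<in>?E. kernel_sum \<beta> (J e) \<alpha> l (cip z e))"
      by (intro sum.cong refl) (auto simp: kernel_sum_def J_def)
    finally show ?thesis .
  qed
  \<comment> \<open>Each \<open>l i\<close> is within \<open>\<delta> / 2\<close> of 1, so replacing
    it by 1 moves the base \<open>1 - cnj (l i) * x\<close> by at most \<open>\<delta> / 2\<close>;
    the base stays at least \<open>\<delta> / 2\<close> away from 0.\<close>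
  have far: "cmod (kernel_sum \<beta> (J e) \<alpha> l x) \<le> C" if x: "\<delta> \<le> cmod (1 - x)" "cmod x < 1" for e x
  proof -
    have "cmod (kernel_sum \<beta> (J e) \<alpha> l x) \<le> (\<Sum>i\<in>J e. cmod (\<alpha> i) * cmod (1 - cnj (l i) * x) powr (- \<beta>))"
      unfolding kernel_sum_def by (rule order_trans[OF norm_sum]) (simp add: norm_mult cmod_powr_real)
    also have "\<dots> \<le> (\<Sum>i\<in>J e. cmod (\<alpha> i) * (\<delta> / 2) powr (- \<beta>))"
    proof (intro sum_mono mult_left_mono powr_mono2')
      fix i assume "i \<in> J e"
      then have i: "i \<in> I" using J by blast
      have "cmod ((1 - cnj (l i)) * x) \<le> cmod (1 - cnj (l i)) * 1"
        unfolding norm_mult using x by (intro mult_left_mono) auto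
      also have "cmod (1 - cnj (l i)) = cmod (1 - l i)"
        by (metis complex_cnj_diff complex_cnj_one complex_mod_cnj)
      finally have "cmod ((1 - cnj (l i)) * x) \<le> \<delta> / 2" using l(2)[OF i] by simp
      moreover have "1 - cnj (l i) * x = (1 - x) + (1 - cnj (l i)) * x" by (simp add: algebra_simps)
      then have "cmod (1 - x) - cmod ((1 - cnj (l i)) * x) \<le> cmod (1 - cnj (l i) * x)"
        using norm_diff_ineq[of "1 - x" "(1 - cnj (l i)) * x"] by (simp only:)
      ultimately show "\<delta> / 2 \<le> cmod (1 - cnj (l i) * x)" using x by linarith
    qed (use \<beta> \<delta> in auto)
    also have "\<dots> \<le> C" unfolding C_def using J I by (intro sum_mono2) auto
    finally show ?thesis .
  qed
  define B where "B = (1 + \<tau>) * (\<Sum>e\<in>?E. Re (kernel_gram \<beta> (J e) \<alpha> l)) + (1 + 1 / \<tau>) * (card ?E * C)\<^sup>2"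
  have int: "(\<integral>\<^sup>+z. ennreal ((cmod (f (r *\<^sub>R z)))\<^sup>2) \<partial>space_measure X) \<le> ennreal B" if r: "r \<in> radii X" for r
  proof -
    let ?k = "\<lambda>e z. kernel_sum \<beta> (J e) \<alpha> l (of_real r * cip z e)"
    define H where "H e z = ennreal ((cmod (?k e z))\<^sup>2)" for e z
    have [measurable]: "H e \<in> borel_measurable borel" for e
      unfolding H_def[abs_def] kernel_sum_def powr_def by measurable
    have "(\<integral>\<^sup>+z. ennreal ((cmod (f (r *\<^sub>R z)))\<^sup>2) \<partial>space_measure X)
      \<le> (\<integral>\<^sup>+z. ennreal (1 + \<tau>) * (\<Sum>e\<in>?E. H e z) + ennreal ((1 + 1 / \<tau>) * (card ?E * C)\<^sup>2) \<partial>space_measure X)"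
    proof (rule nn_integral_mono_AE)
      show "AE z in space_measure X. ennreal ((cmod (f (r *\<^sub>R z)))\<^sup>2)
        \<le> ennreal (1 + \<tau>) * (\<Sum>e\<in>?E. H e z) + ennreal ((1 + 1 / \<tau>) * (card ?E * C)\<^sup>2)"
        using AE_space_measure[OF r]
      proof eventually_elim
        case (elim z)
        have x: "cmod (cip (r *\<^sub>R z) e) < 1" if "e \<in> ?E" for e using that ip[OF elim] by auto
        obtain e0 where e0: "\<forall>e\<in>?E - {e0}. \<delta> \<le> cmod (1 - cip (r *\<^sub>R z) e)"
          using one_near_boundary_point[of "r *\<^sub>R z" ?E \<delta>] elim \<eta> \<delta>(2) by (auto intro: less_imp_le)
        have "cmod (f (r *\<^sub>R z)) \<le> (\<Sum>e\<in>?E. cmod (?k e z))"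
          unfolding decomp[OF elim] cip_scaleR_left by (rule norm_sum)
        then have "(cmod (f (r *\<^sub>R z)))\<^sup>2 \<le> (\<Sum>e\<in>?E. cmod (?k e z))\<^sup>2" by (rule power_mono) simp
        also have "\<dots> \<le> (1 + \<tau>) * (\<Sum>e\<in>?E. (cmod (?k e z))\<^sup>2) + (1 + 1 / \<tau>) * (card ?E * C)\<^sup>2"
          using I e0 x by (intro square_sum_one_dominant[where ?e0.0=e0] C0 \<tau>) (auto simp: cip_scaleR_left intro!: far)
        finally have "ennreal ((cmod (f (r *\<^sub>R z)))\<^sup>2) \<le> ennreal ((1 + \<tau>) * (\<Sum>e\<in>?E. (cmod (?k e z))\<^sup>2) + (1 + 1 / \<tau>) * (card ?E * C)\<^sup>2)"
          by (rule ennreal_leI)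
        also have "\<dots> = ennreal (1 + \<tau>) * (\<Sum>e\<in>?E. H e z) + ennreal ((1 + 1 / \<tau>) * (card ?E * C)\<^sup>2)"
          using \<tau> by (subst ennreal_plus) (auto simp: H_def ennreal_mult sum_nonneg intro!: mult_nonneg_nonneg)
        finally show ?case .
      qed
    qed
    also have "\<dots> = ennreal (1 + \<tau>) * (\<Sum>e\<in>?E. \<integral>\<^sup>+z. H e z \<partial>space_measure X) + ennreal ((1 + 1 / \<tau>) * (card ?E * C)\<^sup>2)"
      by (subst nn_integral_add) (simp_all add: nn_integral_cmult nn_integral_sum prob_space_measure[OF X] measurable_cong_sets[OF sets_space_measure refl])
    also have "\<dots> \<le> ennreal (1 + \<tau>) * (\<Sum>e\<in>?E. ennreal (Re (kernel_gram \<beta> (J e) \<alpha> l))) + ennreal ((1 + 1 / \<tau>) * (card ?E * C)\<^sup>2)"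
    proof (intro add_mono mult_left_mono sum_mono order_refl)
      fix e assume e: "e \<in> ?E"
      show "(\<integral>\<^sup>+z. H e z \<partial>space_measure X) \<le> ennreal (Re (kernel_gram \<beta> (J e) \<alpha> l))"
        unfolding \<beta>_def H_def by (rule kernel_sum_integral_le[OF X _ r J(1)]) (use e \<eta> lJ in auto)
    qed auto
    also have "\<dots> = ennreal B"
    proof -
      have g0: "0 \<le> Re (kernel_gram \<beta> (J e) \<alpha> l)" for e
        by (rule kernel_gram_nonneg[OF \<beta> lJ])
      then show ?thesis
        unfolding B_def using \<tau> by (subst ennreal_plus) (auto simp: ennreal_mult sum_nonneg intro!: mult_nonneg_nonneg)
    qed
    finally show ?thesis .
  qed
  have le: "sqnorm X f \<le> ennreal B"
    unfolding sqnorm_eq[OF X fm] by (rule SUP_least) (rule int)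
  show fc: "f \<in> carrier_of X"
    using hol f0 le_less_trans[OF le ennreal_less_top] by (simp add: carrier_of_iff)
  show "(fnorm X f)\<^sup>2 \<le> (1 + \<tau>) * (\<Sum>e\<in>\<eta> ` I. Re (kernel_gram \<beta> {i \<in> I. \<eta> i = e} \<alpha> l))
      + (1 + 1 / \<tau>) * (card (\<eta> ` I) * (\<Sum>i\<in>I. cmod (\<alpha> i) * (\<delta> / 2) powr (- \<beta>)))\<^sup>2"
  proof -
    have "(fnorm X f)\<^sup>2 \<le> B \<or> B < 0"
      using le unfolding sqnorm_carrier[OF fc] by (auto simp: ennreal_le_iff not_less)
    moreover have "0 \<le> B"
      unfolding B_def using \<tau> lJ
      by (intro add_nonneg_nonneg mult_nonneg_nonneg sum_nonneg kernel_gram_nonneg \<beta>) auto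
    ultimately show ?thesis by (simp add: B_def C_def J_def)
  qed
qed

section \<open>Boundary limits of the kernels\<close>

text \<open>A ray ending at 1 with slope \<open>M\<close>. For fixed \<open>M\<close> it approaches
  1 nontangentially as \<open>t\<close> decreases to 0.\<close>

definition ang_pt :: "real \<Rightarrow> real \<Rightarrow> complex"
  where "ang_pt M t = 1 - of_real t * (1 + \<i> * of_real M)"

lemma ang_pt_norm: "(cmod (ang_pt M t))\<^sup>2 = 1 - t * (2 - t * (1 + M\<^sup>2))"
  unfolding cmod_power2 by (simp add: ang_pt_def power2_eq_square algebra_simps)

lemma tendsto_of_real_at_right: "((\<lambda>t. complex_of_real t) \<longlongrightarrow> 0) (at_right 0)"
  using tendsto_of_real[OF tendsto_ident_at[of "0::real" "{0<..}"], where 'a=complex] by simp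

lemma ang_pt_tendsto: "((\<lambda>t. ang_pt M (d * t)) \<longlongrightarrow> 1) (at_right 0)"
proof -
  have "((\<lambda>t. 1 - of_real d * of_real t * (1 + \<i> * of_real M)) \<longlongrightarrow> 1 - of_real d * 0 * (1 + \<i> * of_real M)) (at_right 0)"
    by (intro tendsto_intros tendsto_of_real_at_right)
  then show ?thesis by (simp add: ang_pt_def)
qed

lemma eventually_ang_pt:
  assumes "d > 0"
  shows "\<forall>\<^sub>F t in at_right 0. cmod (ang_pt M (d * t)) < 1"
proof -
  have "((\<lambda>t. 2 - d * t * (1 + M\<^sup>2)) \<longlongrightarrow> 2 - d * 0 * (1 + M\<^sup>2)) (at_right 0)"
    by (intro tendsto_intros)
  then have "\<forall>\<^sub>F t in at_right 0. 2 - d * t * (1 + M\<^sup>2) > 0"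
    by (rule order_tendstoD) simp
  then show ?thesis
    using eventually_at_right_less[of "0::real"]
  proof eventually_elim
    case (elim t)
    have "0 < d * t * (2 - d * t * (1 + M\<^sup>2))" using elim assms by simp
    then have "(cmod (ang_pt M (d * t)))\<^sup>2 < 1" unfolding ang_pt_norm by simp
    then show ?case by (simp add: abs_square_less_1)
  qed
qed

lemma ang_pt_defect:
  "((\<lambda>t. (1 - (cmod (ang_pt M t))\<^sup>2) / t) \<longlongrightarrow> 2) (at_right 0)"
proof (rule Lim_transform_eventually)
  have "((\<lambda>t. 2 - t * (1 + M\<^sup>2)) \<longlongrightarrow> 2 - 0 * (1 + M\<^sup>2)) (at_right 0)"
    by (intro tendsto_intros)
  then show "((\<lambda>t. 2 - t * (1 + M\<^sup>2)) \<longlongrightarrow> 2) (at_right 0)" by simp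
  show "\<forall>\<^sub>F t in at_right 0. 2 - t * (1 + M\<^sup>2) = (1 - (cmod (ang_pt M t))\<^sup>2) / t"
    using eventually_at_right_less[of "0::real"] by eventually_elim (simp add: ang_pt_norm)
qed

text \<open>A positive real factor may be taken out of a principal power, and
  \<open>Re y > 0\<close> keeps the limit off the branch cut.\<close>

lemma powr_scaled_limit:
  fixes h :: "real \<Rightarrow> complex"
  assumes h: "((\<lambda>t. h t / of_real t) \<longlongrightarrow> y) (at_right 0)" and y: "Re y > 0"
  shows "((\<lambda>t. of_real (t powr \<beta>) * h t powr (- of_real \<beta>)) \<longlongrightarrow> y powr (- of_real \<beta>)) (at_right 0)"
proof (rule Lim_transform_eventually)
  show "((\<lambda>t. (h t / of_real t) powr (- of_real \<beta>)) \<longlongrightarrow> y powr (- of_real \<beta>)) (at_right 0)"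
    by (rule tendsto_powr_complex[OF Re_pos_not_nonpos_Reals[OF y] h tendsto_const])
  show "\<forall>\<^sub>F t in at_right 0. (h t / of_real t) powr (- of_real \<beta>) = of_real (t powr \<beta>) * h t powr (- of_real \<beta>)"
    using eventually_at_right_less[of "0::real"]
  proof eventually_elim
    case (elim t)
    define x where "x = h t / of_real t"
    have "h t powr (- of_real \<beta>) = (of_real t * x) powr (- of_real \<beta>)" using elim by (simp add: x_def)
    also have "\<dots> = of_real t powr (- of_real \<beta>) * x powr (- of_real \<beta>)"
      by (rule powr_times_real_left) (use elim in auto)
    also have "complex_of_real t powr (- of_real \<beta>) = of_real (t powr (- \<beta>))"
      using powr_of_real[of t "- \<beta>"] elim by simp
    finally have "of_real (t powr \<beta>) * h t powr (- of_real \<beta>) = of_real (t powr \<beta> * t powr (- \<beta>)) * x powr (- of_real \<beta>)"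
      by simp
    also have "t powr \<beta> * t powr (- \<beta>) = 1" using elim by (simp add: powr_minus)
    finally show ?case by (simp add: x_def)
  qed
qed

lemma powr_at_right_0: "\<beta> > 0 \<Longrightarrow> ((\<lambda>t. t powr \<beta>) \<longlongrightarrow> 0) (at_right (0::real))"
  by (rule tendsto_zero_powrI[where b=\<beta>]) (auto intro: eventually_mono[OF eventually_at_right_less])

text \<open>The rescaled limit of the pairing of kernels at \<open>ang_pt M (a * t)\<close> and
  \<open>ang_pt M (b * t)\<close>. The opposite signs of \<open>M\<close> leave the imaginary part
  \<open>(b - a) * M\<close> in the base.\<close>

definition pair_val :: "real \<Rightarrow> real \<Rightarrow> real \<Rightarrow> real \<Rightarrow> complex"
  where "pair_val \<beta> M a b =
    (of_real a * (1 - \<i> * of_real M) + of_real b * (1 + \<i> * of_real M)) powr (- of_real \<beta>)"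

lemma kernel_gram_limit:
  assumes d: "\<And>i. i \<in> J \<Longrightarrow> d i > 0"
  shows "((\<lambda>t. of_real (t powr \<beta>) * kernel_gram \<beta> J \<alpha> (\<lambda>i. ang_pt M (d i * t)))
    \<longlongrightarrow> (\<Sum>i\<in>J. \<Sum>j\<in>J. \<alpha> i * cnj (\<alpha> j) * pair_val \<beta> M (d i) (d j))) (at_right 0)"
proof -
  have lim: "((\<lambda>t. of_real (t powr \<beta>) * (1 - cnj (ang_pt M (d i * t)) * ang_pt M (d j * t)) powr (- of_real \<beta>))
    \<longlongrightarrow> pair_val \<beta> M (d i) (d j)) (at_right 0)" if i: "i \<in> J" and j: "j \<in> J" for i j
    unfolding pair_val_def
  proof (rule powr_scaled_limit)
    define w where "w = 1 + \<i> * complex_of_real M"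
    show "((\<lambda>t. (1 - cnj (ang_pt M (d i * t)) * ang_pt M (d j * t)) / of_real t)
      \<longlongrightarrow> of_real (d i) * (1 - \<i> * of_real M) + of_real (d j) * (1 + \<i> * of_real M)) (at_right 0)"
    proof (rule Lim_transform_eventually)
      have "((\<lambda>t. of_real (d i) * cnj w + of_real (d j) * w - of_real t * of_real (d i) * of_real (d j) * w * cnj w)
        \<longlongrightarrow> of_real (d i) * cnj w + of_real (d j) * w - 0 * of_real (d i) * of_real (d j) * w * cnj w) (at_right 0)"
        by (intro tendsto_intros tendsto_of_real_at_right)
      then show "((\<lambda>t. of_real (d i) * cnj w + of_real (d j) * w - of_real t * of_real (d i) * of_real (d j) * w * cnj w)
        \<longlongrightarrow> of_real (d i) * (1 - \<i> * of_real M) + of_real (d j) * (1 + \<i> * of_real M)) (at_right 0)"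
        by (simp add: w_def)
      show "\<forall>\<^sub>F t in at_right 0. of_real (d i) * cnj w + of_real (d j) * w - of_real t * of_real (d i) * of_real (d j) * w * cnj w
        = (1 - cnj (ang_pt M (d i * t)) * ang_pt M (d j * t)) / of_real t"
        using eventually_at_right_less[of "0::real"]
      proof eventually_elim
        case (elim t)
        have ap: "ang_pt M s = 1 - of_real s * w" for s by (simp add: ang_pt_def w_def)
        have "1 - cnj (ang_pt M (d i * t)) * ang_pt M (d j * t)
          = of_real t * (of_real (d i) * cnj w + of_real (d j) * w - of_real t * of_real (d i) * of_real (d j) * w * cnj w)"
          unfolding ap by (simp add: algebra_simps)
        then show ?case using elim by simp
      qed
    qed
    show "0 < Re (of_real (d i) * (1 - \<i> * of_real M) + of_real (d j) * (1 + \<i> * of_real M))"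
      using d[OF i] d[OF j] by simp
  qed
  have "((\<lambda>t. \<Sum>i\<in>J. \<Sum>j\<in>J. \<alpha> i * cnj (\<alpha> j) * (of_real (t powr \<beta>) * (1 - cnj (ang_pt M (d i * t)) * ang_pt M (d j * t)) powr (- of_real \<beta>)))
    \<longlongrightarrow> (\<Sum>i\<in>J. \<Sum>j\<in>J. \<alpha> i * cnj (\<alpha> j) * pair_val \<beta> M (d i) (d j))) (at_right 0)"
    by (intro tendsto_sum tendsto_mult tendsto_const lim)
  then show ?thesis by (simp add: kernel_gram_def sum_distrib_left mult_ac)
qed

text \<open>The curve \<open>y\<close> stands for a map \<open>\<phi> j\<close> along the approach
  path, known through its expansion against \<open>\<eta>\<^sub>0\<close>. For a kernel at
  \<open>\<eta>\<^sub>0\<close> this expansion is all that enters. It also forces \<open>y\<close>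
  to converge to \<open>\<eta>\<^sub>0\<close>, so a kernel at another boundary point stays bounded
  and the factor \<open>t powr \<beta>\<close> removes it.\<close>

lemma kernel_eval_limit:
  fixes y :: "real \<Rightarrow> complex ^ 'n"
  assumes \<beta>: "\<beta> > 0" and yb: "\<forall>\<^sub>F t in at_right 0. norm (y t) < 1"
    and y: "((\<lambda>t. (1 - cip (y t) \<eta>\<^sub>0) / of_real t) \<longlongrightarrow> of_real d\<^sub>0 * (1 + \<i> * of_real M)) (at_right 0)"
    and d0: "d\<^sub>0 > 0" and \<eta>0: "norm \<eta>\<^sub>0 = 1" and d: "d > 0" and \<eta>: "norm \<eta> = 1"
  shows "((\<lambda>t. of_real (t powr \<beta>) * (1 - cnj (ang_pt M (d * t)) * cip (y t) \<eta>) powr (- of_real \<beta>))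
    \<longlongrightarrow> (if \<eta> = \<eta>\<^sub>0 then pair_val \<beta> M d d\<^sub>0 else 0)) (at_right 0)"
proof -
  have x0: "((\<lambda>t. 1 - (1 - cip (y t) \<eta>\<^sub>0) / of_real t * of_real t) \<longlongrightarrow> 1 - of_real d\<^sub>0 * (1 + \<i> * of_real M) * 0) (at_right 0)"
    by (intro tendsto_diff tendsto_mult tendsto_const y tendsto_of_real_at_right)
  have x1: "((\<lambda>t. cip (y t) \<eta>\<^sub>0) \<longlongrightarrow> 1) (at_right 0)"
  proof (rule Lim_transform_eventually)
    show "((\<lambda>t. 1 - (1 - cip (y t) \<eta>\<^sub>0) / of_real t * of_real t) \<longlongrightarrow> 1) (at_right 0)" using x0 by simp
    show "\<forall>\<^sub>F t in at_right 0. 1 - (1 - cip (y t) \<eta>\<^sub>0) / of_real t * of_real t = cip (y t) \<eta>\<^sub>0"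
      using eventually_at_right_less[of "0::real"] by eventually_elim simp
  qed
  show ?thesis
  proof (cases "\<eta> = \<eta>\<^sub>0")
    case True
    have "((\<lambda>t. of_real (t powr \<beta>) * (1 - cnj (ang_pt M (d * t)) * cip (y t) \<eta>\<^sub>0) powr (- of_real \<beta>))
      \<longlongrightarrow> pair_val \<beta> M d d\<^sub>0) (at_right 0)"
      unfolding pair_val_def
    proof (rule powr_scaled_limit)
      show "((\<lambda>t. (1 - cnj (ang_pt M (d * t)) * cip (y t) \<eta>\<^sub>0) / of_real t)
        \<longlongrightarrow> of_real d * (1 - \<i> * of_real M) + of_real d\<^sub>0 * (1 + \<i> * of_real M)) (at_right 0)"
      proof (rule Lim_transform_eventually)
        show "((\<lambda>t. of_real d * (1 - \<i> * of_real M) * cip (y t) \<eta>\<^sub>0 + (1 - cip (y t) \<eta>\<^sub>0) / of_real t)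
          \<longlongrightarrow> of_real d * (1 - \<i> * of_real M) + of_real d\<^sub>0 * (1 + \<i> * of_real M)) (at_right 0)"
          using tendsto_add[OF tendsto_mult[OF tendsto_const x1] y, of "of_real d * (1 - \<i> * of_real M)"] by simp
        show "\<forall>\<^sub>F t in at_right 0. of_real d * (1 - \<i> * of_real M) * cip (y t) \<eta>\<^sub>0 + (1 - cip (y t) \<eta>\<^sub>0) / of_real t
          = (1 - cnj (ang_pt M (d * t)) * cip (y t) \<eta>\<^sub>0) / of_real t"
          using eventually_at_right_less[of "0::real"]
          by eventually_elim (simp add: ang_pt_def field_simps)
      qed
      show "0 < Re (of_real d * (1 - \<i> * of_real M) + of_real d\<^sub>0 * (1 + \<i> * of_real M))" using d d0 by simp
    qed
    then show ?thesis using True by simp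
  next
    case False
    have "((\<lambda>t. (norm (y t - \<eta>\<^sub>0))\<^sup>2) \<longlongrightarrow> 0) (at_right 0)"
    proof (rule tendsto_sandwich[OF _ _ tendsto_const])
      have "((\<lambda>t. 2 * (1 - Re (cip (y t) \<eta>\<^sub>0))) \<longlongrightarrow> 2 * (1 - Re 1)) (at_right 0)" by (intro tendsto_intros x1)
      then show "((\<lambda>t. 2 * (1 - Re (cip (y t) \<eta>\<^sub>0))) \<longlongrightarrow> 0) (at_right 0)" by simp
      show "\<forall>\<^sub>F t in at_right 0. (norm (y t - \<eta>\<^sub>0))\<^sup>2 \<le> 2 * (1 - Re (cip (y t) \<eta>\<^sub>0))"
        using yb by eventually_elim (intro norm_diff_unit_sq_le; simp add: \<eta>0)
    qed simp
    from tendsto_real_sqrt[OF this] have yl: "(y \<longlongrightarrow> \<eta>\<^sub>0) (at_right 0)"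
      by (subst tendsto_dist_iff) (simp add: dist_norm)
    have Re: "Re (1 - cip \<eta>\<^sub>0 \<eta>) > 0"
    proof -
      have "0 < (norm (\<eta>\<^sub>0 - \<eta>))\<^sup>2" using False by simp
      also have "\<dots> \<le> 2 * (1 - Re (cip \<eta>\<^sub>0 \<eta>))" using \<eta> \<eta>0 by (intro norm_diff_unit_sq_le) auto
      finally show ?thesis by simp
    qed
    have "((\<lambda>t. of_real (t powr \<beta>) * (1 - cnj (ang_pt M (d * t)) * cip (y t) \<eta>) powr (- of_real \<beta>))
      \<longlongrightarrow> of_real 0 * (1 - cnj 1 * cip \<eta>\<^sub>0 \<eta>) powr (- of_real \<beta>)) (at_right 0)"
      by (intro tendsto_mult tendsto_of_real powr_at_right_0 \<beta> tendsto_powr_complex tendsto_diff tendsto_const tendsto_cnj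
          ang_pt_tendsto tendsto_cip yl) (use Re in \<open>simp add: Re_pos_not_nonpos_Reals\<close>)
    then show ?thesis using False by simp
  qed
qed

text \<open>The base has modulus at least \<open>1 - norm (y t)\<close>, so the rescaled kernel is
  at most \<open>(t / (1 - norm (y t))) powr \<beta>\<close>.\<close>

lemma kernel_eval_limit_infinite:
  fixes y :: "real \<Rightarrow> complex ^ 'n"
  assumes \<beta>: "\<beta> > 0" and yb: "\<forall>\<^sub>F t in at_right 0. norm (y t) < 1"
    and y: "((\<lambda>t. t / (1 - norm (y t))) \<longlongrightarrow> 0) (at_right 0)" and d: "d > 0" and \<eta>: "norm \<eta> = 1"
  shows "((\<lambda>t. of_real (t powr \<beta>) * (1 - cnj (ang_pt M (d * t)) * cip (y t) \<eta>) powr (- of_real \<beta>)) \<longlongrightarrow> 0) (at_right 0)"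
proof (rule Lim_null_comparison)
  have "\<forall>\<^sub>F t in at_right 0. 0 \<le> t / (1 - norm (y t))"
    using yb eventually_at_right_less[of "0::real"] by eventually_elim simp
  then show "((\<lambda>t. (t / (1 - norm (y t))) powr \<beta>) \<longlongrightarrow> 0) (at_right 0)"
    using \<beta> by (intro tendsto_zero_powrI[OF y tendsto_const]) auto
  show "\<forall>\<^sub>F t in at_right 0. norm (of_real (t powr \<beta>) * (1 - cnj (ang_pt M (d * t)) * cip (y t) \<eta>) powr (- of_real \<beta>))
    \<le> (t / (1 - norm (y t))) powr \<beta>"
    using yb eventually_at_right_less[of "0::real"] eventually_ang_pt[OF d, of M]
  proof eventually_elim
    case (elim t)
    let ?x = "cnj (ang_pt M (d * t)) * cip (y t) \<eta>"
    have "cmod ?x \<le> 1 * (norm (y t) * norm \<eta>)"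
      unfolding norm_mult using elim by (intro mult_mono cmod_cip_le) auto
    then have "1 - norm (y t) \<le> cmod (1 - ?x)"
      using norm_triangle_ineq2[of 1 ?x] \<eta> by simp
    then have "cmod (1 - ?x) powr (- \<beta>) \<le> (1 - norm (y t)) powr (- \<beta>)"
      using elim \<beta> by (intro powr_mono2') auto
    then have "t powr \<beta> * cmod (1 - ?x) powr (- \<beta>) \<le> t powr \<beta> * (1 - norm (y t)) powr (- \<beta>)"
      by (rule mult_left_mono) simp
    also have "\<dots> = (t / (1 - norm (y t))) powr \<beta>"
      using elim by (simp add: powr_divide powr_minus_divide)
    finally show ?case by (simp add: norm_mult cmod_powr_real)
  qed
qed

text \<open>An infinite lower limit makes \<open>(1 - norm (\<phi> z)) / (1 - norm z)\<close> exceed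
  every bound near \<open>\<zeta>\<close>, and on the oblique path \<open>1 - norm z\<close> is
  comparable with \<open>t\<close>. Maps of infinite dilation therefore contribute nothing to the
  limit.\<close>

lemma infinite_dilation_limit:
  fixes \<phi> :: "complex ^ 'n \<Rightarrow> complex ^ 'n"
  assumes \<phi>: "analytic_self_map \<phi>" and \<zeta>: "norm \<zeta> = 1" and inf: "\<not> ang_dilation \<phi> \<zeta> < \<infinity>"
  shows "((\<lambda>t. t / (1 - norm (\<phi> (ang_pt M t *s \<zeta>)))) \<longlongrightarrow> 0) (at_right 0)"
proof (rule tendstoI)
  have \<phi>b: "norm (\<phi> z) < 1" if "norm z < 1" for z
    using \<phi> that by (force simp: analytic_self_map_def)
  have fl: "filterlim (\<lambda>t. ang_pt M t *s \<zeta>) (at \<zeta> within ball 0 1) (at_right 0)"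
  proof -
    have "((\<lambda>t. ang_pt M (1 * t) *s \<zeta>) \<longlongrightarrow> 1 *s \<zeta>) (at_right 0)"
      by (intro tendsto_smult ang_pt_tendsto tendsto_const)
    moreover have "\<forall>\<^sub>F t in at_right 0. ang_pt M t *s \<zeta> \<in> ball 0 1 \<and> ang_pt M t *s \<zeta> \<noteq> \<zeta>"
      using eventually_ang_pt[of 1 M, simplified]
    proof eventually_elim
      case (elim t)
      have "norm (ang_pt M t *s \<zeta>) < 1" using elim \<zeta> by (simp add: norm_smult)
      then show ?case using \<zeta> by (metis less_irrefl mem_ball_0)
    qed
    ultimately show ?thesis by (simp add: filterlim_at)
  qed
  fix e :: real assume e: "e > 0"
  \<comment> \<open>The 2 compensates for \<open>t < 1 - a^2 \<le> 2 * (1 - a)\<close>.\<close>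
  have "ereal (2 / e) < ang_dilation \<phi> \<zeta>" using inf by (simp add: not_less top_unique)
  then have "\<forall>\<^sub>F z in at \<zeta> within ball 0 1. ereal (2 / e) < ereal ((1 - norm (\<phi> z)) / (1 - norm z))"
    unfolding ang_dilation_def by (rule less_LiminfD)
  from eventually_compose_filterlim[OF this fl]
  have big: "\<forall>\<^sub>F t in at_right 0. 2 / e < (1 - norm (\<phi> (ang_pt M t *s \<zeta>))) / (1 - cmod (ang_pt M t))"
    by (simp add: norm_smult \<zeta>)
  have "\<forall>\<^sub>F t in at_right 0. (1 - (cmod (ang_pt M t))\<^sup>2) / t > 1"
    by (rule order_tendstoD(1)[OF ang_pt_defect]) simp
  then show "\<forall>\<^sub>F t in at_right 0. dist (t / (1 - norm (\<phi> (ang_pt M t *s \<zeta>)))) 0 < e"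
    using big eventually_at_right_less[of "0::real"] eventually_ang_pt[of 1 M, simplified]
  proof eventually_elim
    case (elim t)
    define a where "a = cmod (ang_pt M t)"
    define b where "b = norm (\<phi> (ang_pt M t *s \<zeta>))"
    have a: "0 \<le> a" "a < 1" using elim by (simp_all add: a_def)
    have b: "b < 1" unfolding b_def by (rule \<phi>b) (use elim \<zeta> in \<open>simp add: norm_smult\<close>)
    have "t < 1 - a\<^sup>2" using elim by (simp add: a_def)
    also have "\<dots> = (1 - a) * (1 + a)" by (simp add: power2_eq_square algebra_simps)
    also have "\<dots> \<le> (1 - a) * 2" using a by (intro mult_left_mono) auto
    also have "\<dots> < e * (1 - b)"
      using elim(2) a e unfolding a_def[symmetric] b_def[symmetric] by (simp add: field_simps)
    finally have "t / (1 - b) < e" using b by (simp add: divide_less_eq)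
    then show ?case using b elim by (simp add: b_def[symmetric])
  qed
qed

section \<open>The effect of a compact perturbation\<close>

text \<open>The sharp point bound is applied to \<open>T F - K F\<close> for normalised functions
  \<open>F\<close>. Along a subsequence \<open>K F\<close> approaches a fixed \<open>g\<close> in
  norm, and neither \<open>g\<close> nor the difference contributes to the rescaled point values in
  the limit, so only \<open>T F\<close> survives. Taking \<open>q'\<close> strictly above
  \<open>q\<close> makes the rescaled squared norms eventually at most \<open>q'\<close>.\<close>

lemma compact_perturbation_bound:
  fixes f :: "real \<Rightarrow> complex ^ 'n \<Rightarrow> complex" and \<zeta> :: "complex ^ 'n"
  assumes X: "admissible X" and K: "compact_op X K" and T: "linear_op X T"
    and op: "\<And>g. g \<in> carrier_of X \<Longrightarrow> fnorm X g \<le> 1 \<Longrightarrow> fnorm X (\<lambda>z. T g z - K g z) \<le> N0"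
    and \<zeta>: "norm \<zeta> = 1"
  defines "\<beta> \<equiv> kernel_exponent X CARD('n)"
  assumes fc: "\<forall>\<^sub>F t in at_right 0. f t \<in> carrier_of X \<and> t powr \<beta> * (fnorm X (f t))\<^sup>2 \<le> B t"
    and B: "(B \<longlongrightarrow> q) (at_right 0)"
    and Tf: "((\<lambda>t. of_real (t powr \<beta>) * T (f t) (ang_pt M t *s \<zeta>)) \<longlongrightarrow> Q) (at_right 0)"
    and q': "q < q'" "0 < q'"
  shows "(cmod Q)\<^sup>2 * 2 powr \<beta> \<le> N0\<^sup>2 * q'"
proof -
  have \<beta>: "\<beta> > 0" unfolding \<beta>_def by (rule kernel_exponent_pos[OF X])
  have "\<forall>\<^sub>F t in at_right 0. B t < q'" using B q'(1) by (rule order_tendstoD)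
  then have "\<forall>\<^sub>F t in at_right 0. f t \<in> carrier_of X \<and> t powr \<beta> * (fnorm X (f t))\<^sup>2 \<le> q' \<and> 0 < t \<and> cmod (ang_pt M t) < 1"
    using fc eventually_at_right_less[of "0::real"] eventually_ang_pt[of 1 M, simplified]
    by eventually_elim auto
  moreover have "filterlim (\<lambda>k. inverse (real (Suc k))) (at_right 0) sequentially"
    using LIMSEQ_inverse_real_of_nat by (auto simp: filterlim_at)
  ultimately have "\<forall>\<^sub>F k in sequentially. f (inverse (real (Suc k))) \<in> carrier_of X
    \<and> inverse (real (Suc k)) powr \<beta> * (fnorm X (f (inverse (real (Suc k)))))\<^sup>2 \<le> q' \<and> 0 < inverse (real (Suc k))
    \<and> cmod (ang_pt M (inverse (real (Suc k)))) < 1"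
    by (rule eventually_compose_filterlim)
  then obtain k0 where k0: "\<And>k. k \<ge> k0 \<Longrightarrow> f (inverse (real (Suc k))) \<in> carrier_of X
    \<and> inverse (real (Suc k)) powr \<beta> * (fnorm X (f (inverse (real (Suc k)))))\<^sup>2 \<le> q' \<and> 0 < inverse (real (Suc k))
    \<and> cmod (ang_pt M (inverse (real (Suc k)))) < 1"
    by (auto simp: eventually_sequentially)
  define s where "s k = inverse (real (Suc (k + k0)))" for k
  have s: "f (s k) \<in> carrier_of X" "s k powr \<beta> * (fnorm X (f (s k)))\<^sup>2 \<le> q'" "0 < s k" "cmod (ang_pt M (s k)) < 1" for k
    using k0[of "k + k0"] unfolding s_def by auto
  have s0: "s \<longlonglongrightarrow> 0"
    using LIMSEQ_ignore_initial_segment[OF LIMSEQ_inverse_real_of_nat, of k0] by (simp add: s_def[abs_def])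
  \<comment> \<open>Normalising by the bound \<open>q'\<close> instead of by the norm of
    \<open>f (s k)\<close> gives norm at most 1 without any lower bound on that norm.\<close>
  define a where "a k = sqrt (s k powr \<beta> / q')" for k
  have a0: "a k \<ge> 0" for k using q' by (simp add: a_def)
  define F where "F k = (\<lambda>z. of_real (a k) * f (s k) z)" for k
  have Fc: "F k \<in> carrier_of X" for k
    unfolding F_def using lincomb_carrier(1)[OF X s(1) s(1), of "of_real (a k)" k 0 k] by simp
  have F1: "fnorm X (F k) \<le> 1" for k
  proof -
    have "fnorm X (F k) \<le> a k * fnorm X (f (s k))"
      using fnorm_scale_le[OF X s(1), of "of_real (a k)" k] a0[of k] by (simp add: F_def)
    also have "\<dots> = sqrt (s k powr \<beta> * (fnorm X (f (s k)))\<^sup>2 / q')"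
      by (simp add: a_def real_sqrt_mult real_sqrt_divide)
    also have "\<dots> \<le> 1" using s(2)[of k] q' by simp
    finally show ?thesis .
  qed
  obtain r g where r: "strict_mono (r :: nat \<Rightarrow> nat)" and g: "g \<in> carrier_of X"
    and lim: "(\<lambda>k. fnorm X (\<lambda>z. K (F (r k)) z - g z)) \<longlonglongrightarrow> 0"
    using K Fc F1 unfolding compact_op_def by blast
  define l where "l k = ang_pt M (s (r k))" for k
  have l: "cmod (l k) < 1" for k unfolding l_def by (rule s(4))
  define W where "W k = (1 - (cmod (l k))\<^sup>2) powr \<beta>" for k
  have W0: "W k \<ge> 0" for k by (simp add: W_def)
  have Kc: "K (F k) \<in> carrier_of X" and Tc: "T (F k) \<in> carrier_of X" for k
    using K T Fc by (simp_all add: compact_op_def linear_op_def)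
  have sr: "filterlim (\<lambda>k. s (r k)) (at_right 0) sequentially"
    using LIMSEQ_subseq_LIMSEQ[OF s0 r] s(3) by (auto simp: filterlim_at o_def intro!: always_eventually less_imp_neq[symmetric])
  have TK: "cmod (T (F (r k)) (l k *s \<zeta>) - K (F (r k)) (l k *s \<zeta>)) * sqrt (W k) \<le> N0" for k
  proof -
    let ?h = "\<lambda>z. T (F (r k)) z - K (F (r k)) z"
    have h: "?h \<in> carrier_of X" using lincomb_carrier(1)[OF X Tc Kc, of 1 "r k" "-1" "r k"] by simp
    have "(cmod (?h (l k *s \<zeta>)) * sqrt (W k))\<^sup>2 = (cmod (?h (l k *s \<zeta>)))\<^sup>2 * W k"
      using W0 by (simp add: power_mult_distrib)
    also have "\<dots> \<le> (fnorm X ?h)\<^sup>2"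
      unfolding W_def \<beta>_def by (rule carrier_point_bound[OF X h \<zeta> l])
    finally have "cmod (?h (l k *s \<zeta>)) * sqrt (W k) \<le> fnorm X ?h" by (rule power2_le_imp_le) simp
    also have "\<dots> \<le> N0" by (rule op[OF Fc F1])
    finally show ?thesis .
  qed
  have K0: "(\<lambda>k. cmod (K (F (r k)) (l k *s \<zeta>)) * sqrt (W k)) \<longlonglongrightarrow> 0"
  proof -
    have gl: "(\<lambda>k. (cmod (g (l k *s \<zeta>)))\<^sup>2 * W k) \<longlonglongrightarrow> 0"
      unfolding W_def \<beta>_def
    proof (rule carrier_point_little_o[OF X g \<zeta>])
      have "(\<lambda>k. ang_pt M (1 * s (r k))) \<longlonglongrightarrow> 1" by (rule filterlim_compose[OF ang_pt_tendsto sr])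
      from tendsto_norm[OF this] show "(\<lambda>k. cmod (l k)) \<longlonglongrightarrow> 1" by (simp add: l_def)
    qed (simp add: l)
    have "(\<lambda>k. (cmod (K (F (r k)) (l k *s \<zeta>)) * sqrt (W k))\<^sup>2) \<longlonglongrightarrow> 0"
    proof (rule tendsto_sandwich[OF _ _ tendsto_const])
      have "(\<lambda>k. 2 * (fnorm X (\<lambda>z. K (F (r k)) z - g z))\<^sup>2 + 2 * ((cmod (g (l k *s \<zeta>)))\<^sup>2 * W k)) \<longlonglongrightarrow> 2 * 0\<^sup>2 + 2 * 0"
        by (intro tendsto_intros lim gl)
      then show "(\<lambda>k. 2 * (fnorm X (\<lambda>z. K (F (r k)) z - g z))\<^sup>2 + 2 * ((cmod (g (l k *s \<zeta>)))\<^sup>2 * W k)) \<longlonglongrightarrow> 0"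
        by simp
      show "\<forall>\<^sub>F k in sequentially. (cmod (K (F (r k)) (l k *s \<zeta>)) * sqrt (W k))\<^sup>2
        \<le> 2 * (fnorm X (\<lambda>z. K (F (r k)) z - g z))\<^sup>2 + 2 * ((cmod (g (l k *s \<zeta>)))\<^sup>2 * W k)"
      proof (intro always_eventually allI)
        fix k
        let ?h = "\<lambda>z. K (F (r k)) z - g z"
        have h: "?h \<in> carrier_of X" using lincomb_carrier(1)[OF X Kc g, of 1 "r k" "-1"] by simp
        have hb: "(cmod (?h (l k *s \<zeta>)))\<^sup>2 * W k \<le> (fnorm X ?h)\<^sup>2"
          unfolding W_def \<beta>_def by (rule carrier_point_bound[OF X h \<zeta> l])
        have "cmod (K (F (r k)) (l k *s \<zeta>)) \<le> cmod (?h (l k *s \<zeta>)) + cmod (g (l k *s \<zeta>))"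
          using norm_triangle_ineq[of "?h (l k *s \<zeta>)" "g (l k *s \<zeta>)"] by simp
        then have "(cmod (K (F (r k)) (l k *s \<zeta>)))\<^sup>2 \<le> (cmod (?h (l k *s \<zeta>)) + cmod (g (l k *s \<zeta>)))\<^sup>2"
          by (rule power_mono) simp
        also have "\<dots> \<le> 2 * (cmod (?h (l k *s \<zeta>)))\<^sup>2 + 2 * (cmod (g (l k *s \<zeta>)))\<^sup>2"
          using sum_squares_bound[of "cmod (?h (l k *s \<zeta>))" "cmod (g (l k *s \<zeta>))"] by (simp add: power2_sum)
        finally have "(cmod (K (F (r k)) (l k *s \<zeta>)))\<^sup>2 * W k
          \<le> (2 * (cmod (?h (l k *s \<zeta>)))\<^sup>2 + 2 * (cmod (g (l k *s \<zeta>)))\<^sup>2) * W k"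
          using W0 by (rule mult_right_mono)
        then show "(cmod (K (F (r k)) (l k *s \<zeta>)) * sqrt (W k))\<^sup>2
          \<le> 2 * (fnorm X ?h)\<^sup>2 + 2 * ((cmod (g (l k *s \<zeta>)))\<^sup>2 * W k)"
          using hb W0[of k] by (simp add: power_mult_distrib algebra_simps)
      qed
    qed simp
    from tendsto_real_sqrt[OF this] show ?thesis using W0 by (simp add: real_sqrt_mult)
  qed
  \<comment> \<open>The factor \<open>a\<close> carries \<open>sqrt (t powr \<beta> / q')\<close>,
    and \<open>sqrt (W k)\<close> splits into the root of \<open>t powr \<beta>\<close> and that of
    a convergent quotient. Together they produce exactly the scaling \<open>t powr \<beta>\<close>
    of hypothesis \<open>Tf\<close>.\<close>
  have Tl: "(\<lambda>k. cmod (T (F (r k)) (l k *s \<zeta>)) * sqrt (W k)) \<longlonglongrightarrow> cmod Q * sqrt (2 powr \<beta> / q')"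
  proof (rule Lim_transform_eventually)
    have "(\<lambda>k. (1 - (cmod (l k))\<^sup>2) / s (r k)) \<longlonglongrightarrow> 2"
      unfolding l_def by (rule filterlim_compose[OF ang_pt_defect sr])
    then have "(\<lambda>k. ((1 - (cmod (l k))\<^sup>2) / s (r k)) powr \<beta>) \<longlonglongrightarrow> 2 powr \<beta>"
      by (intro tendsto_powr tendsto_const) auto
    moreover have "(\<lambda>k. of_real (s (r k) powr \<beta>) * T (f (s (r k))) (l k *s \<zeta>)) \<longlonglongrightarrow> Q"
      unfolding l_def by (rule filterlim_compose[OF Tf sr])
    ultimately show "(\<lambda>k. cmod (of_real (s (r k) powr \<beta>) * T (f (s (r k))) (l k *s \<zeta>))
        * sqrt (((1 - (cmod (l k))\<^sup>2) / s (r k)) powr \<beta> / q')) \<longlonglongrightarrow> cmod Q * sqrt (2 powr \<beta> / q')"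
      by (intro tendsto_mult tendsto_norm tendsto_real_sqrt tendsto_divide tendsto_const) (use q' in auto)
    show "\<forall>\<^sub>F k in sequentially. cmod (of_real (s (r k) powr \<beta>) * T (f (s (r k))) (l k *s \<zeta>))
        * sqrt (((1 - (cmod (l k))\<^sup>2) / s (r k)) powr \<beta> / q') = cmod (T (F (r k)) (l k *s \<zeta>)) * sqrt (W k)"
    proof (intro always_eventually allI)
      fix k
      let ?t = "s (r k)"
      have t: "?t > 0" by (rule s(3))
      have "T (F (r k)) = (\<lambda>z. of_real (a (r k)) * T (f ?t) z)"
      proof -
        have "T (\<lambda>z. of_real (a (r k)) * f ?t z + 0 * f ?t z) = (\<lambda>z. of_real (a (r k)) * T (f ?t) z + 0 * T (f ?t) z)"
          using T s(1) unfolding linear_op_def by blast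
        then show ?thesis by (simp add: F_def)
      qed
      then have "cmod (T (F (r k)) (l k *s \<zeta>)) * sqrt (W k) = cmod (T (f ?t) (l k *s \<zeta>)) * (a (r k) * sqrt (W k))"
        using a0[of "r k"] by (simp add: norm_mult)
      moreover have "a (r k) * sqrt (W k) = ?t powr \<beta> * sqrt (((1 - (cmod (l k))\<^sup>2) / ?t) powr \<beta> / q')"
      proof -
        have W: "W k = ?t powr \<beta> * ((1 - (cmod (l k))\<^sup>2) / ?t) powr \<beta>"
          using t l[of k] by (simp add: W_def powr_divide abs_square_le_1 less_imp_le)
        have "a (r k) * sqrt (W k) = sqrt (?t powr \<beta> / q' * W k)"
          by (simp only: a_def real_sqrt_mult)
        also have "?t powr \<beta> / q' * W k = (?t powr \<beta>)\<^sup>2 * (((1 - (cmod (l k))\<^sup>2) / ?t) powr \<beta> / q')"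
          by (simp add: W power2_eq_square)
        also have "sqrt \<dots> = ?t powr \<beta> * sqrt (((1 - (cmod (l k))\<^sup>2) / ?t) powr \<beta> / q')"
          by (simp only: real_sqrt_mult real_sqrt_abs) simp
        finally show ?thesis .
      qed
      ultimately show "cmod (of_real (?t powr \<beta>) * T (f ?t) (l k *s \<zeta>)) * sqrt (((1 - (cmod (l k))\<^sup>2) / ?t) powr \<beta> / q')
        = cmod (T (F (r k)) (l k *s \<zeta>)) * sqrt (W k)"
        by (simp add: norm_mult)
    qed
  qed
  have "cmod Q * sqrt (2 powr \<beta> / q') - 0 \<le> N0"
  proof (rule LIMSEQ_le_const2[OF tendsto_diff[OF Tl K0]], intro exI allI impI)
    fix k
    have "cmod (T (F (r k)) (l k *s \<zeta>)) - cmod (K (F (r k)) (l k *s \<zeta>)) \<le> cmod (T (F (r k)) (l k *s \<zeta>) - K (F (r k)) (l k *s \<zeta>))"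
      by (rule norm_triangle_ineq2)
    then have "(cmod (T (F (r k)) (l k *s \<zeta>)) - cmod (K (F (r k)) (l k *s \<zeta>))) * sqrt (W k)
      \<le> cmod (T (F (r k)) (l k *s \<zeta>) - K (F (r k)) (l k *s \<zeta>)) * sqrt (W k)"
      by (rule mult_right_mono) (simp add: W0)
    then show "cmod (T (F (r k)) (l k *s \<zeta>)) * sqrt (W k) - cmod (K (F (r k)) (l k *s \<zeta>)) * sqrt (W k) \<le> N0"
      using TK[of k] by (simp add: left_diff_distrib)
  qed
  then have "(cmod Q * sqrt (2 powr \<beta> / q'))\<^sup>2 \<le> N0\<^sup>2" using q' by (intro power_mono) auto
  then show ?thesis using q' by (simp add: power_mult_distrib field_simps)
qed

section \<open>The lower bound\<close>

text \<open>What survives of the squared norm of the test function after rescaling. Pairs of indices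
  with different boundary points are absent because their kernels do not interact at this
  scale.\<close>

definition gram_limit :: "real \<Rightarrow> ('i \<Rightarrow> 'v) \<Rightarrow> ('i \<Rightarrow> real) \<Rightarrow> ('i \<Rightarrow> complex) \<Rightarrow> 'i set \<Rightarrow> real \<Rightarrow> complex"
  where "gram_limit \<beta> \<eta> d \<alpha> I M =
    (\<Sum>p\<in>I. \<Sum>i\<in>{i \<in> I. \<eta> i = \<eta> p}. \<alpha> i * cnj (\<alpha> p) * pair_val \<beta> M (d i) (d p))"

text \<open>On the diagonal the base is \<open>2 * d p\<close>, free of \<open>M\<close>. Off the
  diagonal its imaginary part has modulus \<open>|d p - d i| * M\<close> for \<open>M > 0\<close>,
  nonzero by injectivity, and the negative power tends to 0.\<close>

lemma gram_limit_at_top: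
  assumes I: "finite I" and \<beta>: "\<beta> > 0" and d: "\<And>i. i \<in> I \<Longrightarrow> d i > 0"
    and inj: "\<And>i j. i \<in> I \<Longrightarrow> j \<in> I \<Longrightarrow> \<eta> i = \<eta> j \<Longrightarrow> d i = d j \<Longrightarrow> i = j"
  shows "((\<lambda>M. gram_limit \<beta> \<eta> d \<alpha> I M) \<longlongrightarrow> of_real (\<Sum>p\<in>I. (cmod (\<alpha> p))\<^sup>2 * (2 * d p) powr (- \<beta>))) at_top"
proof -
  have lim: "((\<lambda>M. pair_val \<beta> M (d i) (d p)) \<longlongrightarrow> (if i = p then of_real ((2 * d p) powr (- \<beta>)) else 0)) at_top"
    if i: "i \<in> I" and p: "p \<in> I" and \<eta>: "\<eta> i = \<eta> p" for i p
  proof (cases "i = p")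
    case True
    have "pair_val \<beta> M (d p) (d p) = of_real ((2 * d p) powr (- \<beta>))" for M
    proof -
      have "complex_of_real (d p) * (1 - \<i> * of_real M) + of_real (d p) * (1 + \<i> * of_real M) = of_real (2 * d p)"
        by (simp add: algebra_simps)
      then show ?thesis
        using powr_of_real[of "2 * d p" "- \<beta>"] d[OF p] by (simp add: pair_val_def)
    qed
    then show ?thesis using True by simp
  next
    case False
    then have dne: "d i \<noteq> d p" using inj[OF i p \<eta>] by auto
    define c where "c = \<bar>d p - d i\<bar>"
    have c: "c > 0" using dne by (simp add: c_def)
    have "((\<lambda>M. pair_val \<beta> M (d i) (d p)) \<longlongrightarrow> 0) at_top"
    proof (rule Lim_null_comparison)
      have "filterlim (\<lambda>M. c * M) at_top at_top"
        by (rule filterlim_tendsto_pos_mult_at_top[OF tendsto_const c filterlim_ident])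
      then show "((\<lambda>M. (c * M) powr (- \<beta>)) \<longlongrightarrow> 0) at_top"
        using \<beta> by (intro tendsto_neg_powr) auto
      show "\<forall>\<^sub>F M in at_top. norm (pair_val \<beta> M (d i) (d p)) \<le> (c * M) powr (- \<beta>)"
        using eventually_gt_at_top[of 0]
      proof eventually_elim
        case (elim M)
        let ?w = "complex_of_real (d i) * (1 - \<i> * of_real M) + of_real (d p) * (1 + \<i> * of_real M)"
        have "Im ?w = (d p - d i) * M" by (simp add: algebra_simps)
        then have "c * M = \<bar>Im ?w\<bar>" using elim by (simp add: c_def abs_mult)
        also have "\<dots> \<le> cmod ?w" by (rule abs_Im_le_cmod)
        finally show ?case
          unfolding pair_val_def cmod_powr_real using \<beta> c elim by (intro powr_mono2') auto
      qed
    qed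
    then show ?thesis using False by simp
  qed
  have "((\<lambda>M. gram_limit \<beta> \<eta> d \<alpha> I M) \<longlongrightarrow>
    (\<Sum>p\<in>I. \<Sum>i\<in>{i \<in> I. \<eta> i = \<eta> p}. \<alpha> i * cnj (\<alpha> p) * (if i = p then of_real ((2 * d p) powr (- \<beta>)) else 0))) at_top"
    unfolding gram_limit_def by (intro tendsto_sum tendsto_mult tendsto_const lim) auto
  also have "(\<Sum>p\<in>I. \<Sum>i\<in>{i \<in> I. \<eta> i = \<eta> p}. \<alpha> i * cnj (\<alpha> p) * (if i = p then of_real ((2 * d p) powr (- \<beta>)) else 0))
    = of_real (\<Sum>p\<in>I. (cmod (\<alpha> p))\<^sup>2 * (2 * d p) powr (- \<beta>))"
  proof -
    have "(\<Sum>i\<in>{i \<in> I. \<eta> i = \<eta> p}. \<alpha> i * cnj (\<alpha> p) * (if i = p then of_real ((2 * d p) powr (- \<beta>)) else 0))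
      = of_real ((cmod (\<alpha> p))\<^sup>2 * (2 * d p) powr (- \<beta>))" if p: "p \<in> I" for p
    proof -
      have "(\<Sum>i\<in>{i \<in> I. \<eta> i = \<eta> p}. \<alpha> i * cnj (\<alpha> p) * (if i = p then of_real ((2 * d p) powr (- \<beta>)) else 0))
        = (\<Sum>i\<in>{i \<in> I. \<eta> i = \<eta> p}. if i = p then \<alpha> p * cnj (\<alpha> p) * of_real ((2 * d p) powr (- \<beta>)) else 0)"
        by (intro sum.cong) auto
      also have "\<dots> = \<alpha> p * cnj (\<alpha> p) * of_real ((2 * d p) powr (- \<beta>))"
        using I p by (subst sum.delta) auto
      finally show ?thesis by (simp only: of_real_mult complex_norm_square)
    qed
    then show ?thesis by (simp only: of_real_sum) (rule sum.cong, auto)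
  qed
  finally show ?thesis .
qed

lemma comp_op_sum_linear:
  fixes \<phi> :: "nat \<Rightarrow> complex ^ 'n \<Rightarrow> complex ^ 'n"
  assumes X: "admissible X" and b: "\<And>j. j \<in> {1..m} \<Longrightarrow> bounded_op X (comp_op (\<phi> j))"
  shows "linear_op X (\<lambda>f z. \<Sum>j=1..m. c j * comp_op (\<phi> j) f z)"
  unfolding linear_op_def
proof (intro conjI ballI allI)
  fix f :: "complex ^ 'n \<Rightarrow> complex" assume f: "f \<in> carrier_of X"
  show "(\<lambda>z. \<Sum>j=1..m. c j * comp_op (\<phi> j) f z) \<in> carrier_of X"
    using sum_carrier[OF X finite_atLeastAtMost, of 1 m "\<lambda>j. comp_op (\<phi> j) f" c] b f
    by (simp add: bounded_op_def linear_op_def)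
next
  fix f g :: "complex ^ 'n \<Rightarrow> complex" and a b :: complex
  show "(\<lambda>z. \<Sum>j=1..m. c j * comp_op (\<phi> j) (\<lambda>z. a * f z + b * g z) z) =
    (\<lambda>z. a * (\<Sum>j=1..m. c j * comp_op (\<phi> j) f z) + b * (\<Sum>j=1..m. c j * comp_op (\<phi> j) g z))"
  proof (rule ext)
    fix z
    have "comp_op (\<phi> j) (\<lambda>z. a * f z + b * g z) z = a * comp_op (\<phi> j) f z + b * comp_op (\<phi> j) g z" for j
      by (simp add: comp_op_def)
    then show "(\<Sum>j=1..m. c j * comp_op (\<phi> j) (\<lambda>z. a * f z + b * g z) z) =
      a * (\<Sum>j=1..m. c j * comp_op (\<phi> j) f z) + b * (\<Sum>j=1..m. c j * comp_op (\<phi> j) g z)"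
      by (simp add: sum_distrib_left sum.distrib algebra_simps)
  qed
qed

text \<open>A real supremum bounds its members only if the set is bounded above. The bounds on the
  composition operators and on \<open>K\<close> provide this.\<close>

lemma bounded_compact_difference:
  fixes \<phi> :: "nat \<Rightarrow> complex ^ 'n \<Rightarrow> complex ^ 'n" and c :: "nat \<Rightarrow> complex"
  assumes X: "admissible X" and b: "\<And>j. j \<in> {1..m} \<Longrightarrow> bounded_op X (comp_op (\<phi> j))" and K: "compact_op X K"
  defines "T \<equiv> \<lambda>f z. \<Sum>j=1..m. c j * comp_op (\<phi> j) f z"
  shows "g \<in> carrier_of X \<Longrightarrow> fnorm X g \<le> 1 \<Longrightarrow> fnorm X (\<lambda>z. T g z - K g z) \<le> op_norm X (\<lambda>f z. T f z - K f z)"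
    and "0 \<le> op_norm X (\<lambda>f z. T f z - K f z)"
proof -
  let ?U = "{f \<in> carrier_of X. fnorm X f \<le> 1}"
  have T: "linear_op X T" unfolding T_def by (rule comp_op_sum_linear[OF X b])
  have "\<exists>B. \<forall>f\<in>?U. fnorm X (T f) \<le> B"
    unfolding T_def
  proof (rule fnorm_sum_bounded[OF X finite_atLeastAtMost])
    fix j assume "j \<in> {1..m}"
    then have bj: "bounded_op X (comp_op (\<phi> j))" by (rule b)
    then obtain C where C: "\<And>f. f \<in> carrier_of X \<Longrightarrow> fnorm X (comp_op (\<phi> j) f) \<le> C * fnorm X f"
      unfolding bounded_op_def by blast
    have "fnorm X (comp_op (\<phi> j) f) \<le> \<bar>C\<bar>" if "f \<in> ?U" for f
    proof -
      have "fnorm X (comp_op (\<phi> j) f) \<le> C * fnorm X f" using C that by blast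
      also have "\<dots> \<le> \<bar>C\<bar> * 1" using that by (intro mult_mono) auto
      finally show ?thesis by simp
    qed
    then show "\<exists>B. \<forall>f\<in>?U. fnorm X (comp_op (\<phi> j) f) \<le> B" by blast
    show "comp_op (\<phi> j) f \<in> carrier_of X" if "f \<in> ?U" for f
      using bj that by (simp add: bounded_op_def linear_op_def)
  qed
  then obtain B1 where B1: "\<And>f. f \<in> ?U \<Longrightarrow> fnorm X (T f) \<le> B1" by blast
  obtain B2 where B2: "\<And>f. f \<in> ?U \<Longrightarrow> fnorm X (K f) \<le> B2" using compact_op_bounded[OF X K] by blast
  have "fnorm X (\<lambda>z. T f z - K f z) \<le> sqrt (2 * B1\<^sup>2 + 2 * B2\<^sup>2)" if f: "f \<in> ?U" for f
  proof (rule real_le_rsqrt)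
    have Tf: "T f \<in> carrier_of X" and Kf: "K f \<in> carrier_of X"
      using T K f by (auto simp: linear_op_def compact_op_def)
    have "(fnorm X (\<lambda>z. T f z - K f z))\<^sup>2 \<le> 2 * (fnorm X (T f))\<^sup>2 + 2 * (fnorm X (K f))\<^sup>2"
      using lincomb_carrier(2)[OF X Tf Kf, of 1 "-1"] by simp
    also have "\<dots> \<le> 2 * B1\<^sup>2 + 2 * B2\<^sup>2"
      using B1[OF f] B2[OF f] by (intro add_mono mult_left_mono power_mono) auto
    finally show "(fnorm X (\<lambda>z. T f z - K f z))\<^sup>2 \<le> 2 * B1\<^sup>2 + 2 * B2\<^sup>2" .
  qed
  then have bdd: "bdd_above ((\<lambda>f. fnorm X (\<lambda>z. T f z - K f z)) ` ?U)"
    by (intro bdd_aboveI2)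
  have up: "fnorm X (\<lambda>z. T g z - K g z) \<le> op_norm X (\<lambda>f z. T f z - K f z)" if "g \<in> ?U" for g
    unfolding op_norm_def by (rule cSUP_upper[OF that bdd])
  then show "g \<in> carrier_of X \<Longrightarrow> fnorm X g \<le> 1 \<Longrightarrow> fnorm X (\<lambda>z. T g z - K g z) \<le> op_norm X (\<lambda>f z. T f z - K f z)"
    by simp
  show "0 \<le> op_norm X (\<lambda>f z. T f z - K f z)"
    by (rule order_trans[OF fnorm_nonneg up[of "\<lambda>z. 0"]]) (simp add: zero_in_carrier fnorm_zero)
qed

text \<open>The estimate of \<open>test_fun_carrier\<close> is multiplied by
  \<open>t powr \<beta>\<close> and used with \<open>\<tau> = t powr (\<beta> / 2)\<close>. Both
  \<open>\<tau>\<close> and \<open>t powr \<beta> / \<tau>\<close> tend to 0, so the factor in front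
  of the Gram forms becomes 1 while the error term vanishes.\<close>

lemma test_fun_norm_limit:
  fixes \<eta> :: "'i \<Rightarrow> complex ^ 'n"
  assumes X: "admissible X" and I: "finite I" and \<eta>: "\<And>i. i \<in> I \<Longrightarrow> norm (\<eta> i) = 1" and d: "\<And>i. i \<in> I \<Longrightarrow> d i > 0"
  defines "\<beta> \<equiv> kernel_exponent X CARD('n)"
  obtains B where "\<forall>\<^sub>F t in at_right 0. test_fun \<beta> I \<alpha> (\<lambda>i. ang_pt M (d i * t)) \<eta> \<in> carrier_of X
      \<and> t powr \<beta> * (fnorm X (test_fun \<beta> I \<alpha> (\<lambda>i. ang_pt M (d i * t)) \<eta>))\<^sup>2 \<le> B t"
    "(B \<longlongrightarrow> Re (gram_limit \<beta> \<eta> d \<alpha> I M)) (at_right 0)"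
proof -
  have \<beta>: "\<beta> > 0" unfolding \<beta>_def by (rule kernel_exponent_pos[OF X])
  obtain \<delta> where \<delta>: "0 < \<delta>" "\<And>e e'. e \<in> \<eta> ` I \<Longrightarrow> e' \<in> \<eta> ` I \<Longrightarrow> e \<noteq> e' \<Longrightarrow> 8 * \<delta> \<le> (norm (e - e'))\<^sup>2"
    using separation_exists[of "\<eta> ` I"] I by blast
  define l where "l t i = ang_pt M (d i * t)" for t i
  define J where "J e = {i \<in> I. \<eta> i = e}" for e
  define C where "C = (card (\<eta> ` I) * (\<Sum>i\<in>I. cmod (\<alpha> i) * (\<delta> / 2) powr (- \<beta>)))\<^sup>2"
  define B where "B t = (1 + t powr (\<beta> / 2)) * (\<Sum>e\<in>\<eta> ` I. Re (of_real (t powr \<beta>) * kernel_gram \<beta> (J e) \<alpha> (l t)))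
    + (t powr \<beta> + t powr (\<beta> / 2)) * C" for t
  have "\<forall>\<^sub>F t in at_right 0. \<forall>i\<in>I. cmod (ang_pt M (d i * t)) < 1"
    using I d by (intro eventually_ball_finite eventually_ang_pt ballI) auto
  moreover have "\<forall>\<^sub>F t in at_right 0. \<forall>i\<in>I. cmod (1 - ang_pt M (d i * t)) < \<delta> / 2"
  proof (intro eventually_ball_finite[OF I] ballI)
    fix i
    have "((\<lambda>t. cmod (1 - ang_pt M (d i * t))) \<longlongrightarrow> cmod (1 - 1)) (at_right 0)"
      by (intro tendsto_intros ang_pt_tendsto)
    then show "\<forall>\<^sub>F t in at_right 0. cmod (1 - ang_pt M (d i * t)) < \<delta> / 2"
      using \<delta>(1) by (intro order_tendstoD(2)) auto
  qed
  ultimately have ev: "\<forall>\<^sub>F t in at_right 0. test_fun \<beta> I \<alpha> (l t) \<eta> \<in> carrier_of X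
      \<and> t powr \<beta> * (fnorm X (test_fun \<beta> I \<alpha> (l t) \<eta>))\<^sup>2 \<le> B t"
    using eventually_at_right_less[of "0::real"]
  proof eventually_elim
    case (elim t)
    let ?\<tau> = "t powr (\<beta> / 2)"
    have \<tau>: "?\<tau> > 0" using elim by simp
    have l: "\<And>i. i \<in> I \<Longrightarrow> cmod (l t i) < 1" "\<And>i. i \<in> I \<Longrightarrow> cmod (1 - l t i) \<le> \<delta> / 2"
      using elim by (auto simp: l_def less_imp_le)
    note tf = test_fun_carrier[OF X I \<eta> l \<delta> \<tau>, where \<alpha>=\<alpha>, folded \<beta>_def]
    have "t powr \<beta> * (fnorm X (test_fun \<beta> I \<alpha> (l t) \<eta>))\<^sup>2
      \<le> t powr \<beta> * ((1 + ?\<tau>) * (\<Sum>e\<in>\<eta> ` I. Re (kernel_gram \<beta> (J e) \<alpha> (l t))) + (1 + 1 / ?\<tau>) * C)"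
      unfolding C_def J_def by (rule mult_left_mono[OF tf(2)]) simp_all
    also have "\<dots> = (1 + ?\<tau>) * (\<Sum>e\<in>\<eta> ` I. t powr \<beta> * Re (kernel_gram \<beta> (J e) \<alpha> (l t))) + (t powr \<beta> + t powr \<beta> / ?\<tau>) * C"
      by (simp add: sum_distrib_left algebra_simps)
    also have "t powr \<beta> / ?\<tau> = ?\<tau>" using elim by (simp add: powr_diff[symmetric])
    finally show ?case using tf(1) by (simp add: B_def)
  qed
  have "((\<lambda>t. t powr (\<beta> / 2)) \<longlongrightarrow> 0) (at_right 0)" by (rule powr_at_right_0) (use \<beta> in simp)
  then have "(B \<longlongrightarrow> (1 + 0) * (\<Sum>e\<in>\<eta> ` I. Re (\<Sum>i\<in>J e. \<Sum>j\<in>J e. \<alpha> i * cnj (\<alpha> j) * pair_val \<beta> M (d i) (d j))) + (0 + 0) * C) (at_right 0)"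
    unfolding B_def[abs_def] l_def
    by (intro tendsto_add tendsto_mult tendsto_sum tendsto_Re tendsto_const kernel_gram_limit powr_at_right_0)
      (auto simp: J_def d \<beta>)
  also have "(1 + 0) * (\<Sum>e\<in>\<eta> ` I. Re (\<Sum>i\<in>J e. \<Sum>j\<in>J e. \<alpha> i * cnj (\<alpha> j) * pair_val \<beta> M (d i) (d j))) + (0 + 0) * C
    = Re (gram_limit \<beta> \<eta> d \<alpha> I M)"
  proof -
    have "gram_limit \<beta> \<eta> d \<alpha> I M = (\<Sum>e\<in>\<eta> ` I. \<Sum>j\<in>J e. \<Sum>i\<in>{i \<in> I. \<eta> i = \<eta> j}. \<alpha> i * cnj (\<alpha> j) * pair_val \<beta> M (d i) (d j))"
      unfolding gram_limit_def J_def by (rule sum.image_gen[OF I])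
    also have "\<dots> = (\<Sum>e\<in>\<eta> ` I. \<Sum>j\<in>J e. \<Sum>i\<in>J e. \<alpha> i * cnj (\<alpha> j) * pair_val \<beta> M (d i) (d j))"
      by (intro sum.cong refl) (auto simp: J_def)
    also have "\<dots> = (\<Sum>e\<in>\<eta> ` I. \<Sum>i\<in>J e. \<Sum>j\<in>J e. \<alpha> i * cnj (\<alpha> j) * pair_val \<beta> M (d i) (d j))"
      by (intro sum.cong refl sum.swap)
    finally show ?thesis by simp
  qed
  finally show ?thesis using ev that[of B] by (simp add: l_def[abs_def])
qed

theorem theorem2p3:
  fixes X :: fspace
    and m :: nat
    and \<phi> :: "nat \<Rightarrow> complex ^ 'n \<Rightarrow> complex ^ 'n"
    and c :: "nat \<Rightarrow> complex"
    and \<zeta> :: "complex ^ 'n"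
  assumes "admissible X"
    and "\<And>j. j \<in> {1..m} \<Longrightarrow> analytic_self_map (\<phi> j)"
    and "\<And>j. j \<in> {1..m} \<Longrightarrow> bounded_op X (comp_op (\<phi> j))"
    and "\<zeta> \<in> sphere 0 1"
  shows "(ess_norm X (\<lambda>f z. \<Sum>j=1..m. c j * comp_op (\<phi> j) f z))\<^sup>2 \<ge>
    (\<Sum>(\<eta>, d)\<in>boundary_data m \<phi> \<zeta>.
       (cmod (\<Sum>l\<in>{l \<in> {1..m}. radial_lim (\<phi> l) \<zeta> = \<eta> \<and> ang_dilation (\<phi> l) \<zeta> = d}. c l))\<^sup>2
         * (1 / real_of_ereal d powr kernel_exponent X CARD('n)))"
proof -
  note X = assms(1) and \<phi> = assms(2) and bd = assms(3)
  have \<zeta>: "norm \<zeta> = 1" using assms(4) by simp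
  define \<beta> where "\<beta> = kernel_exponent X CARD('n)"
  have \<beta>: "\<beta> > 0" unfolding \<beta>_def by (rule kernel_exponent_pos[OF X])
  define T where "T = (\<lambda>f z. \<Sum>j=1..m. c j * comp_op (\<phi> j) f z)"
  \<comment> \<open>Maps with the same first-order data form one fibre of \<open>D\<close>. Sums
    over the indices are regrouped over the image \<open>I\<close>, in which each pair occurs
    once.\<close>
  define D where "D j = (radial_lim (\<phi> j) \<zeta>, ang_dilation (\<phi> j) \<zeta>)" for j
  define F where "F = {j \<in> {1..m}. ang_dilation (\<phi> j) \<zeta> < \<infinity>}"
  define I where "I = boundary_data m \<phi> \<zeta>"
  have I_eq: "I = D ` F" by (simp add: I_def boundary_data_def D_def F_def)
  have F: "finite F" by (simp add: F_def)
  have I: "finite I" by (simp add: I_eq F)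
  define dd :: "(complex ^ 'n) \<times> ereal \<Rightarrow> real" where "dd p = real_of_ereal (snd p)" for p
  define A where "A p = (\<Sum>l\<in>{l \<in> {1..m}. D l = p}. c l)" for p
  have jc: "\<exists>d. ang_dilation (\<phi> j) \<zeta> = ereal d \<and> d > 0 \<and> norm (radial_lim (\<phi> j) \<zeta>) = 1 \<and>
    (\<forall>M. ((\<lambda>t. (1 - cip (\<phi> j (ang_pt M t *s \<zeta>)) (radial_lim (\<phi> j) \<zeta>)) / of_real t)
      \<longlongrightarrow> of_real d * (1 + \<i> * of_real M)) (at_right 0))" if "j \<in> F" for j
  proof -
    have "j \<in> {1..m}" "ang_dilation (\<phi> j) \<zeta> < \<infinity>" using that by (simp_all add: F_def)
    show ?thesis
    proof (rule julia_caratheodory[OF \<phi>[OF \<open>j \<in> {1..m}\<close>] \<zeta> \<open>ang_dilation (\<phi> j) \<zeta> < \<infinity>\<close>])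
      fix d
      assume "ang_dilation (\<phi> j) \<zeta> = ereal d" "d > 0" "norm (radial_lim (\<phi> j) \<zeta>) = 1"
        "\<And>M. ((\<lambda>t. (1 - cip (\<phi> j ((1 - of_real t * (1 + \<i> * of_real M)) *s \<zeta>)) (radial_lim (\<phi> j) \<zeta>)) / of_real t)
          \<longlongrightarrow> of_real d * (1 + \<i> * of_real M)) (at_right 0)"
      then show ?thesis unfolding ang_pt_def by (intro exI[of _ d] conjI allI)
    qed
  qed
  have Ip: "norm (fst p) = 1 \<and> dd p > 0 \<and> snd p = ereal (dd p)" if p: "p \<in> I" for p
  proof -
    obtain j where j: "j \<in> F" "p = D j" using p by (auto simp: I_eq)
    obtain d where "ang_dilation (\<phi> j) \<zeta> = ereal d" "d > 0" "norm (radial_lim (\<phi> j) \<zeta>) = 1"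
      using jc[OF j(1)] by blast
    then show ?thesis by (simp add: j D_def dd_def)
  qed
  have fib: "{l \<in> {1..m}. D l = p} = {l \<in> F. D l = p}" if "p \<in> I" for p
    using that by (auto simp: I_eq D_def F_def)
  define R where "R = (\<Sum>p\<in>I. (cmod (A p))\<^sup>2 * (1 / dd p powr \<beta>))"
  have R_eq: "(\<Sum>(\<eta>, d)\<in>boundary_data m \<phi> \<zeta>.
       (cmod (\<Sum>l\<in>{l \<in> {1..m}. radial_lim (\<phi> l) \<zeta> = \<eta> \<and> ang_dilation (\<phi> l) \<zeta> = d}. c l))\<^sup>2
         * (1 / real_of_ereal d powr kernel_exponent X CARD('n))) = R"
    unfolding R_def I_def[symmetric] \<beta>_def[symmetric]
    by (intro sum.cong refl) (auto simp: A_def D_def dd_def prod_eq_iff)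
  \<comment> \<open>With these conjugates the limit of the point values, the sum of
    \<open>A p * v p\<close>, is the Gram form itself, so the same \<open>Q\<close> governs the
    value and the squared norm.\<close>
  define \<alpha> where "\<alpha> p = cnj (A p)" for p
  have lower: "R \<le> (op_norm X (\<lambda>f z. T f z - K f z))\<^sup>2" if K: "compact_op X K" for K
  proof -
    define N0 where "N0 = op_norm X (\<lambda>f z. T f z - K f z)"
    have TL: "linear_op X T" unfolding T_def by (rule comp_op_sum_linear[OF X bd])
    have op: "fnorm X (\<lambda>z. T g z - K g z) \<le> N0" if "g \<in> carrier_of X" "fnorm X g \<le> 1" for g
      unfolding N0_def T_def by (rule bounded_compact_difference(1)[OF X bd K that])
    have bound: "2 powr \<beta> * Re (gram_limit \<beta> fst dd \<alpha> I M) \<le> N0\<^sup>2" for M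
    proof -
      define Q where "Q = gram_limit \<beta> fst dd \<alpha> I M"
      define f where "f t = test_fun \<beta> I \<alpha> (\<lambda>p. ang_pt M (dd p * t)) fst" for t
      obtain B where B: "\<forall>\<^sub>F t in at_right 0. f t \<in> carrier_of X \<and> t powr \<beta> * (fnorm X (f t))\<^sup>2 \<le> B t"
        "(B \<longlongrightarrow> Re Q) (at_right 0)"
        using test_fun_norm_limit[OF X I, of fst dd \<alpha> M] Ip unfolding f_def Q_def \<beta>_def by blast
      have evb: "\<forall>\<^sub>F t in at_right 0. norm (\<phi> j (ang_pt M t *s \<zeta>)) < 1" if j: "j \<in> {1..m}" for j
        using eventually_ang_pt[of 1 M, simplified]
      proof eventually_elim
        case (elim t)
        then have "ang_pt M t *s \<zeta> \<in> unit_ball" using \<zeta> by (simp add: norm_smult)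
        then show ?case using \<phi>[OF j] by (force simp: analytic_self_map_def)
      qed
      \<comment> \<open>The limit of the rescaled test function along a map with data
        \<open>p\<close>: only the kernels at the boundary point \<open>fst p\<close>
        remain.\<close>
      define v where "v p = (\<Sum>i\<in>{i \<in> I. fst i = fst p}. \<alpha> i * pair_val \<beta> M (dd i) (dd p))" for p
      have Tj: "((\<lambda>t. of_real (t powr \<beta>) * f t (\<phi> j (ang_pt M t *s \<zeta>))) \<longlongrightarrow> (if j \<in> F then v (D j) else 0)) (at_right 0)"
        if j: "j \<in> {1..m}" for j
      proof -
        have "((\<lambda>t. of_real (t powr \<beta>) * (1 - cnj (ang_pt M (dd i * t)) * cip (\<phi> j (ang_pt M t *s \<zeta>)) (fst i)) powr (- of_real \<beta>))
          \<longlongrightarrow> (if j \<in> F \<and> fst i = fst (D j) then pair_val \<beta> M (dd i) (dd (D j)) else 0)) (at_right 0)" if i: "i \<in> I" for i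
        proof (cases "j \<in> F")
          case True
          then have p: "D j \<in> I" by (simp add: I_eq)
          have "((\<lambda>t. (1 - cip (\<phi> j (ang_pt M t *s \<zeta>)) (fst (D j))) / of_real t)
            \<longlongrightarrow> of_real (dd (D j)) * (1 + \<i> * of_real M)) (at_right 0)"
            using jc[OF True] by (auto simp: D_def dd_def)
          from kernel_eval_limit[OF \<beta> evb[OF j] this] Ip[OF p] Ip[OF i] True
          show ?thesis by simp
        next
          case False
          then have "\<not> ang_dilation (\<phi> j) \<zeta> < \<infinity>" using j by (simp add: F_def)
          from kernel_eval_limit_infinite[OF \<beta> evb[OF j] infinite_dilation_limit[OF \<phi>[OF j] \<zeta> this]] Ip[OF i] False
          show ?thesis by simp
        qed
        then have "((\<lambda>t. \<Sum>i\<in>I. \<alpha> i * (of_real (t powr \<beta>) * (1 - cnj (ang_pt M (dd i * t)) * cip (\<phi> j (ang_pt M t *s \<zeta>)) (fst i)) powr (- of_real \<beta>)))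
          \<longlongrightarrow> (\<Sum>i\<in>I. \<alpha> i * (if j \<in> F \<and> fst i = fst (D j) then pair_val \<beta> M (dd i) (dd (D j)) else 0))) (at_right 0)"
          by (intro tendsto_sum tendsto_mult tendsto_const) auto
        moreover have "(\<Sum>i\<in>I. \<alpha> i * (if j \<in> F \<and> fst i = fst (D j) then pair_val \<beta> M (dd i) (dd (D j)) else 0)) = (if j \<in> F then v (D j) else 0)"
        proof (cases "j \<in> F")
          case True
          have "(\<Sum>i\<in>I. \<alpha> i * (if j \<in> F \<and> fst i = fst (D j) then pair_val \<beta> M (dd i) (dd (D j)) else 0))
            = (\<Sum>i\<in>I. if fst i = fst (D j) then \<alpha> i * pair_val \<beta> M (dd i) (dd (D j)) else 0)"
            using True by (intro sum.cong) auto
          then show ?thesis using True unfolding v_def by (simp only: sum.inter_filter[OF I] if_True)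
        qed simp
        ultimately have "((\<lambda>t. \<Sum>i\<in>I. \<alpha> i * (of_real (t powr \<beta>) * (1 - cnj (ang_pt M (dd i * t)) * cip (\<phi> j (ang_pt M t *s \<zeta>)) (fst i)) powr (- of_real \<beta>)))
          \<longlongrightarrow> (if j \<in> F then v (D j) else 0)) (at_right 0)" by simp
        then show ?thesis
        proof (rule Lim_transform_eventually)
          show "\<forall>\<^sub>F t in at_right 0. (\<Sum>i\<in>I. \<alpha> i * (of_real (t powr \<beta>) * (1 - cnj (ang_pt M (dd i * t)) * cip (\<phi> j (ang_pt M t *s \<zeta>)) (fst i)) powr (- of_real \<beta>)))
            = of_real (t powr \<beta>) * f t (\<phi> j (ang_pt M t *s \<zeta>))"
            using evb[OF j]
            by eventually_elim (simp add: f_def test_fun_def sum_distrib_left mult.left_commute)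
        qed
      qed
      have "((\<lambda>t. \<Sum>j=1..m. c j * (of_real (t powr \<beta>) * f t (\<phi> j (ang_pt M t *s \<zeta>))))
        \<longlongrightarrow> (\<Sum>j=1..m. c j * (if j \<in> F then v (D j) else 0))) (at_right 0)"
        by (intro tendsto_sum tendsto_mult tendsto_const Tj)
      moreover have "(\<Sum>j=1..m. c j * (if j \<in> F then v (D j) else 0)) = Q"
      proof -
        have "(\<Sum>j=1..m. c j * (if j \<in> F then v (D j) else 0)) = (\<Sum>j\<in>F. c j * v (D j))"
          by (rule sum.mono_neutral_cong_right) (auto simp: F_def)
        also have "\<dots> = (\<Sum>p\<in>I. \<Sum>j\<in>{j \<in> F. D j = p}. c j * v (D j))"
          unfolding I_eq by (rule sum.image_gen[OF F])
        also have "\<dots> = (\<Sum>p\<in>I. A p * v p)"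
        proof (rule sum.cong[OF refl])
          fix p assume p: "p \<in> I"
          have "A p = (\<Sum>j\<in>{j \<in> F. D j = p}. c j)" by (simp only: A_def fib[OF p])
          then show "(\<Sum>j\<in>{j \<in> F. D j = p}. c j * v (D j)) = A p * v p"
            by (simp add: sum_distrib_right)
        qed
        also have "\<dots> = Q"
          by (simp add: Q_def gram_limit_def v_def \<alpha>_def sum_distrib_left mult_ac)
        finally show ?thesis .
      qed
      ultimately have lim: "((\<lambda>t. \<Sum>j=1..m. c j * (of_real (t powr \<beta>) * f t (\<phi> j (ang_pt M t *s \<zeta>)))) \<longlongrightarrow> Q) (at_right 0)"
        by simp
      have Tf: "((\<lambda>t. of_real (t powr \<beta>) * T (f t) (ang_pt M t *s \<zeta>)) \<longlongrightarrow> Q) (at_right 0)"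
        using lim
      proof (rule Lim_transform_eventually)
        show "\<forall>\<^sub>F t in at_right 0. (\<Sum>j=1..m. c j * (of_real (t powr \<beta>) * f t (\<phi> j (ang_pt M t *s \<zeta>))))
          = of_real (t powr \<beta>) * T (f t) (ang_pt M t *s \<zeta>)"
          using eventually_ang_pt[of 1 M, simplified]
          by eventually_elim (simp add: T_def comp_op_def norm_smult \<zeta> sum_distrib_left mult.left_commute)
      qed
      \<comment> \<open>The perturbation bound is quadratic in \<open>Q\<close> on the left and
        linear in \<open>q'\<close> on the right. For positive \<open>Re Q\<close> the number
        \<open>q'\<close> decreases to \<open>Re Q\<close> and one factor \<open>Re Q\<close>
        cancels; otherwise the claim follows from \<open>0 \<le> N0^2\<close>.\<close>
      show ?thesis
      proof (cases "Re Q > 0")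
        case False
        then have "2 powr \<beta> * Re Q \<le> 0" by (simp add: mult_le_0_iff)
        then show ?thesis by (simp add: Q_def order_trans)
      next
        case True
        have le: "(Re Q)\<^sup>2 * 2 powr \<beta> \<le> N0\<^sup>2 * q'" if q': "q' > Re Q" for q'
        proof -
          have "(cmod Q)\<^sup>2 * 2 powr \<beta> \<le> N0\<^sup>2 * q'"
            using compact_perturbation_bound[OF X K TL op \<zeta> B(1)[unfolded \<beta>_def] B(2) Tf[unfolded \<beta>_def] q'] True q'
            by (simp add: \<beta>_def)
          moreover have "(Re Q)\<^sup>2 * 2 powr \<beta> \<le> (cmod Q)\<^sup>2 * 2 powr \<beta>"
            using abs_Re_le_cmod[of Q] by (intro mult_right_mono) (auto simp: abs_le_square_iff[symmetric])
          ultimately show ?thesis by linarith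
        qed
        have "((\<lambda>q'. N0\<^sup>2 * q') \<longlongrightarrow> N0\<^sup>2 * Re Q) (at_right (Re Q))" by (intro tendsto_intros)
        moreover have "\<forall>\<^sub>F q' in at_right (Re Q). (Re Q)\<^sup>2 * 2 powr \<beta> \<le> N0\<^sup>2 * q'"
          using eventually_at_right_less[of "Re Q"] by eventually_elim (rule le)
        ultimately have "(Re Q)\<^sup>2 * 2 powr \<beta> \<le> N0\<^sup>2 * Re Q"
          by (rule tendsto_lowerbound) simp
        then have "Re Q * (2 powr \<beta> * Re Q) \<le> Re Q * N0\<^sup>2" by (simp add: power2_eq_square mult_ac)
        then show ?thesis using True by (simp add: Q_def)
      qed
    qed
    \<comment> \<open>Finite dilations are determined by their real values, so distinct pairs over
      one boundary point have distinct \<open>dd\<close>.\<close>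
    have inj: "i = j" if "i \<in> I" "j \<in> I" "fst i = fst j" "dd i = dd j" for i j
      using Ip[OF that(1)] Ip[OF that(2)] that by (simp add: prod_eq_iff)
    have "((\<lambda>M. gram_limit \<beta> fst dd \<alpha> I M) \<longlongrightarrow> of_real (\<Sum>p\<in>I. (cmod (\<alpha> p))\<^sup>2 * (2 * dd p) powr (- \<beta>))) at_top"
      by (rule gram_limit_at_top[OF I \<beta>]) (use Ip inj in auto)
    from tendsto_mult[OF tendsto_const[of "2 powr \<beta>"] tendsto_Re[OF this]]
    have "((\<lambda>M. 2 powr \<beta> * Re (gram_limit \<beta> fst dd \<alpha> I M))
      \<longlongrightarrow> 2 powr \<beta> * (\<Sum>p\<in>I. (cmod (\<alpha> p))\<^sup>2 * (2 * dd p) powr (- \<beta>))) at_top"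
      by (simp only: Re_complex_of_real)
    from tendsto_upperbound[OF this] bound
    have "2 powr \<beta> * (\<Sum>p\<in>I. (cmod (\<alpha> p))\<^sup>2 * (2 * dd p) powr (- \<beta>)) \<le> N0\<^sup>2"
      by simp
    \<comment> \<open>The factor \<open>2 powr \<beta>\<close> from the boundary defect of
      \<open>w\<close> cancels the 2 in the diagonal base \<open>2 * dd p\<close>.\<close>
    also have "2 powr \<beta> * (\<Sum>p\<in>I. (cmod (\<alpha> p))\<^sup>2 * (2 * dd p) powr (- \<beta>)) = R"
      unfolding R_def sum_distrib_left
    proof (rule sum.cong[OF refl])
      fix p assume "p \<in> I"
      then have "(2 * dd p) powr (- \<beta>) = 2 powr (- \<beta>) * dd p powr (- \<beta>)"
        using Ip[of p] by (simp add: powr_mult)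
      then show "2 powr \<beta> * ((cmod (\<alpha> p))\<^sup>2 * (2 * dd p) powr (- \<beta>)) = (cmod (A p))\<^sup>2 * (1 / dd p powr \<beta>)"
        by (simp add: \<alpha>_def powr_minus_divide)
    qed
    finally show ?thesis by (simp add: N0_def)
  qed
  have R0: "0 \<le> R" unfolding R_def by (intro sum_nonneg) simp
  \<comment> \<open>The infimum runs over norms, not over their squares; hence the bound is proved
    for the root of \<open>R\<close> and squared afterwards.\<close>
  have "sqrt R \<le> ess_norm X T"
    unfolding ess_norm_def
  proof (rule cINF_greatest)
    show "{K. compact_op X K} \<noteq> {}" using compact_op_zero[of X] by blast
    fix K assume "K \<in> {K :: (complex ^ 'n \<Rightarrow> complex) \<Rightarrow> complex ^ 'n \<Rightarrow> complex. compact_op X K}"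
    then have K: "compact_op X K" by simp
    have "0 \<le> op_norm X (\<lambda>f z. T f z - K f z)"
      unfolding T_def by (rule bounded_compact_difference(2)[OF X bd K])
    then show "sqrt R \<le> op_norm X (\<lambda>f z. T f z - K f z)"
      by (intro real_le_lsqrt lower[OF K] R0)
  qed
  then have "(sqrt R)\<^sup>2 \<le> (ess_norm X T)\<^sup>2" using R0 by (intro power_mono) auto
  then show ?thesis using R0 unfolding R_eq T_def by simp
qed

end
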